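(* Let $n\ge 2$. Suppose the sequences $(k_j)_{j\in\mathbb{N}}$ and $(a_j)_{j\in\mathbb{N}}$ are positive, increasing and unbounded, and that $$\sum_{j=1}^\infty k_j^{-n}<\infty .$$ Then there exists a compact set $\Gamma\subset\mathbb{R}^n$, with $\Omega:=\mathbb{R}^n\setminus\Gamma$ connected, such that, for all $R>R_\Gamma:=\max_{x\in\Gamma}|x|$, it holds that $$C_{k_j,R}=\|\chi_R R(k_j)\chi_R\|_{L^2(\Omega)\to L^2(\Omega)}\ \ge\ a_j\qquad\text{for each } j\in\mathbb{N},$$ where $\chi_R R(k)\chi_R$ is the cut-off resolvent of the Dirichlet Laplacian on $\Omega$ (defined in the context).
   Context: Function spaces. For a non-empty open set $\Omega\subset\mathbb{R}^n$: $H^1(\Omega)=\{u\in L^2(\Omega):\nabla u\in (L^2(\Omega))^n\}$ (complex-valued functions, weak gradient); $H^1_0(\Omega)$ is the closure of $C_0^\infty(\Omega)$ in $H^1(\Omega)$; $H^1_0(\Delta,\Omega)=\{u\in H^1_0(\Omega):\Delta u\in L^2(\Omega)\}$; $L^2_{\mathrm{comp}}(\Omega)$ is the set of $f\in L^2(\Omega)$ with bounded support; $L^2_{\mathrm{loc}}(\Omega)$ is the set of functions on $\Omega$ whose restriction to every bounded measurable $V\subset\Omega$ lies in $L^2(V)$; $H^{1,\mathrm{loc}}(\Omega)=\{u\in L^2_{\mathrm{loc}}(\Omega):\nabla u\in(L^2_{\mathrm{loc}}(\Omega))^n\}$; $H^{1,\mathrm{loc}}_0(\Omega)=\{u\in H^{1,\mathrm{loc}}(\Omega):\chi|_\Omega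 u\in H^1_0(\Omega)\ \forall\chi\in C_0^\infty(\mathbb{R}^n)\}$; $H^{1,\mathrm{loc}}_0(\Delta,\Omega)=\{u\in H^{1,\mathrm{loc}}_0(\Omega):\chi|_\Omega u\in H^1_0(\Delta,\Omega)\ \forall\chi\in C_0^\infty(\mathbb{R}^n)\}$. Scattering problem. Let $\Gamma\subset\mathbb{R}^n$ be compact with $\Omega:=\mathbb{R}^n\setminus\Gamma$ connected, and let $k>0$. Given $f\in L^2_{\mathrm{comp}}(\Omega)$, find $u\in H^{1,\mathrm{loc}}_0(\Delta,\Omega)$ satisfying $\Delta u+k^2u=-f$ in $\Omega$ in the weak sense, and the Sommerfeld radiation condition $\frac{\partial u}{\partial r}(x)-\mathrm{i}ku(x)=o(r^{-(n-1)/2})$ as $r:=|x|\to\infty$, uniformly in $x/r$. It is well known that this problem is well-posed (exactly one solution for each $f$, depending continuously on $f$). Cut-off resolvent. For $k>0$, $R(k):L^2_{\mathrm{comp}}(\Omega)\to H^{1,\mathrm{loc}}_0(\Delta,\Omega)$ denotes the operator mapping $f$ to the solution $u$ of the scattering problem. For $R>R_\Gamma:=\max_{x\in\Gamma}|x|$, let $\Omega_R:=\{x\in\Omega:|x|<R\}$ and let $\chi_R$ be (multiplication by) the characteristic function of $\Omega_R$. Then $C_{k,R}:=\|\chi_RR(k)\chi_R\|_{L^2(\Omega)\to L^2(\Omega)}$; equivalently, $C_{k,R}$ is the smallest constant with $\|u\|_{L^2(\Omega_R)}\le C_{k,R}\|f\|_{L^2(\Omega_R)}$ for all $f\in L^2(\Omega)$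 vanishing outside $\Omega_R$, where $u$ is the solution of the scattering problem with data $f$. *)

theory Defs
  imports "HOL-Analysis.Analysis" "HOL-Library.Landau_Symbols"
begin

text \<open>
  Elements of the function spaces over an open set \<open>\<Omega>\<close> are represented by total functions
  \<open>'a \<Rightarrow> complex\<close>; only the values on \<open>\<Omega>\<close>, and these only up to null sets, matter.
\<close>

section \<open>Smooth functions and test functions\<close>

definition partial_deriv :: "'a::euclidean_space \<Rightarrow> ('a \<Rightarrow> complex) \<Rightarrow> 'a \<Rightarrow> complex" where
  "partial_deriv b f x = frechet_derivative f (at x) b"

definition laplacian :: "('a::euclidean_space \<Rightarrow> complex) \<Rightarrow> 'a \<Rightarrow> complex" where
  "laplacian f x = (\<Sum>b\<in>Basis. partial_deriv b (partial_deriv b f) x)"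

primrec C_k :: "nat \<Rightarrow> ('a::euclidean_space \<Rightarrow> complex) \<Rightarrow> bool" where
  "C_k 0 f \<longleftrightarrow> continuous_on UNIV f"
| "C_k (Suc m) f \<longleftrightarrow> (\<forall>x. f differentiable (at x)) \<and> (\<forall>b\<in>Basis. C_k m (partial_deriv b f))"

definition test_functions :: "'a::euclidean_space set \<Rightarrow> ('a \<Rightarrow> complex) set" where
  "test_functions \<Omega> =
    {\<phi>. (\<forall>m. C_k m \<phi>) \<and> compact (closure {x. \<phi> x \<noteq> 0}) \<and> closure {x. \<phi> x \<noteq> 0} \<subseteq> \<Omega>}"

section \<open>Lebesgue spaces\<close>

definition L2 :: "'a::euclidean_space set \<Rightarrow> ('a \<Rightarrow> complex) set" where
  "L2 \<Omega> = {f \<in> borel_measurable (lebesgue_on \<Omega>).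
             integrable (lebesgue_on \<Omega>) (\<lambda>x. (cmod (f x))\<^sup>2)}"

definition L2_norm :: "'a::euclidean_space set \<Rightarrow> ('a \<Rightarrow> complex) \<Rightarrow> real" where
  "L2_norm \<Omega> f = sqrt (LINT x|lebesgue_on \<Omega>. (cmod (f x))\<^sup>2)"

definition L2_comp :: "'a::euclidean_space set \<Rightarrow> ('a \<Rightarrow> complex) set" where
  "L2_comp \<Omega> = {f \<in> L2 \<Omega>. \<exists>r. AE x in lebesgue_on \<Omega>. norm x > r \<longrightarrow> f x = 0}"

text \<open>Square integrability is required up to the boundary of \<open>\<Omega>\<close>, not only on compact subsets.\<close>

definition L2_loc :: "'a::euclidean_space set \<Rightarrow> ('a \<Rightarrow> complex) set" where
  "L2_loc \<Omega> = {f. \<forall>V\<in>sets lebesgue. bounded V \<and> V \<subseteq> \<Omega> \<longrightarrow> f \<in> L2 V}"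

section \<open>Weak derivatives and Sobolev spaces\<close>

text \<open>
  The two relations below are only used for functions in \<open>L2_loc \<Omega>\<close>, for which all the
  integrands are integrable.
\<close>

definition has_weak_deriv ::
    "'a::euclidean_space set \<Rightarrow> 'a \<Rightarrow> ('a \<Rightarrow> complex) \<Rightarrow> ('a \<Rightarrow> complex) \<Rightarrow> bool" where
  "has_weak_deriv \<Omega> b u g \<longleftrightarrow> (\<forall>\<phi>\<in>test_functions \<Omega>.
     (LINT x|lebesgue_on \<Omega>. u x * partial_deriv b \<phi> x) = - (LINT x|lebesgue_on \<Omega>. g x * \<phi> x))"

definition has_weak_laplacian ::
    "'a::euclidean_space set \<Rightarrow> ('a \<Rightarrow> complex) \<Rightarrow> ('a \<Rightarrow> complex) \<Rightarrow> bool" where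
  "has_weak_laplacian \<Omega> u h \<longleftrightarrow> (\<forall>\<phi>\<in>test_functions \<Omega>.
     (LINT x|lebesgue_on \<Omega>. u x * laplacian \<phi> x) = (LINT x|lebesgue_on \<Omega>. h x * \<phi> x))"

definition H1 :: "'a::euclidean_space set \<Rightarrow> ('a \<Rightarrow> complex) set" where
  "H1 \<Omega> = {u \<in> L2 \<Omega>. \<forall>b\<in>Basis. \<exists>g\<in>L2 \<Omega>. has_weak_deriv \<Omega> b u g}"

text \<open>For \<open>u \<in> H1 \<Omega>\<close> the choice is unique up to null sets.\<close>

definition weak_deriv ::
    "'a::euclidean_space set \<Rightarrow> 'a \<Rightarrow> ('a \<Rightarrow> complex) \<Rightarrow> 'a \<Rightarrow> complex" where
  "weak_deriv \<Omega> b u = (SOME g. g \<in> L2 \<Omega> \<and> has_weak_deriv \<Omega> b u g)"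

definition H1_norm :: "'a::euclidean_space set \<Rightarrow> ('a \<Rightarrow> complex) \<Rightarrow> real" where
  "H1_norm \<Omega> u = sqrt ((L2_norm \<Omega> u)\<^sup>2 + (\<Sum>b\<in>Basis. (L2_norm \<Omega> (weak_deriv \<Omega> b u))\<^sup>2))"

definition H10 :: "'a::euclidean_space set \<Rightarrow> ('a \<Rightarrow> complex) set" where
  "H10 \<Omega> = {u \<in> H1 \<Omega>. \<forall>\<epsilon>>0. \<exists>\<phi>\<in>test_functions \<Omega>. H1_norm \<Omega> (\<lambda>x. u x - \<phi> x) < \<epsilon>}"

definition H10_Laplace :: "'a::euclidean_space set \<Rightarrow> ('a \<Rightarrow> complex) set" where
  "H10_Laplace \<Omega> = {u \<in> H10 \<Omega>. \<exists>h\<in>L2 \<Omega>. has_weak_laplacian \<Omega> u h}"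

definition H1_loc :: "'a::euclidean_space set \<Rightarrow> ('a \<Rightarrow> complex) set" where
  "H1_loc \<Omega> = {u \<in> L2_loc \<Omega>. \<forall>b\<in>Basis. \<exists>g\<in>L2_loc \<Omega>. has_weak_deriv \<Omega> b u g}"

definition H10_loc :: "'a::euclidean_space set \<Rightarrow> ('a \<Rightarrow> complex) set" where
  "H10_loc \<Omega> = {u \<in> H1_loc \<Omega>. \<forall>\<eta>\<in>test_functions UNIV. (\<lambda>x. \<eta> x * u x) \<in> H10 \<Omega>}"

definition H10_loc_Laplace :: "'a::euclidean_space set \<Rightarrow> ('a \<Rightarrow> complex) set" where
  "H10_loc_Laplace \<Omega> =
    {u \<in> H10_loc \<Omega>. \<forall>\<eta>\<in>test_functions UNIV. (\<lambda>x. \<eta> x * u x) \<in> H10_Laplace \<Omega>}"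

section \<open>The scattering problem and its cut-off resolvent\<close>

text \<open>
  The radiation condition is a pointwise condition, so it is imposed on the (unique) continuous
  representative \<open>v\<close> of \<open>u\<close> near infinity, which for a solution of the scattering problem exists
  and is smooth by elliptic regularity. The filter \<open>at_infinity\<close> expresses uniformity in the
  direction \<open>x / norm x\<close>.
\<close>

definition radiation_condition ::
    "'a::euclidean_space set \<Rightarrow> real \<Rightarrow> ('a \<Rightarrow> complex) \<Rightarrow> bool" where
  "radiation_condition \<Omega> k u \<longleftrightarrow> (\<exists>v r\<^sub>0.
     (AE x in lebesgue_on \<Omega>. norm x > r\<^sub>0 \<longrightarrow> u x = v x) \<and>
     (\<forall>x. norm x > r\<^sub>0 \<longrightarrow> v differentiable (at x)) \<and>
     (\<lambda>x. frechet_derivative v (at x) (x /\<^sub>R norm x) - \<i> * complex_of_real k * v x)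
       \<in> o[at_infinity](\<lambda>x. complex_of_real (norm x powr (- (real DIM('a) - 1) / 2))))"

definition scattering_solution ::
    "'a::euclidean_space set \<Rightarrow> real \<Rightarrow> ('a \<Rightarrow> complex) \<Rightarrow> ('a \<Rightarrow> complex) \<Rightarrow> bool" where
  "scattering_solution \<Omega> k f u \<longleftrightarrow>
     u \<in> H10_loc_Laplace \<Omega> \<and>
     has_weak_laplacian \<Omega> u (\<lambda>x. - f x - complex_of_real (k\<^sup>2) * u x) \<and>
     radiation_condition \<Omega> k u"

text \<open>
  Since functions represent classes modulo null sets, the resolvent \<open>R(k)\<close>, which maps \<open>f\<close> to the
  solution of the scattering problem with data \<open>f\<close>, is given by its graph. When \<open>\<Omega>\<close> is connected
  with compact complement and \<open>k > 0\<close>, the scattering problem is well-posed, so that this is the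
  graph of an operator defined on all of \<open>L2_comp \<Omega>\<close> and single-valued modulo null sets.
\<close>

definition resolvent ::
    "'a::euclidean_space set \<Rightarrow> real \<Rightarrow> (('a \<Rightarrow> complex) \<times> ('a \<Rightarrow> complex)) set" where
  "resolvent \<Omega> k = {(f, u). f \<in> L2_comp \<Omega> \<and> scattering_solution \<Omega> k f u}"

definition cutoff :: "'a::euclidean_space set \<Rightarrow> real \<Rightarrow> ('a \<Rightarrow> complex) \<Rightarrow> 'a \<Rightarrow> complex" where
  "cutoff \<Omega> R f x = indicator {x \<in> \<Omega>. norm x < R} x * f x"

definition cutoff_resolvent ::
    "'a::euclidean_space set \<Rightarrow> real \<Rightarrow> real \<Rightarrow> (('a \<Rightarrow> complex) \<times> ('a \<Rightarrow> complex)) set" where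
  "cutoff_resolvent \<Omega> k R =
    {(f, cutoff \<Omega> R u) | f u. f \<in> L2 \<Omega> \<and> (cutoff \<Omega> R f, u) \<in> resolvent \<Omega> k}"

text \<open>
  The norm on \<open>L2 \<Omega>\<close> of an operator given by its graph: the smallest admissible constant, as an
  extended real, so that it would be infinite (rather than unspecified) for an unbounded operator.
\<close>

definition L2_opnorm ::
    "'a::euclidean_space set \<Rightarrow> (('a \<Rightarrow> complex) \<times> ('a \<Rightarrow> complex)) set \<Rightarrow> ereal" where
  "L2_opnorm \<Omega> T =
    Inf {ereal C | C. C \<ge> 0 \<and> (\<forall>(f, g)\<in>T. L2_norm \<Omega> g \<le> C * L2_norm \<Omega> f)}"

end

theory Submission
  imports Defs "HOL-Computational_Algebra.Polynomial"
begin

text \<open>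
  Since the resolvent is only bounded from below, no well-posedness is needed: for each \<open>j\<close> it
  suffices to exhibit one solution \<open>u\<close> that is large compared with its data \<open>f\<close>, and a compactly
  supported \<open>u\<close> satisfies the radiation condition trivially. Take a cube whose lowest Dirichlet
  eigenvalue is \<open>(k j)\<^sup>2\<close>, open it to the exterior only near one corner, and multiply the
  eigenfunction by a cut-off vanishing near that corner. As the eigenfunction vanishes to second
  order there, the residual is bounded independently of the scale of the cut-off and concentrates
  at the corner, so its \<open>L\<^sup>2\<close> norm is as small as desired when the aperture shrinks. The cube has
  volume proportional to \<open>k j powi (- n)\<close>, so the cubes for all \<open>j\<close> fit into a bounded region.
\<close>

section \<open>Smooth functions\<close>

text \<open>The aperture sits at a corner because of a count of powers. With a cut-off at scale
  \<delta>, the terms in which derivatives fall on the cut-off have size \<delta>^(-2) |v| and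
  \<delta>^(-1) |grad v|. Near an interior point of a face the mode v vanishes only to first order;
  these terms are then of size 1/\<delta> on a volume \<delta>^n, and for n = 2 this estimate gives
  no decay of the L2 norm. At a corner all n \<ge> 2 sine factors vanish. The product of mode and
  cut-off, extended by zero, has a kink across the walls of the cube. First weak derivatives do not
  notice it, as the mode is zero there; the weak Laplacian would, but the exterior domain meets the
  walls only where the cut-off is already zero. One domain has to serve all j. Each aperture is
  therefore chosen from the cube and the bound \<open>a j\<close> alone, uniformly over all domains
  that contain the cube and meet its walls only inside the aperture. The side solves n (pi/L)^2 =
  k^2, that is, L = pi sqrt(n) / k.\<close>

definition smooth :: "('a::euclidean_space \<Rightarrow> complex) \<Rightarrow> bool" where
  "smooth f \<longleftrightarrow> (\<forall>m. C_k m f)"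

lemma partial_deriv_eq: "(f has_derivative D) (at x) \<Longrightarrow> partial_deriv b f x = D b"
  unfolding partial_deriv_def using frechet_derivative_at by metis

lemma has_derivative_partial:
  "f differentiable (at x) \<Longrightarrow> (f has_derivative frechet_derivative f (at x)) (at x)"
  using frechet_derivative_works by blast

lemma C_k_SucD: "C_k (Suc m) f \<Longrightarrow> C_k m f"
proof (induction m arbitrary: f)
  case 0
  then show ?case
    by (auto intro!: differentiable_imp_continuous_on simp: differentiable_on_def)
next
  case (Suc m)
  then show ?case by (metis C_k.simps(2))
qed

lemma smooth_differentiable: "smooth f \<Longrightarrow> f differentiable (at x)"
  unfolding smooth_def by (metis C_k.simps(2))

lemma smooth_partial_deriv: "smooth f \<Longrightarrow> b \<in> Basis \<Longrightarrow> smooth (partial_deriv b f)"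
  unfolding smooth_def by (metis C_k.simps(2))

lemma smooth_continuous_on: "smooth f \<Longrightarrow> continuous_on S f"
  unfolding smooth_def using continuous_on_subset by (metis C_k.simps(1) subset_UNIV)

lemma smooth_borel_measurable: "smooth f \<Longrightarrow> f \<in> borel_measurable borel"
  using smooth_continuous_on borel_measurable_continuous_onI by blast

lemma C_k_const: "C_k m (\<lambda>x. c)"
proof (induction m arbitrary: c)
  case (Suc m)
  have "partial_deriv b (\<lambda>x::'a. c) = (\<lambda>x. 0)" for b
    by (rule ext, rule partial_deriv_eq[OF has_derivative_const])
  then show ?case using Suc by simp
qed simp

lemma partial_deriv_add:
  assumes "f differentiable (at x)" "g differentiable (at x)"
  shows "partial_deriv b (\<lambda>x. f x + g x) x = partial_deriv b f x + partial_deriv b g x"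
  using partial_deriv_eq[OF has_derivative_add[OF assms[THEN has_derivative_partial]]]
  by (simp add: partial_deriv_def)

lemma partial_deriv_mult:
  assumes "f differentiable (at x)" "g differentiable (at x)"
  shows "partial_deriv b (\<lambda>x. f x * g x) x = f x * partial_deriv b g x + partial_deriv b f x * g x"
  using partial_deriv_eq[OF has_derivative_mult[OF assms[THEN has_derivative_partial]]]
  by (simp add: partial_deriv_def)

lemma C_k_add: "C_k m f \<Longrightarrow> C_k m g \<Longrightarrow> C_k m (\<lambda>x. f x + g x)"
proof (induction m arbitrary: f g)
  case 0
  then show ?case by (simp add: continuous_on_add)
next
  case (Suc m)
  then have "partial_deriv b (\<lambda>x. f x + g x) = (\<lambda>x. partial_deriv b f x + partial_deriv b g x)" for b
    by (intro ext partial_deriv_add) auto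
  with Suc show ?case by simp
qed

lemma C_k_mult: "C_k m f \<Longrightarrow> C_k m g \<Longrightarrow> C_k m (\<lambda>x. f x * g x)"
proof (induction m arbitrary: f g)
  case 0
  then show ?case by (simp add: continuous_on_mult)
next
  case (Suc m)
  then have "partial_deriv b (\<lambda>x. f x * g x)
      = (\<lambda>x. f x * partial_deriv b g x + partial_deriv b f x * g x)" for b
    by (intro ext partial_deriv_mult) auto
  moreover have "C_k m f" "C_k m g" using Suc.prems C_k_SucD by auto
  ultimately show ?case using Suc.prems Suc.IH by (auto intro!: C_k_add)
qed

lemma smooth_const [intro]: "smooth (\<lambda>x. c)"
  by (simp add: smooth_def C_k_const)

lemma smooth_add [intro]: "smooth f \<Longrightarrow> smooth g \<Longrightarrow> smooth (\<lambda>x. f x + g x)"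
  by (simp add: smooth_def C_k_add)

lemma smooth_mult [intro]: "smooth f \<Longrightarrow> smooth g \<Longrightarrow> smooth (\<lambda>x. f x * g x)"
  by (simp add: smooth_def C_k_mult)

lemma smooth_prod: "(\<And>i. i \<in> A \<Longrightarrow> smooth (f i)) \<Longrightarrow> smooth (\<lambda>x. \<Prod>i\<in>A. f i x)"
  by (induction A rule: infinite_finite_induct) auto

lemma smooth_sum: "(\<And>i. i \<in> A \<Longrightarrow> smooth (f i)) \<Longrightarrow> smooth (\<lambda>x. \<Sum>i\<in>A. f i x)"
  by (induction A rule: infinite_finite_induct) auto

lemma smooth_laplacian: "smooth f \<Longrightarrow> smooth (laplacian f)"
  unfolding laplacian_def [abs_def] by (intro smooth_sum smooth_partial_deriv)

lemma smooth_inner: "smooth (\<lambda>x. of_real (x \<bullet> b))"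
proof -
  have d: "((\<lambda>x. complex_of_real (x \<bullet> b)) has_derivative (\<lambda>h. of_real (h \<bullet> b))) (at x)" for x :: 'a
    by (intro has_derivative_of_real derivative_eq_intros) auto
  have p: "partial_deriv c (\<lambda>x. complex_of_real (x \<bullet> b)) = (\<lambda>x. of_real (c \<bullet> b))" for c
    by (rule ext, rule partial_deriv_eq[OF d])
  have "C_k (Suc m) (\<lambda>x. complex_of_real (x \<bullet> b))" for m
    using d by (auto simp: p C_k_const differentiable_def)
  then show ?thesis unfolding smooth_def using C_k_SucD by blast
qed

text \<open>An explicit tower of derivatives: differentiating the outer function once just drops the
  first entry, which is the form that the induction in \<open>C_k_compose_real\<close>
  consumes.\<close>

definition smooth_real :: "(real \<Rightarrow> real) \<Rightarrow> bool" where
  "smooth_real f \<longleftrightarrow>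
     (\<exists>d. d 0 = f \<and> (\<forall>m t. (d m has_real_derivative d (Suc m) t) (at t)))"

lemma smooth_realE:
  assumes "smooth_real f"
  obtains f' where "\<And>t. (f has_real_derivative f' t) (at t)" "smooth_real f'"
proof -
  obtain d where "d 0 = f" "\<forall>m t. (d m has_real_derivative d (Suc m) t) (at t)"
    using assms unfolding smooth_real_def by blast
  then show thesis
    by (intro that[of "d 1"]) (auto simp: smooth_real_def intro!: exI[of _ "\<lambda>m. d (Suc m)"])
qed

lemma differentiable_of_realD:
  assumes "(\<lambda>x. complex_of_real (w x)) differentiable (at x)"
  shows "w differentiable (at x)"
proof -
  obtain D where "((\<lambda>x. complex_of_real (w x)) has_derivative D) (at x)"
    using assms by (auto simp: differentiable_def)
  from has_derivative_Re[OF this] show ?thesis by (auto simp: differentiable_def)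
qed

text \<open>\<open>partial_deriv\<close> acts on complex-valued functions only, so the real inner
  function \<open>w\<close> enters through its embedding into the complex numbers.\<close>

lemma has_derivative_compose_real:
  assumes F: "\<And>t. (F has_real_derivative F' t) (at t)"
    and w: "(\<lambda>x. complex_of_real (w x)) differentiable (at x)"
  shows "(\<lambda>x. complex_of_real (F (w x))) differentiable (at x)"
    and "partial_deriv b (\<lambda>x. complex_of_real (F (w x))) x
      = of_real (F' (w x)) * partial_deriv b (\<lambda>x. of_real (w x)) x"
proof -
  obtain D where D: "(w has_derivative D) (at x)"
    using differentiable_of_realD[OF w] by (auto simp: differentiable_def)
  have 1: "((\<lambda>x. F (w x)) has_derivative (\<lambda>h. F' (w x) * D h)) (at x)"
    using has_derivative_compose[OF D F[unfolded has_field_derivative_def]] by simp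
  note 2 = has_derivative_of_real[OF 1, where 'a=complex]
  show "(\<lambda>x. complex_of_real (F (w x))) differentiable (at x)"
    using 2 by (auto simp: differentiable_def)
  show "partial_deriv b (\<lambda>x. complex_of_real (F (w x))) x
      = of_real (F' (w x)) * partial_deriv b (\<lambda>x. of_real (w x)) x"
    using partial_deriv_eq[OF 2] partial_deriv_eq[OF has_derivative_of_real[OF D, where 'a=complex]]
    by simp
qed

text \<open>By the chain rule a partial derivative is \<open>F' (w x)\<close> times one of
  \<open>w\<close>. Since \<open>F'\<close> is again \<open>smooth_real\<close>, the induction runs
  over all \<open>F\<close> at once.\<close>

lemma C_k_compose_real:
  assumes "smooth_real F" "C_k m (\<lambda>x. complex_of_real (w x))"
  shows "C_k m (\<lambda>x. complex_of_real (F (w x)))"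
  using assms
proof (induction m arbitrary: F)
  case 0
  obtain F' where F': "\<And>t. (F has_real_derivative F' t) (at t)"
    using smooth_realE[OF 0(1)] by blast
  then have c: "continuous_on UNIV F"
    by (auto intro!: continuous_at_imp_continuous_on DERIV_isCont)
  have "continuous_on UNIV (\<lambda>x. Re (complex_of_real (w x)))"
    using 0 by (intro continuous_intros) simp
  then have "continuous_on UNIV (\<lambda>x. F (w x))"
    using continuous_on_compose2[OF c] by simp
  then show ?case by (auto intro: continuous_intros)
next
  case (Suc m)
  obtain F' where F': "\<And>t. (F has_real_derivative F' t) (at t)" "smooth_real F'"
    using smooth_realE[OF Suc.prems(1)] by blast
  have w: "(\<lambda>x. complex_of_real (w x)) differentiable (at x)" for x
    using Suc.prems by simp
  have "C_k m (\<lambda>x. complex_of_real (F' (w x)))"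
    using Suc F' C_k_SucD by blast
  then have "C_k m (\<lambda>x. of_real (F' (w x)) * partial_deriv b (\<lambda>x. of_real (w x)) x)" if "b \<in> Basis" for b
    using Suc.prems that by (intro C_k_mult) auto
  moreover have "partial_deriv b (\<lambda>x. complex_of_real (F (w x)))
      = (\<lambda>x. of_real (F' (w x)) * partial_deriv b (\<lambda>x. of_real (w x)) x)" for b
    using has_derivative_compose_real(2)[OF F'(1) w] by (rule ext)
  ultimately show ?case
    using has_derivative_compose_real(1)[OF F'(1) w] by simp
qed

lemma smooth_compose_real:
  "smooth_real F \<Longrightarrow> smooth (\<lambda>x. complex_of_real (w x)) \<Longrightarrow> smooth (\<lambda>x. complex_of_real (F (w x)))"
  by (simp add: smooth_def C_k_compose_real)

section \<open>Locality of derivatives and gluing over an open cover\<close>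

lemma partial_deriv_cong_open:
  assumes "open S" "x \<in> S" "\<And>y. y \<in> S \<Longrightarrow> f y = g y"
  shows "f differentiable (at x) \<longleftrightarrow> g differentiable (at x)"
    and "partial_deriv b f x = partial_deriv b g x"
proof -
  \<comment> \<open>The two predicates on \<open>D\<close> coincide, so the choice in
    \<open>frechet_derivative\<close> picks the same map even where no derivative exists.\<close>
  have "(f has_derivative D) (at x) \<longleftrightarrow> (g has_derivative D) (at x)" for D
    using has_derivative_transform_within_open[OF _ assms(1,2)] assms(3) by metis
  then show "f differentiable (at x) \<longleftrightarrow> g differentiable (at x)"
    "partial_deriv b f x = partial_deriv b g x"
    unfolding differentiable_def partial_deriv_def frechet_derivative_def by auto
qed

lemma laplacian_cong_open:
  assumes "open S" "x \<in> S" "\<And>y. y \<in> S \<Longrightarrow> f y = g y"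
  shows "laplacian f x = laplacian g x"
  unfolding laplacian_def
  by (intro sum.cong refl partial_deriv_cong_open(2)[OF assms(1,2)])
    (rule partial_deriv_cong_open(2)[OF assms(1) _ assms(3)])

text \<open>Agreement on an open set passes to the partial derivatives there, so the hypotheses
  reproduce themselves one order lower.\<close>

lemma C_k_glue:
  assumes "open A" "open B" "A \<union> B = UNIV"
    "\<And>x. x \<in> A \<Longrightarrow> f x = g x" "\<And>x. x \<in> B \<Longrightarrow> f x = h x" "C_k m g" "C_k m h"
  shows "C_k m f"
  using assms(4-7)
proof (induction m arbitrary: f g h)
  case 0
  have "continuous_on A f" "continuous_on B f"
    using 0 by (metis C_k.simps(1) continuous_on_cong continuous_on_subset subset_UNIV)+
  then show ?case using continuous_on_open_Un[OF assms(1,2)] assms(3) by auto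
next
  case (Suc m)
  have "f differentiable (at x)" for x
    using Suc.prems assms(1-3) partial_deriv_cong_open(1)
    by (metis C_k.simps(2) UNIV_I Un_iff)
  moreover have "C_k m (partial_deriv b f)" if b: "b \<in> Basis" for b
  proof (rule Suc.IH)
    show "partial_deriv b f x = partial_deriv b g x" if "x \<in> A" for x
      using partial_deriv_cong_open(2)[OF assms(1) that] Suc.prems by blast
    show "partial_deriv b f x = partial_deriv b h x" if "x \<in> B" for x
      using partial_deriv_cong_open(2)[OF assms(2) that] Suc.prems by blast
  qed (use Suc.prems b in auto)
  ultimately show ?case by simp
qed

lemma smooth_glue:
  assumes "open A" "open B" "A \<union> B = UNIV"
    "\<And>x. x \<in> A \<Longrightarrow> f x = g x" "\<And>x. x \<in> B \<Longrightarrow> f x = h x" "smooth g" "smooth h"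
  shows "smooth f"
  unfolding smooth_def
  by (intro allI C_k_glue[OF assms(1-5)] assms(6,7)[unfolded smooth_def, rule_format])

section \<open>A smooth step\<close>

text \<open>The polynomial factor makes the family closed under differentiation: with s = 1/t, the
  polynomial p(s) is replaced by s^2 (p(s) - p'(s)). Iterating this map yields the whole tower of
  derivatives.\<close>

definition exp_inv_poly :: "real poly \<Rightarrow> real \<Rightarrow> real" where
  "exp_inv_poly p t = (if t > 0 then poly p (1 / t) * exp (- (1 / t)) else 0)"

lemma poly_exp_neg_tendsto_0: "((\<lambda>y::real. poly p y * exp (- y)) \<longlongrightarrow> 0) at_top"
proof -
  have "((\<lambda>y::real. \<Sum>i\<le>degree p. coeff p i * (y ^ i / exp y)) \<longlongrightarrow> (\<Sum>i\<le>degree p. coeff p i * 0)) at_top"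
    by (intro tendsto_sum tendsto_mult tendsto_const tendsto_power_div_exp_0)
  moreover have "(\<Sum>i\<le>degree p. coeff p i * (y ^ i / exp y)) = poly p y * exp (- y)" for y
    by (simp add: poly_altdef exp_minus sum_distrib_right divide_simps)
  ultimately show ?thesis by simp
qed

lemma exp_inv_poly_deriv:
  "(exp_inv_poly p has_real_derivative exp_inv_poly ([:0, 0, 1:] * (p - pderiv p)) t) (at t)"
proof (cases "t = 0")
  case False
  show ?thesis
  proof (cases "t > 0")
    case True
    have "((\<lambda>t. poly p (1 / t) * exp (- (1 / t))) has_real_derivative
        exp_inv_poly ([:0, 0, 1:] * (p - pderiv p)) t) (at t)"
    proof -
      have i: "((\<lambda>t. 1 / t) has_real_derivative - (1 / t\<^sup>2)) (at t)"
        using True by (auto intro!: derivative_eq_intros simp: power2_eq_square)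
      have 1: "((\<lambda>t. poly p (1 / t)) has_real_derivative poly (pderiv p) (1 / t) * - (1 / t\<^sup>2)) (at t)"
        using DERIV_chain2[OF poly_DERIV i] .
      have 2: "((\<lambda>t. exp (- (1 / t))) has_real_derivative exp (- (1 / t)) * (1 / t\<^sup>2)) (at t)"
        using DERIV_chain2[OF DERIV_exp DERIV_minus[OF i]] by simp
      show ?thesis
        by (rule DERIV_cong[OF DERIV_mult[OF 1 2]])
          (use True in \<open>simp add: exp_inv_poly_def algebra_simps power2_eq_square\<close>)
    qed
    then show ?thesis
      using True by (elim has_field_derivative_transform_within_open[where S="{0<..}"])
        (auto simp: exp_inv_poly_def)
  next
    case neg: False
    have "((\<lambda>t. 0) has_real_derivative exp_inv_poly ([:0, 0, 1:] * (p - pderiv p)) t) (at t)"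
      using neg by (simp add: exp_inv_poly_def)
    then show ?thesis
      using neg False by (elim has_field_derivative_transform_within_open[where S="{..<0}"])
        (auto simp: exp_inv_poly_def)
  qed
next
  case True
  \<comment> \<open>Dividing by \<open>t\<close> multiplies the polynomial in 1/t by its variable,
    hence \<open>pCons 0 p\<close>; the right difference quotient is again a polynomial times a
    decaying exponential.\<close>
  have "((\<lambda>t. exp_inv_poly p t / t) \<longlongrightarrow> 0) (at_right 0)"
  proof -
    have "((\<lambda>t. poly (pCons 0 p) (inverse t) * exp (- inverse t)) \<longlongrightarrow> 0) (at_right 0)"
      using filterlim_compose[OF poly_exp_neg_tendsto_0[of "pCons 0 p"] filterlim_inverse_at_top_right] .
    moreover have "\<forall>\<^sub>F t in at_right 0. poly (pCons 0 p) (inverse t) * exp (- inverse t) = exp_inv_poly p t / t"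
      using eventually_at_right_less[of "0::real"]
      by eventually_elim (simp add: exp_inv_poly_def inverse_eq_divide)
    ultimately show ?thesis by (rule Lim_transform_eventually)
  qed
  moreover have "((\<lambda>t. exp_inv_poly p t / t) \<longlongrightarrow> 0) (at_left 0)"
    by (rule tendsto_eventually)
      (use eventually_at_left_real[of "-1" "0::real"] in \<open>auto simp: exp_inv_poly_def elim!: eventually_mono\<close>)
  ultimately have "((\<lambda>t. exp_inv_poly p t / t) \<longlongrightarrow> 0) (at 0)"
    using filterlim_split_at by blast
  then show ?thesis using True by (simp add: has_field_derivative_iff exp_inv_poly_def)
qed

lemma smooth_real_exp_inv_poly: "smooth_real (exp_inv_poly p)"
  unfolding smooth_real_def
  by (intro exI[of _ "\<lambda>m. exp_inv_poly (((\<lambda>p. [:0, 0, 1:] * (p - pderiv p)) ^^ m) p)"] conjI allI)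
    (simp, simp only: funpow.simps o_apply, rule exp_inv_poly_deriv)

lemma smooth_real_affine: "smooth_real (\<lambda>t. c + d * t)"
proof -
  have "((\<lambda>t. (if m = 0 then c + d * t else if m = 1 then d else 0)) has_real_derivative
      (if Suc m = 0 then c + d * t else if Suc m = 1 then d else 0)) (at t)" for m t
    by (cases m) (auto intro!: derivative_eq_intros)
  then show ?thesis unfolding smooth_real_def
    by (intro exI[of _ "\<lambda>m t. if m = 0 then c + d * t else if m = 1 then d else 0"]) auto
qed

text \<open>Products and compositions are treated once, for \<open>C_k\<close>. Iterating
  \<open>partial_deriv 1\<close> and taking real parts turns the outcome into a tower, without a
  Leibniz formula for towers.\<close>

lemma smooth_real_of_smooth:
  assumes "smooth (\<lambda>t::real. complex_of_real (f t))"
  shows "smooth_real f"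
proof -
  define G where "G m = (partial_deriv 1 ^^ m) (\<lambda>t::real. complex_of_real (f t))" for m
  have sm: "smooth (G m)" for m
    by (induction m) (auto simp: G_def assms smooth_partial_deriv)
  have "((\<lambda>t. Re (G m t)) has_real_derivative Re (G (Suc m) t)) (at t)" for m t
  proof -
    let ?D = "frechet_derivative (G m) (at t)"
    have D: "(G m has_derivative ?D) (at t)"
      using sm smooth_differentiable frechet_derivative_works by blast
    have "?D s = of_real s * G (Suc m) t" for s
      using linear_scale[OF has_derivative_linear[OF D], of s 1]
      by (simp add: G_def partial_deriv_def scaleR_conv_of_real)
    then have "Re (?D s) = Re (G (Suc m) t) * s" for s by simp
    with has_derivative_Re[OF D] show ?thesis
      by (simp add: has_field_derivative_def)
  qed
  then show ?thesis
    unfolding smooth_real_def by (intro exI[of _ "\<lambda>m t. Re (G m t)"]) (simp add: G_def)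
qed

lemma smooth_id_real: "smooth complex_of_real"
  using smooth_inner[of "1::real"] by simp

text \<open>
  The inner function is at least \<open>exp (- 1)\<close> for \<open>t \<le> 1\<close> and vanishes for \<open>t \<ge> 2\<close>, so
  that a step which is exactly constant on both sides arises by composition.
\<close>

definition smooth_step :: "real \<Rightarrow> real" where
  "smooth_step t = exp_inv_poly 1 (exp (- 1) + (- 1) * exp_inv_poly 1 (2 + (- 1) * t))
     * inverse (exp_inv_poly 1 (exp (- 1)))"

lemma exp_inv_poly_1_mono: "s \<le> t \<Longrightarrow> exp_inv_poly 1 s \<le> exp_inv_poly 1 t"
  by (auto simp: exp_inv_poly_def divide_simps)

lemma exp_inv_poly_1_nonneg: "0 \<le> exp_inv_poly 1 s"
  by (auto simp: exp_inv_poly_def)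

lemma smooth_real_step: "smooth_real smooth_step"
proof -
  have "smooth (\<lambda>t. complex_of_real (smooth_step t))"
    unfolding smooth_step_def of_real_mult
    by (intro smooth_mult smooth_const smooth_compose_real[OF smooth_real_exp_inv_poly]
        smooth_compose_real[OF smooth_real_affine] smooth_id_real)
  then show ?thesis by (rule smooth_real_of_smooth)
qed

lemma smooth_step_eq_0: "t \<le> 1 \<Longrightarrow> smooth_step t = 0"
  \<comment> \<open>\<open>exp_inv_poly 1 1\<close> equals \<open>exp (- 1)\<close>, so monotonicity
    makes the argument of the outer function nonpositive.\<close>
  using exp_inv_poly_1_mono[of 1 "2 - t"]
  by (auto simp: smooth_step_def exp_inv_poly_def)

lemma smooth_step_eq_1: "t \<ge> 2 \<Longrightarrow> smooth_step t = 1"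
  by (auto simp: smooth_step_def exp_inv_poly_def)

lemma smooth_step_bounds: "0 \<le> smooth_step t" "smooth_step t \<le> 1"
proof -
  have p: "0 < exp_inv_poly 1 (exp (- 1))" by (simp add: exp_inv_poly_def)
  show "0 \<le> smooth_step t"
    unfolding smooth_step_def using p exp_inv_poly_1_nonneg
    by (intro mult_nonneg_nonneg) auto
  have "exp_inv_poly 1 (exp (- 1) + (- 1) * exp_inv_poly 1 (2 + (- 1) * t)) \<le> exp_inv_poly 1 (exp (- 1))"
    using exp_inv_poly_1_nonneg by (intro exp_inv_poly_1_mono) simp
  with p show "smooth_step t \<le> 1"
    unfolding smooth_step_def by (simp add: divide_simps flip: divide_inverse)
qed

lemma smooth_step_abs_le: "\<bar>smooth_step t\<bar> \<le> 1"
  using smooth_step_bounds[of t] by simp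

text \<open>The weighted bounds are the scale-invariant ones: the derivatives of step(M s) are M
  h1(M s) and M^2 h2(M s), so multiplied by s and s^2 they are bounded uniformly in M. They hold
  because both derivatives vanish outside [1, 2] and are continuous there.\<close>

lemma smooth_step_derivs:
  obtains h1 h2 C where "\<And>t. (smooth_step has_real_derivative h1 t) (at t)"
    "\<And>t. (h1 has_real_derivative h2 t) (at t)" "smooth_real h1" "smooth_real h2"
    "\<And>t. t > 2 \<Longrightarrow> h1 t = 0" "\<And>t. t > 2 \<Longrightarrow> h2 t = 0"
    "\<And>t. t < 1 \<Longrightarrow> h1 t = 0" "\<And>t. t < 1 \<Longrightarrow> h2 t = 0"
    "C \<ge> 0" "\<And>t. \<bar>t * h1 t\<bar> \<le> C" "\<And>t. \<bar>t\<^sup>2 * h2 t\<bar> \<le> C"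
proof -
  obtain h1 where h1: "\<And>t. (smooth_step has_real_derivative h1 t) (at t)" "smooth_real h1"
    using smooth_realE[OF smooth_real_step] by blast
  obtain h2 where h2: "\<And>t. (h1 has_real_derivative h2 t) (at t)" "smooth_real h2"
    using smooth_realE[OF h1(2)] by blast
  \<comment> \<open>The third derivative provides the continuity of \<open>h2\<close>, hence its
    boundedness on the compact interval.\<close>
  obtain h3 where h3: "\<And>t. (h2 has_real_derivative h3 t) (at t)" "smooth_real h3"
    using smooth_realE[OF h2(2)] by blast
  have zero: "f' t = 0"
    if "\<And>t. (f has_real_derivative f' t) (at t)" "open S" "t \<in> S" "\<And>s. s \<in> S \<Longrightarrow> f s = c"
    for f f' :: "real \<Rightarrow> real" and S c t
  proof -
    have "((\<lambda>s. c) has_real_derivative f' t) (at t)"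
      by (rule has_field_derivative_transform_within_open[OF that(1-3)]) (use that(4) in auto)
    then show ?thesis using DERIV_const DERIV_unique by blast
  qed
  have r1: "h1 t = 0" if "t > 2" for t
    by (rule zero[OF h1(1), of "{2<..}" _ 1]) (use that smooth_step_eq_1 in auto)
  have l1: "h1 t = 0" if "t < 1" for t
    by (rule zero[OF h1(1), of "{..<1}" _ 0]) (use that smooth_step_eq_0 in auto)
  have r2: "h2 t = 0" if "t > 2" for t
    by (rule zero[OF h2(1), of "{2<..}" _ 0]) (use that r1 in auto)
  have l2: "h2 t = 0" if "t < 1" for t
    by (rule zero[OF h2(1), of "{..<1}" _ 0]) (use that l1 in auto)
  have c1: "continuous_on A h1" and c2: "continuous_on A h2" for A
    using h2(1) h3(1) by (auto intro!: continuous_at_imp_continuous_on DERIV_isCont)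
  have "bounded ((\<lambda>t. t * h1 t) ` {1..2})" "bounded ((\<lambda>t. t\<^sup>2 * h2 t) ` {1..2})"
    by (intro compact_imp_bounded compact_continuous_image continuous_intros c1 c2; simp)+
  then obtain C1 C2 where C: "\<And>t. t \<in> {1..2} \<Longrightarrow> \<bar>t * h1 t\<bar> \<le> C1" "\<And>t. t \<in> {1..2} \<Longrightarrow> \<bar>t\<^sup>2 * h2 t\<bar> \<le> C2"
    unfolding bounded_iff by fastforce
  show thesis
  proof (rule that[of h1 h2 "max 0 (max C1 C2)"])
    show "\<bar>t * h1 t\<bar> \<le> max 0 (max C1 C2)" for t
      using C(1)[of t] r1[of t] l1[of t] by (cases "t < 1"; cases "t > 2") auto
    show "\<bar>t\<^sup>2 * h2 t\<bar> \<le> max 0 (max C1 C2)" for t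
      using C(2)[of t] r2[of t] l2[of t] by (cases "t < 1"; cases "t > 2") auto
  qed (use h1 h2 r1 l1 r2 l2 in auto)
qed

section \<open>Dominated functions\<close>

text \<open>A single condition that yields integrability and square integrability on every
  measurable set and, for a sequence with common \<open>C\<close> and \<open>r\<close>, the majorant
  for dominated convergence. For \<open>r < 0\<close> the ball is empty and \<open>C\<close> may be
  negative, hence the absolute values in the derived bounds.\<close>

definition dominated :: "real \<Rightarrow> real \<Rightarrow> ('a::euclidean_space \<Rightarrow> complex) \<Rightarrow> bool" where
  "dominated C r f \<longleftrightarrow>
     f \<in> borel_measurable borel \<and> (\<forall>x. cmod (f x) \<le> C * indicator (cball 0 r) x)"

lemma dominatedI:
  assumes "f \<in> borel_measurable borel" "\<And>x. cmod (f x) \<le> C" "\<And>x. norm x > r \<Longrightarrow> f x = 0"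
  shows "dominated C r f"
proof -
  have "cmod (f x) \<le> C * indicator (cball 0 r) x" for x
    using assms(2)[of x] assms(3)[of x] by (cases "norm x \<le> r") auto
  with assms(1) show ?thesis by (simp add: dominated_def)
qed

lemma dominated_bound:
  assumes "dominated C r f" shows "cmod (f x) \<le> \<bar>C\<bar>"
proof -
  have "cmod (f x) \<le> C * indicator (cball 0 r) x" using assms by (simp add: dominated_def)
  also have "\<dots> \<le> \<bar>C\<bar>" by (auto simp: indicator_def)
  finally show ?thesis .
qed

lemma dominated_zero: "dominated C r f \<Longrightarrow> norm x > r \<Longrightarrow> f x = 0"
  unfolding dominated_def by (metis indicator_simps(2) mem_cball_0 mult_zero_right norm_le_zero_iff not_le)

lemma dominated_measurable: "dominated C r f \<Longrightarrow> f \<in> borel_measurable borel"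
  by (simp add: dominated_def)

lemma dominated_mult:
  assumes "dominated C r f" "g \<in> borel_measurable borel" "\<And>x. cmod (g x) \<le> B"
  shows "dominated (\<bar>C\<bar> * B) r (\<lambda>x. f x * g x)"
proof (rule dominatedI)
  show "cmod (f x * g x) \<le> \<bar>C\<bar> * B" for x
    unfolding norm_mult using dominated_bound[OF assms(1), of x] assms(3)[of x]
    by (intro mult_mono) auto
qed (use assms dominated_measurable[OF assms(1)] dominated_zero[OF assms(1)] in auto)

lemma dominated_diff:
  assumes "dominated C r f" "dominated D r g"
  shows "dominated (\<bar>C\<bar> + \<bar>D\<bar>) r (\<lambda>x. f x - g x)"
proof (rule dominatedI)
  show "cmod (f x - g x) \<le> \<bar>C\<bar> + \<bar>D\<bar>" for x
    using norm_triangle_ineq4[of "f x" "g x"] dominated_bound[OF assms(1), of x]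
      dominated_bound[OF assms(2), of x] by linarith
qed (use assms[THEN dominated_measurable] dominated_zero[OF assms(1)] dominated_zero[OF assms(2)] in auto)

lemma measurable_lebesgue_on:
  "f \<in> borel_measurable borel \<Longrightarrow> f \<in> borel_measurable (lebesgue_on S)"
  by (intro measurable_restrict_space1 measurable_completion) auto

lemma dominated_measurable_on: "dominated C r f \<Longrightarrow> f \<in> borel_measurable (lebesgue_on S)"
  by (rule measurable_lebesgue_on[OF dominated_measurable])

lemma integrable_lebesgue_on_cball:
  assumes "S \<in> sets lebesgue"
  shows "integrable (lebesgue_on S) (\<lambda>x. C * indicator (cball (a::'a::euclidean_space) r) x :: real)"
proof -
  have "integrable lborel (indicator (cball a r) :: 'a \<Rightarrow> real)"
    using emeasure_bounded_finite[of "cball a r"] by (intro integrable_real_indicator) auto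
  then have "integrable lebesgue (indicator (cball a r) :: 'a \<Rightarrow> real)"
    by (subst integrable_completion) auto
  then have "integrable lebesgue (\<lambda>x. indicator S x *\<^sub>R (indicator (cball a r) x :: real))"
    using integrable_mult_indicator[OF assms] by blast
  then have "integrable (lebesgue_on S) (indicator (cball a r) :: 'a \<Rightarrow> real)"
    using assms by (subst integrable_restrict_space) auto
  then show ?thesis by simp
qed

lemma dominated_integrable:
  assumes "dominated C r f" "S \<in> sets lebesgue"
  shows "integrable (lebesgue_on S) f"
proof (rule Bochner_Integration.integrable_bound[OF integrable_lebesgue_on_cball[OF assms(2), of "\<bar>C\<bar>" 0 r]])
  show "AE x in lebesgue_on S. norm (f x) \<le> norm (\<bar>C\<bar> * indicat_real (cball 0 r) x)"
    using dominated_bound[OF assms(1)] dominated_zero[OF assms(1)]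
    by (intro always_eventually) (auto simp: indicator_def not_le)
qed (rule dominated_measurable_on[OF assms(1)])

lemma dominated_L2:
  assumes "dominated C r f" "S \<in> sets lebesgue"
  shows "f \<in> L2 S"
proof -
  have m: "f \<in> borel_measurable (lebesgue_on S)"
    by (rule dominated_measurable_on[OF assms(1)])
  have "integrable (lebesgue_on S) (\<lambda>x. (cmod (f x))\<^sup>2)"
  proof (rule Bochner_Integration.integrable_bound[OF integrable_lebesgue_on_cball[OF assms(2), of "\<bar>C\<bar>\<^sup>2" 0 r]])
    have "(cmod (f x))\<^sup>2 \<le> \<bar>C\<bar>\<^sup>2" for x
      using dominated_bound[OF assms(1)] by (intro power_mono) auto
    then show "AE x in lebesgue_on S. norm ((cmod (f x))\<^sup>2) \<le> norm (\<bar>C\<bar>\<^sup>2 * indicat_real (cball 0 r) x)"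
      using dominated_zero[OF assms(1)]
      by (intro always_eventually) (auto simp: indicator_def not_le)
  qed (use m in auto)
  with m show ?thesis by (simp add: L2_def)
qed

lemma dominated_lim:
  assumes "\<And>m. dominated C r (f m)" "\<And>x. (\<lambda>m. f m x) \<longlonglongrightarrow> g x"
  shows "dominated \<bar>C\<bar> r g"
proof (rule dominatedI)
  show "g \<in> borel_measurable borel"
    by (rule borel_measurable_LIMSEQ_metric[OF _ assms(2)]) (rule dominated_measurable[OF assms(1)])
  show "cmod (g x) \<le> \<bar>C\<bar>" for x
    by (rule LIMSEQ_le_const2[OF tendsto_norm[OF assms(2)]])
      (use assms dominated_bound in blast)
  show "g x = 0" if "norm x > r" for x
    using assms(2)[of x] dominated_zero[OF assms(1) that] by (simp add: LIMSEQ_const_iff)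
qed

lemma dominated_integral_tendsto:
  assumes "\<And>m. dominated C r (f m)" "\<And>x. (\<lambda>m. f m x) \<longlonglongrightarrow> g x" "S \<in> sets lebesgue"
  shows "(\<lambda>m. LINT x|lebesgue_on S. f m x) \<longlonglongrightarrow> (LINT x|lebesgue_on S. g x)"
proof (rule integral_dominated_convergence[OF _ _ integrable_lebesgue_on_cball[OF assms(3), of "\<bar>C\<bar>" 0 r]])
  show "AE x in lebesgue_on S. norm (f m x) \<le> \<bar>C\<bar> * indicat_real (cball 0 r) x" for m
    using dominated_bound[OF assms(1)] dominated_zero[OF assms(1)]
    by (intro always_eventually) (auto simp: indicator_def not_le)
qed (use assms(2) in \<open>auto intro: dominated_measurable_on[OF assms(1)]
  dominated_measurable_on[OF dominated_lim[OF assms(1,2)]]\<close>)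

lemma dominated_L2_norm_tendsto:
  assumes "\<And>m. dominated C r (f m)" "\<And>x. (\<lambda>m. f m x) \<longlonglongrightarrow> g x" "S \<in> sets lebesgue"
  shows "(\<lambda>m. L2_norm S (f m)) \<longlonglongrightarrow> L2_norm S g"
  unfolding L2_norm_def
proof (intro tendsto_real_sqrt integral_dominated_convergence[OF _ _ integrable_lebesgue_on_cball[OF assms(3), of "\<bar>C\<bar>\<^sup>2" 0 r]])
  have "(cmod (f m x))\<^sup>2 \<le> \<bar>C\<bar>\<^sup>2" for m x
    using dominated_bound[OF assms(1)] by (intro power_mono) auto
  then show "AE x in lebesgue_on S. norm ((cmod (f m x))\<^sup>2) \<le> \<bar>C\<bar>\<^sup>2 * indicat_real (cball 0 r) x" for m
    using dominated_zero[OF assms(1)]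
    by (intro always_eventually) (auto simp: indicator_def not_le)
  have "f m \<in> borel_measurable (lebesgue_on S)" "g \<in> borel_measurable (lebesgue_on S)" for m
    by (rule dominated_measurable_on[OF assms(1)], rule dominated_measurable_on[OF dominated_lim[OF assms(1,2)]])
  then show "(\<lambda>x. (cmod (f m x))\<^sup>2) \<in> borel_measurable (lebesgue_on S)"
    "(\<lambda>x. (cmod (g x))\<^sup>2) \<in> borel_measurable (lebesgue_on S)" for m by simp_all
  show "AE x in lebesgue_on S. (\<lambda>m. (cmod (f m x))\<^sup>2) \<longlonglongrightarrow> (cmod (g x))\<^sup>2"
    using assms(2) by (intro always_eventually allI tendsto_intros)
qed

text \<open>The function spaces integrate over \<open>lebesgue_on\<close>, while translation
  invariance is available for \<open>lborel\<close>. The common value also shows that the integral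
  does not depend on the set \<open>S\<close>.\<close>

lemma LINT_lebesgue_on_eq_lborel:
  fixes f :: "'a::euclidean_space \<Rightarrow> 'b::{banach, second_countable_topology}"
  assumes "f \<in> borel_measurable borel" "S \<in> sets lebesgue" "\<And>x. x \<notin> S \<Longrightarrow> f x = 0"
  shows "(LINT x|lebesgue_on S. f x) = (LINT x|lborel. f x)"
proof -
  have "(LINT x|lebesgue_on S. f x) = (LINT x|lebesgue. indicator S x *\<^sub>R f x)"
    using assms(2) by (subst integral_restrict_space) auto
  also have "(\<lambda>x. indicator S x *\<^sub>R f x) = f"
    using assms(3) by (auto simp: indicator_def)
  also have "(LINT x|lebesgue. f x) = (LINT x|lborel. f x)"
    using assms(1) by (subst integral_completion) auto
  finally show ?thesis .
qed

section \<open>Test functions and integration by parts\<close>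

lemma test_function_smooth: "\<phi> \<in> test_functions \<Omega> \<Longrightarrow> smooth \<phi>"
  by (simp add: test_functions_def smooth_def)

lemma test_functionI:
  assumes "smooth \<phi>" "compact K" "K \<subseteq> \<Omega>" "\<And>x. x \<notin> K \<Longrightarrow> \<phi> x = 0"
  shows "\<phi> \<in> test_functions \<Omega>"
proof -
  have "closure {x. \<phi> x \<noteq> 0} \<subseteq> K"
    using assms by (intro closure_minimal) (auto simp: compact_imp_closed)
  moreover from this have "compact (closure {x. \<phi> x \<noteq> 0})"
    using compact_Int_closed[OF assms(2) closed_closure, of "{x. \<phi> x \<noteq> 0}"]
    by (simp only: Int_absorb1)
  ultimately show ?thesis using assms by (auto simp: test_functions_def smooth_def)
qed

lemma test_functions_mono: "\<phi> \<in> test_functions A \<Longrightarrow> A \<subseteq> B \<Longrightarrow> \<phi> \<in> test_functions B"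
  by (auto simp: test_functions_def)

lemma test_functionE:
  assumes "\<phi> \<in> test_functions \<Omega>"
  obtains K where "compact K" "K \<subseteq> \<Omega>" "\<And>x. x \<notin> K \<Longrightarrow> \<phi> x = 0"
proof (rule that)
  show "compact (closure {x. \<phi> x \<noteq> 0})" "closure {x. \<phi> x \<noteq> 0} \<subseteq> \<Omega>"
    using assms by (auto simp: test_functions_def)
  show "\<phi> x = 0" if "x \<notin> closure {x. \<phi> x \<noteq> 0}" for x
  proof (rule ccontr)
    assume "\<phi> x \<noteq> 0"
    then have "x \<in> closure {x. \<phi> x \<noteq> 0}" by (intro closure_subset[THEN subsetD]) simp
    with that show False by contradiction
  qed
qed

lemma test_function_zero_outside: "\<phi> \<in> test_functions \<Omega> \<Longrightarrow> x \<notin> \<Omega> \<Longrightarrow> \<phi> x = 0"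
  by (erule test_functionE) blast

lemma partial_deriv_zero_open:
  assumes "open S" "x \<in> S" "\<And>y. y \<in> S \<Longrightarrow> f y = 0"
  shows "partial_deriv b f x = 0"
  using partial_deriv_cong_open(2)[OF assms(1,2), of f "\<lambda>_. 0"] assms(3)
    partial_deriv_eq[OF has_derivative_const] by metis

lemma test_function_partial_deriv:
  assumes "\<phi> \<in> test_functions \<Omega>" "b \<in> Basis"
  shows "partial_deriv b \<phi> \<in> test_functions \<Omega>"
proof -
  obtain K where K: "compact K" "K \<subseteq> \<Omega>" "\<And>x. x \<notin> K \<Longrightarrow> \<phi> x = 0"
    using test_functionE[OF assms(1)] by blast
  have "partial_deriv b \<phi> x = 0" if "x \<notin> K" for x
    using partial_deriv_zero_open[of "- K" x \<phi> b] that K(3) compact_imp_closed[OF K(1)]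
    by (simp add: open_Compl)
  then show ?thesis
    using test_functionI[OF _ K(1,2)] smooth_partial_deriv test_function_smooth assms by blast
qed

lemma test_function_mult:
  assumes "\<phi> \<in> test_functions \<Omega>" "smooth w"
  shows "(\<lambda>x. w x * \<phi> x) \<in> test_functions \<Omega>"
proof (rule test_functionE[OF assms(1)])
  fix K assume K: "compact K" "K \<subseteq> \<Omega>" "\<And>x. x \<notin> K \<Longrightarrow> \<phi> x = 0"
  show ?thesis
    by (rule test_functionI[OF _ K(1,2)])
      (use K(3) in \<open>auto intro: smooth_mult assms test_function_smooth[OF assms(1)]\<close>)
qed

lemma dominated_of_compact:
  assumes "compact K" "continuous_on UNIV f" "\<And>x. x \<notin> K \<Longrightarrow> f x = 0"
  obtains C r where "dominated C r f"
proof -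
  obtain r where r: "\<And>x. x \<in> K \<Longrightarrow> norm x \<le> r"
    using compact_imp_bounded[OF assms(1)] by (auto simp: bounded_iff)
  have "bounded (f ` K)"
    using assms by (meson compact_continuous_image compact_imp_bounded continuous_on_subset subset_UNIV)
  then obtain C where C: "\<And>x. x \<in> K \<Longrightarrow> cmod (f x) \<le> C"
    by (auto simp: bounded_iff)
  have "dominated \<bar>C\<bar> r f"
  proof (rule dominatedI)
    show "cmod (f x) \<le> \<bar>C\<bar>" for x
      using C[of x] assms(3)[of x] by (cases "x \<in> K") auto
    show "f x = 0" if "norm x > r" for x
      using r[of x] assms(3)[of x] that by force
  qed (use assms in \<open>auto intro: borel_measurable_continuous_onI\<close>)
  then show thesis by (rule that)
qed

lemma test_function_dominated:
  assumes "\<phi> \<in> test_functions \<Omega>"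
  obtains C r where "dominated C r \<phi>"
  using test_functionE[OF assms] dominated_of_compact
    smooth_continuous_on[OF test_function_smooth[OF assms]] by metis

text \<open>Every difference quotient in direction \<open>b\<close> has integral zero by translation
  invariance, and the quotients converge dominatedly to the partial derivative. This takes the place
  of Fubini and the one-dimensional fundamental theorem.\<close>

lemma integral_partial_deriv_eq_0:
  fixes F :: "'a::euclidean_space \<Rightarrow> complex"
  assumes F: "F \<in> test_functions UNIV" and b: "b \<in> Basis"
  shows "(LINT x|lborel. partial_deriv b F x) = 0"
proof -
  note sF = test_function_smooth[OF F]
  obtain C r where dF: "dominated C r F" using test_function_dominated[OF F] by blast
  obtain B s where dB: "dominated B s (partial_deriv b F)"
    using test_function_dominated[OF test_function_partial_deriv[OF F b]] by blast
  \<comment> \<open>Step sizes at most 1 keep the supports of all quotients in the ball of radius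
    \<open>r + 1\<close>.\<close>
  define t where "t m = inverse (real (Suc m))" for m
  have t: "0 < t m" "t m \<le> 1" for m by (auto simp: t_def divide_simps)
  define q where "q m x = (F (x + t m *\<^sub>R b) - F x) / of_real (t m)" for m x
  have D: "((\<lambda>u. F (x + u *\<^sub>R b)) has_vector_derivative partial_deriv b F (x + u *\<^sub>R b)) (at u within S)" for x u S
  proof -
    have "(F has_derivative frechet_derivative F (at (x + u *\<^sub>R b))) (at (x + u *\<^sub>R b))"
      using sF smooth_differentiable frechet_derivative_works by blast
    moreover have "((\<lambda>u. x + u *\<^sub>R b) has_derivative (\<lambda>h. h *\<^sub>R b)) (at u within S)"
      by (auto intro!: derivative_eq_intros)
    ultimately have "((\<lambda>u. F (x + u *\<^sub>R b)) has_derivative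
        (\<lambda>h. frechet_derivative F (at (x + u *\<^sub>R b)) (h *\<^sub>R b))) (at u within S)"
      by (rule has_derivative_compose[rotated])
    moreover have "linear (frechet_derivative F (at (x + u *\<^sub>R b)))"
      using linear_frechet_derivative sF smooth_differentiable by blast
    ultimately show ?thesis
      by (simp add: has_vector_derivative_def partial_deriv_def linear_scale)
  qed
  \<comment> \<open>The mean value inequality along the segment gives a bound independent of
    \<open>m\<close>.\<close>
  have bq: "cmod (q m x) \<le> \<bar>B\<bar>" for m x
  proof -
    have "norm (F (x + t m *\<^sub>R b) - F (x + 0 *\<^sub>R b)) \<le> \<bar>B\<bar> * norm (t m - 0)"
    proof (rule differentiable_bound[of UNIV])
      show "((\<lambda>u. F (x + u *\<^sub>R b)) has_derivative (\<lambda>h. h *\<^sub>R partial_deriv b F (x + u *\<^sub>R b))) (at u)" for u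
        using D[of x u UNIV] by (simp add: has_vector_derivative_def)
      show "onorm (\<lambda>h. h *\<^sub>R partial_deriv b F (x + u *\<^sub>R b)) \<le> \<bar>B\<bar>" for u
        by (rule onorm_le) (use dominated_bound[OF dB, of "x + u *\<^sub>R b"] in \<open>simp add: mult.commute mult_left_mono\<close>)
    qed auto
    then show ?thesis using t[of m] by (simp add: q_def norm_divide divide_simps)
  qed
  have dq: "dominated \<bar>B\<bar> (r + 1) (q m)" for m
  proof (rule dominatedI)
    have "continuous_on UNIV (q m)"
      unfolding q_def using t[of m]
      by (intro continuous_intros continuous_on_compose2[OF smooth_continuous_on[OF sF, of UNIV]]) auto
    then show "q m \<in> borel_measurable borel" by (rule borel_measurable_continuous_onI)
    show "q m x = 0" if "r + 1 < norm x" for x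
    proof -
      have "norm x \<le> norm (x + t m *\<^sub>R b) + norm (t m *\<^sub>R b)"
        by (metis add_diff_cancel norm_triangle_ineq4)
      then have "norm (x + t m *\<^sub>R b) > r" using that b t[of m] by simp
      then show ?thesis using that dominated_zero[OF dF] by (simp add: q_def)
    qed
  qed (rule bq)
  have lq: "(\<lambda>m. q m x) \<longlonglongrightarrow> partial_deriv b F x" for x
  proof -
    have "LIM m sequentially. t m :> at 0"
      unfolding t_def by (intro filterlim_atI LIMSEQ_inverse_real_of_nat always_eventually) auto
    then have lim: "(\<lambda>m. (g (t m) - g 0) / t m) \<longlonglongrightarrow> g'" if "(g has_real_derivative g') (at 0)" for g g'
      using filterlim_compose[OF DERIV_D[OF that]] by simp
    have "((\<lambda>u. Re (F (x + u *\<^sub>R b))) has_real_derivative Re (partial_deriv b F x)) (at 0)"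
      "((\<lambda>u. Im (F (x + u *\<^sub>R b))) has_real_derivative Im (partial_deriv b F x)) (at 0)"
      using bounded_linear.has_vector_derivative[OF bounded_linear_Re D[of x 0 UNIV]]
        bounded_linear.has_vector_derivative[OF bounded_linear_Im D[of x 0 UNIV]]
      by (simp_all add: has_real_derivative_iff_has_vector_derivative)
    from this[THEN lim] show ?thesis
      by (simp add: tendsto_complex_iff q_def)
  qed
  have int: "integrable lborel F"
    using dominated_integrable[OF dF, of UNIV] dominated_measurable[OF dF]
    by (simp add: lebesgue_on_UNIV_eq integrable_completion)
  have "(LINT x|lborel. q m x) = 0" for m
  proof -
    have F': "F \<in> borel_measurable borel" by (rule dominated_measurable[OF dF])
    have "integrable (distr lborel borel ((+) (t m *\<^sub>R b))) F"
      using int by (simp add: lborel_distr_plus)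
    then have i2: "integrable lborel (\<lambda>x. F (t m *\<^sub>R b + x))"
      using F' by (subst (asm) integrable_distr_eq) auto
    have "(LINT x|lborel. F (t m *\<^sub>R b + x)) = (LINT x|distr lborel borel ((+) (t m *\<^sub>R b)). F x)"
      using F' by (subst integral_distr) auto
    then have "(LINT x|lborel. F (t m *\<^sub>R b + x)) = (LINT x|lborel. F x)"
      by (simp add: lborel_distr_plus)
    with int i2 show ?thesis by (simp add: q_def add.commute)
  qed
  moreover have "(\<lambda>m. LINT x|lborel. q m x) \<longlonglongrightarrow> (LINT x|lborel. partial_deriv b F x)"
  proof -
    have "(LINT x|lebesgue_on UNIV. f x) = (LINT x|lborel. f x)" if "dominated c s f" for c s and f :: "'a \<Rightarrow> complex"
      by (rule LINT_lebesgue_on_eq_lborel[OF dominated_measurable[OF that]]) auto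
    from this[OF dq] this[OF dB] show ?thesis
      using dominated_integral_tendsto[OF dq lq, of UNIV] by simp
  qed
  ultimately show ?thesis by (simp add: LIMSEQ_const_iff)
qed

text \<open>The product inherits the compact support of \<phi>, so its derivative integrates to zero
  whatever \<open>w\<close> does outside.\<close>

lemma integration_by_parts:
  assumes \<phi>: "\<phi> \<in> test_functions \<Omega>" and w: "smooth w" and b: "b \<in> Basis" and \<Omega>: "\<Omega> \<in> sets lebesgue"
  shows "(LINT x|lebesgue_on \<Omega>. w x * partial_deriv b \<phi> x)
    = - (LINT x|lebesgue_on \<Omega>. partial_deriv b w x * \<phi> x)"
proof -
  let ?F = "\<lambda>x. w x * \<phi> x"
  note s\<phi> = test_function_smooth[OF \<phi>]
  have F: "?F \<in> test_functions \<Omega>" by (rule test_function_mult[OF \<phi> w])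
  have 1: "(\<lambda>x. w x * partial_deriv b \<phi> x) \<in> test_functions \<Omega>"
    by (intro test_function_mult test_function_partial_deriv \<phi> w b)
  have 2: "(\<lambda>x. partial_deriv b w x * \<phi> x) \<in> test_functions \<Omega>"
    by (intro test_function_mult \<phi> smooth_partial_deriv w b)
  have int: "integrable (lebesgue_on \<Omega>) f" if "f \<in> test_functions \<Omega>" for f
    using test_function_dominated[OF that] dominated_integrable \<Omega> by metis
  have "partial_deriv b ?F x = w x * partial_deriv b \<phi> x + partial_deriv b w x * \<phi> x" for x
    using partial_deriv_mult smooth_differentiable w s\<phi> by blast
  then have "(LINT x|lebesgue_on \<Omega>. w x * partial_deriv b \<phi> x) + (LINT x|lebesgue_on \<Omega>. partial_deriv b w x * \<phi> x)
      = (LINT x|lebesgue_on \<Omega>. partial_deriv b ?F x)"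
    using int[OF 1] int[OF 2] by simp
  also have "\<dots> = (LINT x|lborel. partial_deriv b ?F x)"
    using test_function_zero_outside[OF test_function_partial_deriv[OF F b]]
    by (intro LINT_lebesgue_on_eq_lborel \<Omega> smooth_borel_measurable smooth_partial_deriv b
        test_function_smooth[OF F]) auto
  also have "\<dots> = 0"
    using F b by (intro integral_partial_deriv_eq_0 test_functions_mono[OF F]) auto
  finally show ?thesis by (simp add: add_eq_0_iff2)
qed

lemma integration_by_parts_laplacian:
  assumes \<phi>: "\<phi> \<in> test_functions \<Omega>" and w: "smooth w" and \<Omega>: "\<Omega> \<in> sets lebesgue"
  shows "(LINT x|lebesgue_on \<Omega>. w x * laplacian \<phi> x) = (LINT x|lebesgue_on \<Omega>. laplacian w x * \<phi> x)"
proof -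
  have int: "integrable (lebesgue_on \<Omega>) f" if "f \<in> test_functions \<Omega>" for f
    using test_function_dominated[OF that] dominated_integrable \<Omega> by metis
  have "(LINT x|lebesgue_on \<Omega>. w x * laplacian \<phi> x)
      = (\<Sum>b\<in>Basis. LINT x|lebesgue_on \<Omega>. w x * partial_deriv b (partial_deriv b \<phi>) x)"
    unfolding laplacian_def sum_distrib_left
    by (intro Bochner_Integration.integral_sum int test_function_mult test_function_partial_deriv \<phi> w)
  also have "\<dots> = (\<Sum>b\<in>Basis. LINT x|lebesgue_on \<Omega>. partial_deriv b (partial_deriv b w) x * \<phi> x)"
  proof (rule sum.cong[OF refl])
    fix b :: 'a assume b: "b \<in> Basis"
    show "(LINT x|lebesgue_on \<Omega>. w x * partial_deriv b (partial_deriv b \<phi>) x)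
        = (LINT x|lebesgue_on \<Omega>. partial_deriv b (partial_deriv b w) x * \<phi> x)"
      using integration_by_parts[OF test_function_partial_deriv[OF \<phi> b] w b \<Omega>]
        integration_by_parts[OF \<phi> smooth_partial_deriv[OF w b] b \<Omega>] by simp
  qed
  also have "\<dots> = (LINT x|lebesgue_on \<Omega>. laplacian w x * \<phi> x)"
    unfolding laplacian_def sum_distrib_right
    by (intro Bochner_Integration.integral_sum[symmetric] int test_function_mult smooth_partial_deriv \<phi> w)
  finally show ?thesis .
qed

section \<open>Cavities\<close>

lemma test_function_laplacian:
  assumes "\<phi> \<in> test_functions \<Omega>"
  shows "laplacian \<phi> \<in> test_functions \<Omega>"
proof -
  obtain K where K: "compact K" "K \<subseteq> \<Omega>" "\<And>x. x \<notin> K \<Longrightarrow> \<phi> x = 0"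
    using test_functionE[OF assms] by blast
  have "laplacian \<phi> x = 0" if "x \<notin> K" for x
  proof -
    have o: "open (- K)" using K(1) by (simp add: compact_imp_closed open_Compl)
    have 1: "partial_deriv b \<phi> y = 0" if "y \<in> - K" for b y
      by (rule partial_deriv_zero_open[OF o that]) (use K in auto)
    have "partial_deriv b (partial_deriv b \<phi>) x = 0" for b
      by (rule partial_deriv_zero_open[OF o _ 1]) (use \<open>x \<notin> K\<close> in auto)
    then show ?thesis by (simp add: laplacian_def)
  qed
  then show ?thesis
    using test_functionI[OF _ K(1,2)] smooth_laplacian test_function_smooth assms by blast
qed

definition ext_zero :: "'a set \<Rightarrow> ('a \<Rightarrow> complex) \<Rightarrow> 'a \<Rightarrow> complex" where
  "ext_zero Q f x = (if x \<in> Q then f x else 0)"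

lemma has_weak_deriv_diff:
  assumes "has_weak_deriv \<Omega> b u g" "has_weak_deriv \<Omega> b u' g'" "\<Omega> \<in> sets lebesgue" "b \<in> Basis"
    "dominated C r u" "dominated C' r' u'" "dominated D s g" "dominated D' s' g'"
  shows "has_weak_deriv \<Omega> b (\<lambda>x. u x - u' x) (\<lambda>x. g x - g' x)"
  unfolding has_weak_deriv_def
proof
  fix \<phi> assume \<phi>: "\<phi> \<in> test_functions \<Omega>"
  have int: "integrable (lebesgue_on \<Omega>) (\<lambda>x. f x * \<psi> x)"
    if f: "dominated c t f" and \<psi>: "\<psi> \<in> test_functions \<Omega>" for c t f \<psi>
  proof -
    obtain B s where \<psi>': "dominated B s \<psi>" using test_function_dominated[OF \<psi>] by blast
    show ?thesis
      by (rule dominated_integrable[OF dominated_mult[OF f dominated_measurable[OF \<psi>'] dominated_bound[OF \<psi>']] assms(3)])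
  qed
  note \<phi>' = test_function_partial_deriv[OF \<phi> assms(4)]
  have "(LINT x|lebesgue_on \<Omega>. u x * partial_deriv b \<phi> x) = - (LINT x|lebesgue_on \<Omega>. g x * \<phi> x)"
    "(LINT x|lebesgue_on \<Omega>. u' x * partial_deriv b \<phi> x) = - (LINT x|lebesgue_on \<Omega>. g' x * \<phi> x)"
    using assms(1,2) \<phi> by (auto simp: has_weak_deriv_def)
  then show "(LINT x|lebesgue_on \<Omega>. (u x - u' x) * partial_deriv b \<phi> x) = - (LINT x|lebesgue_on \<Omega>. (g x - g' x) * \<phi> x)"
    by (simp add: left_diff_distrib int[OF assms(5) \<phi>'] int[OF assms(6) \<phi>'] int[OF assms(7) \<phi>] int[OF assms(8) \<phi>])
qed

text \<open>\<open>v\<close> has two roles: it is a factor of every function considered on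
  \<open>Q\<close>, and it replaces the distance to the boundary. Its superlevel sets in the closure
  of \<open>Q\<close> are compact subsets of \<open>Q\<close>, so no regularity of the boundary
  enters and the edges of a cube cause no trouble.\<close>

locale cavity =
  fixes Q :: "'a::euclidean_space set" and v :: "'a \<Rightarrow> real"
  assumes open_Q: "open Q" and bounded_Q: "bounded Q"
    and smooth_v: "smooth (\<lambda>x. complex_of_real (v x))"
    and v_pos: "\<And>x. x \<in> Q \<Longrightarrow> v x > 0" and v_frontier: "\<And>x. x \<in> frontier Q \<Longrightarrow> v x = 0"
begin

lemma continuous_v: "continuous_on S v"
proof -
  have "continuous_on S (\<lambda>x. Re (complex_of_real (v x)))"
    by (intro continuous_intros smooth_continuous_on smooth_v)
  then show ?thesis by simp
qed

text \<open>Equal to \<open>f\<close> where v \<ge> 2/(m+1) and to zero where v \<le> 1/(m+1): an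
  approximation of the zero extension by test functions on \<open>Q\<close>.\<close>

definition cut :: "nat \<Rightarrow> ('a \<Rightarrow> complex) \<Rightarrow> 'a \<Rightarrow> complex" where
  "cut m f = ext_zero Q (\<lambda>x. f x * of_real (smooth_step (real (Suc m) * v x)))"

lemma bounded_on_Q:
  assumes "smooth f" obtains C where "C \<ge> 0" "\<And>x. x \<in> Q \<Longrightarrow> cmod (f x) \<le> C"
proof -
  have "bounded (f ` closure Q)"
    using bounded_Q smooth_continuous_on[OF assms]
    by (intro compact_imp_bounded compact_continuous_image) auto
  then obtain C where "\<And>x. x \<in> closure Q \<Longrightarrow> cmod (f x) \<le> C"
    by (auto simp: bounded_iff)
  then show thesis using that[of "max C 0"] closure_subset[of Q] by fastforce
qed

lemma Q_radius: obtains r where "\<And>x. x \<in> Q \<Longrightarrow> norm x \<le> r"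
  using bounded_Q by (auto simp: bounded_iff)

lemma dominated_ext_zero:
  assumes "f \<in> borel_measurable borel" "\<And>x. x \<in> Q \<Longrightarrow> cmod (f x) \<le> C" "C \<ge> 0"
    "\<And>x. x \<in> Q \<Longrightarrow> norm x \<le> r"
  shows "dominated C r (ext_zero Q f)"
proof (rule dominatedI)
  show "ext_zero Q f \<in> borel_measurable borel"
  proof -
    have [measurable]: "Q \<in> sets borel" "f \<in> borel_measurable borel" using open_Q assms(1) by auto
    show ?thesis unfolding ext_zero_def[abs_def] by measurable
  qed
  show "ext_zero Q f x = 0" if "r < norm x" for x
    using assms(4)[of x] that by (auto simp: ext_zero_def)
qed (use assms in \<open>auto simp: ext_zero_def\<close>)

lemma dominated_ext_zero_smooth:
  assumes "smooth f" obtains C r where "dominated C r (ext_zero Q f)"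
  using bounded_on_Q[OF assms] Q_radius dominated_ext_zero[OF smooth_borel_measurable[OF assms]] by metis

lemma cut_eventually:
  assumes "x \<in> Q"
  shows "\<forall>\<^sub>F m in sequentially. real (Suc m) * v x > 2"
proof -
  obtain N where N: "2 / v x < real N" using reals_Archimedean2 by blast
  have "real (Suc m) * v x > 2" if "m \<ge> N" for m
  proof -
    have "2 / v x < real (Suc m)" using that N by linarith
    then show ?thesis using v_pos[OF assms] by (simp add: divide_simps mult.commute)
  qed
  then show ?thesis by (auto simp: eventually_sequentially)
qed

definition cut_support :: "nat \<Rightarrow> 'a set" where
  "cut_support m = {x \<in> closure Q. 1 \<le> real (Suc m) * v x}"

lemma cut_support: "compact (cut_support m)" "cut_support m \<subseteq> Q"
proof -
  have "closed {x. 1 \<le> real (Suc m) * v x}"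
    by (intro closed_Collect_le continuous_intros continuous_v)
  then have "compact (closure Q \<inter> {x. 1 \<le> real (Suc m) * v x})"
    using bounded_Q by (intro compact_Int_closed) auto
  then show "compact (cut_support m)" by (simp add: cut_support_def Collect_conj_eq)
  show "cut_support m \<subseteq> Q"
  proof
    fix x assume x: "x \<in> cut_support m"
    show "x \<in> Q"
    proof (rule ccontr)
      assume "x \<notin> Q"
      then have "x \<in> frontier Q" using x open_Q by (auto simp: cut_support_def frontier_def interior_open)
      with v_frontier x show False by (auto simp: cut_support_def)
    qed
  qed
qed

lemma cut_zero: "x \<notin> cut_support m \<Longrightarrow> cut m f x = 0"
  using closure_subset[of Q] by (auto simp: cut_def ext_zero_def cut_support_def smooth_step_eq_0 not_le)

lemma smooth_cut_factor: "smooth (\<lambda>x. complex_of_real (smooth_step (c * v x)))"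
  using smooth_compose_real[OF smooth_real_affine[of 0 c] smooth_v]
  by (intro smooth_compose_real[OF smooth_real_step]) simp

lemma cut_test_function:
  assumes "smooth f" shows "cut m f \<in> test_functions Q"
proof (rule test_functionI[OF _ cut_support cut_zero])
  show "smooth (cut m f)"
  proof (rule smooth_glue[of Q "- cut_support m"])
    show "open (- cut_support m)" using cut_support(1) by (simp add: compact_imp_closed open_Compl)
    show "cut m f x = f x * of_real (smooth_step (real (Suc m) * v x))" if "x \<in> Q" for x
      using that by (simp add: cut_def ext_zero_def)
    show "cut m f x = 0" if "x \<in> - cut_support m" for x using that cut_zero by auto
    show "smooth (\<lambda>x. f x * complex_of_real (smooth_step (real (Suc m) * v x)))"
      by (intro smooth_mult assms smooth_cut_factor)
  qed (use open_Q cut_support(2) in auto)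
qed

lemma dominated_cut:
  assumes "smooth f" obtains C r where "\<And>m. dominated C r (cut m f)"
proof -
  obtain C where C: "C \<ge> 0" "\<And>x. x \<in> Q \<Longrightarrow> cmod (f x) \<le> C" using bounded_on_Q[OF assms] by blast
  obtain r where r: "\<And>x. x \<in> Q \<Longrightarrow> norm x \<le> r" using Q_radius by blast
  have "dominated C r (cut m f)" for m
    unfolding cut_def
  proof (rule dominated_ext_zero[OF _ _ C(1) r])
    show "cmod (f x * complex_of_real (smooth_step (real (Suc m) * v x))) \<le> C" if "x \<in> Q" for x
      using mult_mono[OF C(2)[OF that] smooth_step_abs_le[of "real (Suc m) * v x"]] C(1)
      by (simp add: norm_mult)
  qed (intro smooth_borel_measurable smooth_mult assms smooth_cut_factor)
  then show thesis by (rule that)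
qed

lemma cut_tendsto: "(\<lambda>m. cut m f x) \<longlonglongrightarrow> ext_zero Q f x"
proof (cases "x \<in> Q")
  case True
  show ?thesis
    by (rule tendsto_eventually, rule eventually_mono[OF cut_eventually[OF True]])
      (use True in \<open>simp add: cut_def ext_zero_def smooth_step_eq_1\<close>)
qed (simp add: cut_def ext_zero_def)

lemma partial_deriv_cut:
  assumes "smooth f" and h1: "\<And>t. (smooth_step has_real_derivative h1 t) (at t)"
  shows "partial_deriv b (cut m f) = ext_zero Q (\<lambda>x. f x * (of_real (h1 (real (Suc m) * v x) * real (Suc m)) * partial_deriv b (\<lambda>x. of_real (v x)) x)
      + partial_deriv b f x * of_real (smooth_step (real (Suc m) * v x)))"
proof
  fix x
  let ?M = "real (Suc m)"
  show "partial_deriv b (cut m f) x = ext_zero Q (\<lambda>x. f x * (of_real (h1 (?M * v x) * ?M) * partial_deriv b (\<lambda>x. of_real (v x)) x)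
      + partial_deriv b f x * of_real (smooth_step (?M * v x))) x"
  proof (cases "x \<in> Q")
    case True
    have "((\<lambda>t. smooth_step (?M * t)) has_real_derivative h1 (?M * t) * ?M) (at t)" for t
      using DERIV_chain'[OF DERIV_cmult_Id h1, of ?M] by (simp add: mult.commute)
    from has_derivative_compose_real(2)[OF this smooth_differentiable[OF smooth_v]]
    have "partial_deriv b (\<lambda>x. complex_of_real (smooth_step (?M * v x))) x
        = of_real (h1 (?M * v x) * ?M) * partial_deriv b (\<lambda>x. of_real (v x)) x" by simp
    moreover have "partial_deriv b (cut m f) x = partial_deriv b (\<lambda>x. f x * of_real (smooth_step (?M * v x))) x"
      by (rule partial_deriv_cong_open[OF open_Q True]) (simp add: cut_def ext_zero_def)
    ultimately show ?thesis
      using True partial_deriv_mult[OF smooth_differentiable[OF assms(1)] smooth_differentiable[OF smooth_cut_factor], of b ?M x]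
      by (simp add: ext_zero_def)
  next
    case False
    have "partial_deriv b (cut m f) x = 0"
      by (rule partial_deriv_zero_open[of "- cut_support m"])
        (use False cut_support cut_zero in \<open>auto simp: compact_imp_closed open_Compl\<close>)
    then show ?thesis using False by (simp add: ext_zero_def)
  qed
qed

text \<open>The factor \<open>v\<close> compensates the blow-up of the gradient of the cut-off near the boundary.\<close>

lemma partial_deriv_cut_convergence:
  assumes \<psi>: "smooth \<psi>" and b: "b \<in> Basis"
  defines "w \<equiv> \<lambda>x. \<psi> x * of_real (v x)"
  obtains C r where "\<And>m. dominated C r (partial_deriv b (cut m w))"
    "\<And>x. (\<lambda>m. partial_deriv b (cut m w) x) \<longlonglongrightarrow> ext_zero Q (partial_deriv b w) x"
proof -
  have w: "smooth w" unfolding w_def by (intro smooth_mult \<psi> smooth_v)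
  have dv: "smooth (partial_deriv b (\<lambda>x. complex_of_real (v x)))" by (intro smooth_partial_deriv smooth_v b)
  obtain h1 h2 B where h1: "\<And>t. (smooth_step has_real_derivative h1 t) (at t)"
    and h1_0: "\<And>t. t > 2 \<Longrightarrow> h1 t = 0" and h1_b: "\<And>t. \<bar>t * h1 t\<bar> \<le> B" and B: "B \<ge> 0"
    by (rule smooth_step_derivs) blast
  obtain C1 where C1: "C1 \<ge> 0" "\<And>x. x \<in> Q \<Longrightarrow> cmod (\<psi> x * partial_deriv b (\<lambda>x. complex_of_real (v x)) x) \<le> C1"
    using bounded_on_Q[OF smooth_mult[OF \<psi> dv]] by blast
  obtain C2 where C2: "C2 \<ge> 0" "\<And>x. x \<in> Q \<Longrightarrow> cmod (partial_deriv b w x) \<le> C2"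
    using bounded_on_Q[OF smooth_partial_deriv[OF w b]] by blast
  obtain r where r: "\<And>x. x \<in> Q \<Longrightarrow> norm x \<le> r" using Q_radius by blast
  note eq = partial_deriv_cut[OF w h1, of b]
  have "cmod (partial_deriv b (cut m w) x) \<le> C1 * B + C2" for m x
  proof (cases "x \<in> Q")
    case True
    let ?t = "real (Suc m) * v x"
    have "partial_deriv b (cut m w) x = (\<psi> x * partial_deriv b (\<lambda>x. complex_of_real (v x)) x) * of_real (?t * h1 ?t)
       + partial_deriv b w x * of_real (smooth_step ?t)"
      using True unfolding eq by (simp add: ext_zero_def w_def algebra_simps)
    also have "cmod \<dots> \<le> cmod (\<psi> x * partial_deriv b (\<lambda>x. complex_of_real (v x)) x) * \<bar>?t * h1 ?t\<bar>
       + cmod (partial_deriv b w x) * \<bar>smooth_step ?t\<bar>"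
      by (rule order_trans[OF norm_triangle_ineq]) (simp only: norm_mult norm_of_real order_refl)
    also have "\<dots> \<le> C1 * B + C2 * 1"
      by (intro add_mono mult_mono C1 C2 h1_b smooth_step_abs_le True) auto
    finally show ?thesis by simp
  qed (use C1 C2 B in \<open>simp add: eq ext_zero_def\<close>)
  note bound = this
  have "dominated (C1 * B + C2) r (partial_deriv b (cut m w))" for m
  proof (rule dominatedI[OF _ bound])
    show "partial_deriv b (cut m w) \<in> borel_measurable borel"
      by (intro smooth_borel_measurable smooth_partial_deriv b test_function_smooth[OF cut_test_function[OF w]])
    show "partial_deriv b (cut m w) x = 0" if "r < norm x" for x
      using r[of x] that by (auto simp: eq ext_zero_def)
  qed
  moreover have "(\<lambda>m. partial_deriv b (cut m w) x) \<longlonglongrightarrow> ext_zero Q (partial_deriv b w) x" for x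
  proof (cases "x \<in> Q")
    case True
    show ?thesis
      by (rule tendsto_eventually, rule eventually_mono[OF cut_eventually[OF True]])
        (use True in \<open>simp add: eq ext_zero_def smooth_step_eq_1 h1_0\<close>)
  qed (simp add: eq ext_zero_def)
  ultimately show thesis by (rule that)
qed

text \<open>No boundary term arises although the gradient may jump across the frontier: the identity
  holds for the smooth functions \<open>cut m w\<close>, and the factor \<open>v\<close> keeps their
  derivatives dominated in the limit.\<close>

lemma has_weak_deriv_ext_zero:
  assumes \<psi>: "smooth \<psi>" and b: "b \<in> Basis" and \<Omega>: "\<Omega> \<in> sets lebesgue"
  defines "w \<equiv> \<lambda>x. \<psi> x * of_real (v x)"
  shows "has_weak_deriv \<Omega> b (ext_zero Q w) (ext_zero Q (partial_deriv b w))"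
  unfolding has_weak_deriv_def
proof
  fix \<phi> assume \<phi>: "\<phi> \<in> test_functions \<Omega>"
  have w: "smooth w" unfolding w_def by (intro smooth_mult \<psi> smooth_v)
  obtain C r where C: "\<And>m. dominated C r (cut m w)" using dominated_cut[OF w] by blast
  obtain D s where D: "\<And>m. dominated D s (partial_deriv b (cut m w))"
    "\<And>x. (\<lambda>m. partial_deriv b (cut m w) x) \<longlonglongrightarrow> ext_zero Q (partial_deriv b w) x"
    using partial_deriv_cut_convergence[OF \<psi> b] unfolding w_def by blast
  have lim: "(\<lambda>m. LINT x|lebesgue_on \<Omega>. f m x * \<zeta> x) \<longlonglongrightarrow> (LINT x|lebesgue_on \<Omega>. g x * \<zeta> x)"
    if f: "\<And>m. dominated c t (f m)" and g: "\<And>x. (\<lambda>m. f m x) \<longlonglongrightarrow> g x" and \<zeta>: "\<zeta> \<in> test_functions \<Omega>"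
    for c t f g \<zeta>
  proof -
    obtain B s where \<zeta>': "dominated B s \<zeta>" using test_function_dominated[OF \<zeta>] by blast
    show ?thesis
      by (rule dominated_integral_tendsto[OF dominated_mult[OF f dominated_measurable[OF \<zeta>'] dominated_bound[OF \<zeta>']] _ \<Omega>])
        (intro tendsto_intros g)
  qed
  have "(\<lambda>m. LINT x|lebesgue_on \<Omega>. cut m w x * partial_deriv b \<phi> x)
      \<longlonglongrightarrow> (LINT x|lebesgue_on \<Omega>. ext_zero Q w x * partial_deriv b \<phi> x)"
    by (rule lim[OF C cut_tendsto test_function_partial_deriv[OF \<phi> b]])
  moreover have "(LINT x|lebesgue_on \<Omega>. cut m w x * partial_deriv b \<phi> x)
      = - (LINT x|lebesgue_on \<Omega>. partial_deriv b (cut m w) x * \<phi> x)" for m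
    by (rule integration_by_parts[OF \<phi> test_function_smooth[OF cut_test_function[OF w]] b \<Omega>])
  ultimately have "(\<lambda>m. - (LINT x|lebesgue_on \<Omega>. partial_deriv b (cut m w) x * \<phi> x))
      \<longlonglongrightarrow> (LINT x|lebesgue_on \<Omega>. ext_zero Q w x * partial_deriv b \<phi> x)" by simp
  moreover have "(\<lambda>m. - (LINT x|lebesgue_on \<Omega>. partial_deriv b (cut m w) x * \<phi> x))
      \<longlonglongrightarrow> - (LINT x|lebesgue_on \<Omega>. ext_zero Q (partial_deriv b w) x * \<phi> x)"
    by (intro tendsto_minus lim[OF D \<phi>])
  ultimately show "(LINT x|lebesgue_on \<Omega>. ext_zero Q w x * partial_deriv b \<phi> x)
      = - (LINT x|lebesgue_on \<Omega>. ext_zero Q (partial_deriv b w) x * \<phi> x)"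
    by (rule LIMSEQ_unique)
qed

text \<open>A jump of the gradient would now contribute a surface term on the frontier of
  \<open>Q\<close>. As \<Omega> meets the frontier only where \<open>w\<close> vanishes identically
  nearby, \<phi> can be exchanged for a test function supported inside \<open>Q\<close> without
  changing either integrand; after that \<open>w\<close> is smooth on the whole support.\<close>

lemma has_weak_laplacian_ext_zero:
  assumes w: "smooth w" and N: "open N" "\<And>x. x \<in> N \<Longrightarrow> w x = 0" and fr: "frontier Q \<inter> \<Omega> \<subseteq> N"
    and \<Omega>: "\<Omega> \<in> sets lebesgue" "Q \<subseteq> \<Omega>"
  shows "has_weak_laplacian \<Omega> (ext_zero Q w) (ext_zero Q (laplacian w))"
  unfolding has_weak_laplacian_def
proof
  fix \<phi> assume \<phi>: "\<phi> \<in> test_functions \<Omega>"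
  obtain K where K: "compact K" "K \<subseteq> \<Omega>" "\<And>x. x \<notin> K \<Longrightarrow> \<phi> x = 0"
    using test_functionE[OF \<phi>] by blast
  \<comment> \<open>The part of the support of \<phi> on which \<open>w\<close> may be nonzero. It
    avoids the frontier, so \<open>v\<close> has a positive lower bound there and a large
    \<open>m\<close> puts the step in its constant range.\<close>
  let ?K = "K \<inter> closure Q - N"
  have cK: "compact ?K" using K(1) N(1) by (intro compact_diff compact_Int_closed) auto
  have KQ: "?K \<subseteq> Q"
  proof
    fix x assume x: "x \<in> ?K"
    then have "x \<notin> frontier Q" using fr K(2) by auto
    with x show "x \<in> Q" using open_Q by (auto simp: frontier_def interior_open)
  qed
  obtain c where c: "c > 0" "\<And>x. x \<in> ?K \<Longrightarrow> v x \<ge> c"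
  proof (cases "?K = {}")
    case True
    then show ?thesis using that[of 1] by auto
  next
    case False
    obtain y where "y \<in> ?K" "\<forall>x\<in>?K. v y \<le> v x"
      using continuous_attains_inf[OF cK False continuous_v] by blast
    then show ?thesis using that[of "v y"] v_pos KQ by blast
  qed
  obtain m where m: "2 < real (Suc m) * c"
  proof -
    obtain n where "2 / c < real n" using reals_Archimedean2 by blast
    then have "2 / c < real (Suc n)" by simp
    then show thesis using that[of n] c(1) by (simp add: divide_simps mult.commute)
  qed
  let ?\<phi> = "cut m \<phi>"
  have \<phi>Q: "?\<phi> \<in> test_functions Q" by (rule cut_test_function[OF test_function_smooth[OF \<phi>]])
  have near: "ext_zero Q w x * laplacian \<phi> x = w x * laplacian ?\<phi> x \<and>
      ext_zero Q (laplacian w) x * \<phi> x = laplacian w x * ?\<phi> x" for x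
  proof (cases "x \<in> Q")
    case False
    then show ?thesis
      using test_function_zero_outside[OF \<phi>Q] test_function_zero_outside[OF test_function_laplacian[OF \<phi>Q]]
      by (simp add: ext_zero_def)
  next
    case Q: True
    show ?thesis
    proof (cases "x \<in> N")
      case True
      have "laplacian w x = laplacian (\<lambda>_. 0) x"
        by (rule laplacian_cong_open[OF N(1) True N(2)])
      also have "\<dots> = 0"
        unfolding laplacian_def
        by (intro sum.neutral ballI partial_deriv_zero_open[of UNIV]) auto
      finally show ?thesis using N(2)[OF True] by (simp add: ext_zero_def)
    next
      case False
      \<comment> \<open>A neighbourhood on which \<phi> equals its cut version: either the step is 1
        there, or \<phi> itself is zero. Agreement on an open set is required because the Laplacians
        are compared.\<close>
      define U where "U = (if x \<in> K then Q \<inter> {y. 2 < real (Suc m) * v y} else Q \<inter> - K)"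
      have "open U"
        unfolding U_def using open_Q K(1)
        by (auto intro!: open_Int open_Collect_less continuous_intros continuous_v simp: compact_imp_closed open_Compl)
      moreover have "x \<in> U"
      proof (cases "x \<in> K")
        case True
        then have "c \<le> v x" using c(2)[of x] Q False closure_subset[of Q] by auto
        then have "real (Suc m) * c \<le> real (Suc m) * v x" by (intro mult_left_mono) auto
        with m have "2 < real (Suc m) * v x" by (rule less_le_trans)
        then show ?thesis using True Q by (simp add: U_def)
      qed (use Q in \<open>simp add: U_def\<close>)
      moreover have "\<phi> y = ?\<phi> y" if "y \<in> U" for y
        using that K(3)[of y] by (auto simp: U_def cut_def ext_zero_def smooth_step_eq_1 split: if_splits)
      ultimately show ?thesis
        using laplacian_cong_open[of U x \<phi> ?\<phi>] Q by (simp add: ext_zero_def)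
    qed
  qed
  have "(LINT x|lebesgue_on \<Omega>. ext_zero Q w x * laplacian \<phi> x) = (LINT x|lebesgue_on \<Omega>. w x * laplacian ?\<phi> x)"
    using near by simp
  also have "\<dots> = (LINT x|lebesgue_on \<Omega>. laplacian w x * ?\<phi> x)"
    by (rule integration_by_parts_laplacian[OF test_functions_mono[OF \<phi>Q \<Omega>(2)] w \<Omega>(1)])
  also have "\<dots> = (LINT x|lebesgue_on \<Omega>. ext_zero Q (laplacian w) x * \<phi> x)"
    using near by simp
  finally show "(LINT x|lebesgue_on \<Omega>. ext_zero Q w x * laplacian \<phi> x)
      = (LINT x|lebesgue_on \<Omega>. ext_zero Q (laplacian w) x * \<phi> x)" .
qed

end

section \<open>Cubes and the fundamental lemma\<close>

definition cube :: "'a::euclidean_space \<Rightarrow> real \<Rightarrow> 'a set" where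
  "cube p L = box p (p + L *\<^sub>R One)"

text \<open>The lowest Dirichlet eigenfunction of the cube with lower corner \<open>p\<close>,
  unnormalised and defined on the whole space.\<close>

definition cube_mode :: "'a::euclidean_space \<Rightarrow> real \<Rightarrow> 'a \<Rightarrow> real" where
  "cube_mode p L x = (\<Prod>b\<in>Basis. sin (pi / L * ((x - p) \<bullet> b)))"

lemma mem_cube: "x \<in> cube p L \<longleftrightarrow> (\<forall>b\<in>Basis. 0 < (x - p) \<bullet> b \<and> (x - p) \<bullet> b < L)"
  by (auto simp: cube_def mem_box inner_left_distrib inner_diff_left)

lemma smooth_real_sin: "smooth_real sin"
  unfolding smooth_real_def
\<comment> \<open>A phase shift by pi/2 per derivative gives one formula for all orders.\<close>
proof (intro exI[of _ "\<lambda>m t. sin (t + real m * (pi / 2))"] conjI allI)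
  fix m t
  have "t + real (Suc m) * (pi / 2) = (t + real m * (pi / 2)) + pi / 2"
    by (simp add: field_simps)
  then have "cos (t + real m * (pi / 2)) = sin (t + real (Suc m) * (pi / 2))"
    by (simp only: sin_add cos_pi_half sin_pi_half mult_zero_right mult_1_right add_0_left)
  moreover have "((\<lambda>t. sin (t + real m * (pi / 2))) has_real_derivative cos (t + real m * (pi / 2))) (at t)"
    by (auto intro!: derivative_eq_intros)
  ultimately show "((\<lambda>t. sin (t + real m * (pi / 2))) has_real_derivative sin (t + real (Suc m) * (pi / 2))) (at t)"
    by simp
qed simp

lemma smooth_sin_inner: "smooth (\<lambda>x. complex_of_real (sin (c * ((x - p) \<bullet> b))))"
proof -
  have "(\<lambda>x. complex_of_real (sin (c * ((x - p) \<bullet> b)))) = (\<lambda>x. of_real (sin ((- c * (p \<bullet> b)) + c * (x \<bullet> b))))"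
    by (simp add: inner_diff_left algebra_simps)
  then show ?thesis
    using smooth_compose_real[OF smooth_real_sin smooth_compose_real[OF smooth_real_affine smooth_inner]] by metis
qed

lemma smooth_cube_mode: "smooth (\<lambda>x. complex_of_real (cube_mode p L x))"
  unfolding cube_mode_def of_real_prod by (intro smooth_prod smooth_sin_inner)

lemma cavity_cube:
  assumes "L > 0"
  shows "cavity (cube p L) (cube_mode p L)"
proof
  show "0 < cube_mode p L x" if "x \<in> cube p L" for x
    unfolding cube_mode_def
  proof (intro prod_pos sin_gt_zero)
    fix b :: 'a assume b: "b \<in> Basis"
    then have "0 < (x - p) \<bullet> b" "(x - p) \<bullet> b < L" using that by (auto simp: mem_cube)
    then show "0 < pi / L * ((x - p) \<bullet> b)" "pi / L * ((x - p) \<bullet> b) < pi"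
      using assms by (auto simp: divide_simps)
  qed
  show "cube_mode p L x = 0" if "x \<in> frontier (cube p L)" for x
  proof -
    have "x \<in> cbox p (p + L *\<^sub>R One)" "x \<notin> cube p L"
      using that by (auto simp: cube_def frontier_box split: if_splits)
    then obtain b where b: "b \<in> Basis" "(x - p) \<bullet> b = 0 \<or> (x - p) \<bullet> b = L"
      by (force simp: mem_cube mem_box inner_left_distrib inner_diff_left)
    then have "sin (pi / L * ((x - p) \<bullet> b)) = 0" using assms by auto
    then show ?thesis unfolding cube_mode_def using b(1) by (intro prod_zero) auto
  qed
qed (auto simp: cube_def smooth_cube_mode)

text \<open>Determines weak derivatives up to null sets, and thereby the choice made in
  \<open>weak_deriv\<close>. Test functions approximating the indicator of a small cube show that
  the integrals of \<open>d\<close> over such cubes vanish; Lebesgue differentiation then gives the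
  claim without mollifiers.\<close>

lemma fundamental_lemma:
  fixes d :: "'a::euclidean_space \<Rightarrow> complex"
  assumes \<Omega>: "open \<Omega>" and d: "d \<in> L2 \<Omega>"
    and test: "\<And>\<phi>. \<phi> \<in> test_functions \<Omega> \<Longrightarrow> (LINT x|lebesgue_on \<Omega>. d x * \<phi> x) = 0"
  shows "AE x in lebesgue_on \<Omega>. d x = 0"
proof -
  have L\<Omega>: "\<Omega> \<in> sets lebesgue" using \<Omega> by auto
  define f where "f = ext_zero \<Omega> d"
  have dm: "d \<in> borel_measurable (lebesgue_on \<Omega>)" and di: "integrable (lebesgue_on \<Omega>) (\<lambda>x. (cmod (d x))\<^sup>2)"
    using d by (auto simp: L2_def)
  have fm: "f \<in> borel_measurable lebesgue"
    using dm borel_measurable_if[OF L\<Omega>, of d] by (simp add: f_def ext_zero_def[abs_def])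
  have "integrable lebesgue (\<lambda>x. indicator \<Omega> x *\<^sub>R (cmod (d x))\<^sup>2)"
    using di L\<Omega> by (subst (asm) integrable_restrict_space) auto
  moreover have "indicator \<Omega> x *\<^sub>R (cmod (d x))\<^sup>2 = (cmod (f x))\<^sup>2" for x
    by (simp add: f_def ext_zero_def)
  ultimately have fi: "integrable lebesgue (\<lambda>x. (cmod (f x))\<^sup>2)" by simp
  \<comment> \<open>Local integrability follows from square integrability through c \<le> 1 +
    c^2.\<close>
  have si: "set_integrable lebesgue (cbox a b) f" for a b
    unfolding set_integrable_def
  proof (rule Bochner_Integration.integrable_bound)
    have "integrable lebesgue (indicator (cbox a b) :: 'a \<Rightarrow> real)"
      by (intro integrable_real_indicator) (auto simp: emeasure_lborel_cbox_eq)
    then show "integrable lebesgue (\<lambda>x. indicator (cbox a b) x + (cmod (f x))\<^sup>2)"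
      using fi by auto
    have "c \<le> 1 + c\<^sup>2" for c :: real
    proof -
      have "0 \<le> (c - 1 / 2)\<^sup>2" by simp
      then show ?thesis by (simp add: power2_eq_square algebra_simps)
    qed
    then have "norm (indicat_real (cbox a b) x *\<^sub>R f x) \<le> norm (indicat_real (cbox a b) x + (cmod (f x))\<^sup>2)" for x
      by (auto simp: indicator_def)
    then show "AE x in lebesgue. norm (indicat_real (cbox a b) x *\<^sub>R f x) \<le> norm (indicat_real (cbox a b) x + (cmod (f x))\<^sup>2)"
      by simp
    show "(\<lambda>x. indicat_real (cbox a b) x *\<^sub>R f x) \<in> borel_measurable lebesgue"
      by (intro borel_measurable_scaleR borel_measurable_indicator fm) auto
  qed
  have fint: "f integrable_on cbox a b" for a b
    using set_lebesgue_integral_eq_integral(1)[OF si] .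
  \<comment> \<open>Lebesgue differentiation along the cubes with lower corner
    \<open>x\<close>.\<close>
  obtain N where N: "negligible N"
    "\<And>x e. x \<notin> N \<Longrightarrow> 0 < e \<Longrightarrow> \<exists>\<delta>>0. \<forall>h. 0 < h \<and> h < \<delta> \<longrightarrow>
       norm (integral (cbox x (x + h *\<^sub>R One)) f /\<^sub>R h ^ DIM('a) - f x) < e"
    using integrable_ccontinuous_explicit[of f] fint by metis
  have cube0: "integral (cbox x (x + h *\<^sub>R One)) f = 0"
    if h: "h > 0" and sub: "cbox x (x + h *\<^sub>R One) \<subseteq> \<Omega>" for x h
  proof -
    \<comment> \<open>The cuts of the constant 1 are test functions converging boundedly to the
      indicator of this cube.\<close>
    interpret cavity "cube x h" "cube_mode x h" by (rule cavity_cube[OF h])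
    have cs: "cube x h \<subseteq> cbox x (x + h *\<^sub>R One)" by (simp add: cube_def box_subset_cbox)
    have one: "smooth (\<lambda>_. 1)" by blast
    have t0: "(LINT y|lebesgue_on \<Omega>. d y * cut m (\<lambda>_. 1) y) = 0" for m
      by (intro test test_functions_mono[OF cut_test_function[OF one]]) (use cs sub in auto)
    have "(\<lambda>m. LINT y|lebesgue_on \<Omega>. d y * cut m (\<lambda>_. 1) y)
        \<longlonglongrightarrow> (LINT y|lebesgue_on \<Omega>. d y * ext_zero (cube x h) (\<lambda>_. 1) y)"
    proof (rule integral_dominated_convergence)
      show "integrable (lebesgue_on \<Omega>) (\<lambda>y. cmod (indicat_real (cbox x (x + h *\<^sub>R One)) y *\<^sub>R f y))"
      proof -
        have "integrable lebesgue (\<lambda>y. indicat_real \<Omega> y *\<^sub>R (cmod (indicat_real (cbox x (x + h *\<^sub>R One)) y *\<^sub>R f y)))"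
          using si[of x "x + h *\<^sub>R One"] unfolding set_integrable_def
          by (intro integrable_mult_indicator[OF L\<Omega>] integrable_norm)
        then show ?thesis using L\<Omega> by (subst integrable_restrict_space) auto
      qed
      show "AE y in lebesgue_on \<Omega>. (\<lambda>m. d y * cut m (\<lambda>_. 1) y) \<longlonglongrightarrow> d y * ext_zero (cube x h) (\<lambda>_. 1) y"
        by (intro always_eventually allI tendsto_intros cut_tendsto)
      have "norm (d y * cut m (\<lambda>_. 1) y) \<le> cmod (indicat_real (cbox x (x + h *\<^sub>R One)) y *\<^sub>R f y)" for y m
      proof (cases "y \<in> cube x h")
        case True
        then have "y \<in> cbox x (x + h *\<^sub>R One)" "y \<in> \<Omega>" using cs sub by auto
        then show ?thesis
          using True mult_left_mono[OF smooth_step_abs_le[of "real (Suc m) * cube_mode x h y"], of "cmod (d y)"]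
          by (simp add: cut_def ext_zero_def norm_mult f_def)
      qed (simp add: cut_def ext_zero_def)
      then show "AE y in lebesgue_on \<Omega>. norm (d y * cut m (\<lambda>_. 1) y) \<le> cmod (indicat_real (cbox x (x + h *\<^sub>R One)) y *\<^sub>R f y)" for m
        by simp
      show "(\<lambda>y. d y * cut m (\<lambda>_. 1) y) \<in> borel_measurable (lebesgue_on \<Omega>)" for m
        by (intro borel_measurable_times dm measurable_lebesgue_on smooth_borel_measurable
            test_function_smooth[OF cut_test_function[OF one]])
      have "ext_zero (cube x h) (\<lambda>_. 1) \<in> borel_measurable borel"
        using dominated_ext_zero_smooth[OF one] dominated_measurable by metis
      then show "(\<lambda>y. d y * ext_zero (cube x h) (\<lambda>_. 1) y) \<in> borel_measurable (lebesgue_on \<Omega>)"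
        by (intro borel_measurable_times dm measurable_lebesgue_on)
    qed
    then have "(LINT y|lebesgue_on \<Omega>. d y * ext_zero (cube x h) (\<lambda>_. 1) y) = 0"
      unfolding t0 by (simp add: LIMSEQ_const_iff)
    also have "(LINT y|lebesgue_on \<Omega>. d y * ext_zero (cube x h) (\<lambda>_. 1) y)
        = (LINT y|lebesgue. indicat_real \<Omega> y *\<^sub>R (d y * ext_zero (cube x h) (\<lambda>_. 1) y))"
      using L\<Omega> by (subst integral_restrict_space) auto
    also have "\<dots> = (LINT y : cube x h | lebesgue. f y)"
      unfolding set_lebesgue_integral_def
      by (intro Bochner_Integration.integral_cong refl)
        (use cs sub in \<open>auto simp: indicator_def ext_zero_def f_def\<close>)
    also have "\<dots> = integral (cube x h) f"
    proof (rule set_lebesgue_integral_eq_integral(2))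
      show "set_integrable lebesgue (cube x h) f"
        by (rule set_integrable_subset[OF si _ cs]) (auto simp: cube_def)
    qed
    also have "\<dots> = integral (cbox x (x + h *\<^sub>R One)) f"
      by (simp add: cube_def integral_open_interval)
    finally show ?thesis .
  qed
  have zero: "d x = 0" if x: "x \<in> \<Omega>" "x \<notin> N" for x
  proof -
    obtain e0 where e0: "e0 > 0" "ball x e0 \<subseteq> \<Omega>" using \<Omega> x(1) open_contains_ball by blast
    have inside: "cbox x (x + h *\<^sub>R One) \<subseteq> \<Omega>" if h: "0 < h" "h * real DIM('a) < e0" for h
    proof
      fix y assume y: "y \<in> cbox x (x + h *\<^sub>R One)"
      have "norm (y - x) \<le> (\<Sum>b\<in>Basis. \<bar>(y - x) \<bullet> b\<bar>)" by (rule norm_le_l1)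
      also have "\<dots> \<le> (\<Sum>b\<in>(Basis::'a set). h)"
        using y by (intro sum_mono) (auto simp: mem_box inner_left_distrib inner_diff_left)
      finally have "norm (y - x) < e0" using h(2) by (simp add: mult.commute)
      then show "y \<in> \<Omega>" using e0(2) by (auto simp: dist_norm norm_minus_commute)
    qed
    have "cmod (d x) < e" if e: "e > 0" for e
    proof -
      obtain \<delta> where \<delta>: "\<delta> > 0" "\<And>h. 0 < h \<Longrightarrow> h < \<delta> \<Longrightarrow>
          norm (integral (cbox x (x + h *\<^sub>R One)) f /\<^sub>R h ^ DIM('a) - f x) < e"
        using N(2)[OF x(2) e] by blast
      \<comment> \<open>All points of the cube have l1 distance at most \<open>h\<close> times the
        dimension from \<open>x\<close>; the second entry keeps the cube inside the ball of radius
        \<open>e0\<close>.\<close>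
      define h where "h = min (\<delta> / 2) (e0 / 2 / real DIM('a))"
      have h: "0 < h" "h < \<delta>" using \<delta>(1) e0(1) by (auto simp: h_def)
      have "h * real DIM('a) \<le> e0 / 2 / real DIM('a) * real DIM('a)"
        by (intro mult_right_mono) (auto simp: h_def)
      also have "\<dots> < e0" using e0(1) by simp
      finally have "h * real DIM('a) < e0" .
      from cube0[OF h(1) inside[OF h(1) this]] \<delta>(2)[OF h] show ?thesis
        using x(1) by (simp add: f_def ext_zero_def)
    qed
    then show ?thesis by (metis less_irrefl zero_less_norm_iff)
  qed
  have "N \<in> null_sets lebesgue" using N(1) by (simp add: negligible_iff_null_sets)
  then have "AE x in lebesgue. x \<notin> N" by (rule AE_not_in)
  then have "AE x in lebesgue. x \<in> \<Omega> \<longrightarrow> d x = 0" by (rule AE_mp) (use zero in auto)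
  then show ?thesis using L\<Omega> by (simp add: AE_restrict_space_iff)
qed

section \<open>Uniqueness of weak derivatives in L2\<close>

lemma L2_diff:
  assumes "f \<in> L2 S" "g \<in> L2 S"
  shows "(\<lambda>x. f x - g x) \<in> L2 S"
proof -
  have m: "f \<in> borel_measurable (lebesgue_on S)" "g \<in> borel_measurable (lebesgue_on S)"
    using assms by (auto simp: L2_def)
  have "integrable (lebesgue_on S) (\<lambda>x. (cmod (f x - g x))\<^sup>2)"
  proof (rule Bochner_Integration.integrable_bound)
    show "integrable (lebesgue_on S) (\<lambda>x. 2 * (cmod (f x))\<^sup>2 + 2 * (cmod (g x))\<^sup>2)"
      using assms by (auto simp: L2_def)
    have "(cmod (f x - g x))\<^sup>2 \<le> 2 * (cmod (f x))\<^sup>2 + 2 * (cmod (g x))\<^sup>2" for x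
    proof -
      have "(cmod (f x - g x))\<^sup>2 \<le> (cmod (f x) + cmod (g x))\<^sup>2"
        by (intro power_mono norm_triangle_ineq4) auto
      also have "\<dots> \<le> 2 * (cmod (f x))\<^sup>2 + 2 * (cmod (g x))\<^sup>2"
        using zero_le_power2[of "cmod (f x) - cmod (g x)"] by (simp add: power2_eq_square algebra_simps)
      finally show ?thesis .
    qed
    then show "AE x in lebesgue_on S. norm ((cmod (f x - g x))\<^sup>2) \<le> norm (2 * (cmod (f x))\<^sup>2 + 2 * (cmod (g x))\<^sup>2)"
      by simp
  qed (use m in auto)
  with m show ?thesis by (simp add: L2_def)
qed

lemma L2_mult_test_function_integrable:
  assumes g: "g \<in> L2 \<Omega>" and \<phi>: "\<phi> \<in> test_functions \<Omega>" and \<Omega>: "\<Omega> \<in> sets lebesgue"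
  shows "integrable (lebesgue_on \<Omega>) (\<lambda>x. g x * \<phi> x)"
proof (rule Bochner_Integration.integrable_bound)
  obtain C r where C: "dominated C r \<phi>" using test_function_dominated[OF \<phi>] by blast
  from dominated_L2[OF this \<Omega>] g
  show "integrable (lebesgue_on \<Omega>) (\<lambda>x. (cmod (g x))\<^sup>2 + (cmod (\<phi> x))\<^sup>2)"
    by (auto simp: L2_def)
  have "cmod (g x * \<phi> x) \<le> (cmod (g x))\<^sup>2 + (cmod (\<phi> x))\<^sup>2" for x
  proof -
    have "0 \<le> (cmod (g x) - cmod (\<phi> x))\<^sup>2 + (cmod (g x))\<^sup>2 + (cmod (\<phi> x))\<^sup>2" by simp
    then show ?thesis by (simp add: norm_mult power2_eq_square algebra_simps)
  qed
  then show "AE x in lebesgue_on \<Omega>. norm (g x * \<phi> x) \<le> norm ((cmod (g x))\<^sup>2 + (cmod (\<phi> x))\<^sup>2)"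
    by simp
  show "(\<lambda>x. g x * \<phi> x) \<in> borel_measurable (lebesgue_on \<Omega>)"
    using g dominated_measurable_on[OF C, of \<Omega>] by (auto simp: L2_def)
qed

text \<open>\<open>H1_norm\<close> contains a Hilbert choice; any explicitly known weak derivative
  now gives its value.\<close>

lemma L2_norm_weak_deriv:
  assumes \<Omega>: "open \<Omega>" and g: "g \<in> L2 \<Omega>" "has_weak_deriv \<Omega> b u g"
  shows "L2_norm \<Omega> (weak_deriv \<Omega> b u) = L2_norm \<Omega> g"
proof -
  have L\<Omega>: "\<Omega> \<in> sets lebesgue" using \<Omega> by auto
  define g' where "g' = weak_deriv \<Omega> b u"
  have g': "g' \<in> L2 \<Omega>" "has_weak_deriv \<Omega> b u g'"
    unfolding g'_def weak_deriv_def by (rule someI2[of _ g]; use g in blast)+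
  have "AE x in lebesgue_on \<Omega>. g' x - g x = 0"
  proof (rule fundamental_lemma[OF \<Omega> L2_diff[OF g'(1) g(1)]])
    fix \<phi> assume \<phi>: "\<phi> \<in> test_functions \<Omega>"
    have "(LINT x|lebesgue_on \<Omega>. g' x * \<phi> x) = (LINT x|lebesgue_on \<Omega>. g x * \<phi> x)"
      using g(2) g'(2) \<phi> by (simp add: has_weak_deriv_def)
    then show "(LINT x|lebesgue_on \<Omega>. (g' x - g x) * \<phi> x) = 0"
      by (simp add: left_diff_distrib L2_mult_test_function_integrable[OF _ \<phi> L\<Omega>] g(1) g'(1))
  qed
  then have "(LINT x|lebesgue_on \<Omega>. (cmod (g' x))\<^sup>2) = (LINT x|lebesgue_on \<Omega>. (cmod (g x))\<^sup>2)"
    using g(1) g'(1) by (intro integral_cong_AE) (auto simp: L2_def)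
  then show ?thesis by (simp add: L2_norm_def g'_def)
qed

section \<open>Solutions supported in a cavity\<close>

context cavity
begin

text \<open>The functions \<open>cut m\<close> of the product are the approximating test functions:
  values and first derivatives converge pointwise under bounds that do not depend on
  \<open>m\<close>, so the H1 distance tends to zero.\<close>

lemma H10_ext_zero:
  assumes \<psi>: "smooth \<psi>" and \<Omega>: "open \<Omega>" "Q \<subseteq> \<Omega>"
  shows "ext_zero Q (\<lambda>x. \<psi> x * of_real (v x)) \<in> H10 \<Omega>"
proof -
  define w where "w = (\<lambda>x. \<psi> x * of_real (v x))"
  have w: "smooth w" unfolding w_def by (intro smooth_mult \<psi> smooth_v)
  have L\<Omega>: "\<Omega> \<in> sets lebesgue" using \<Omega> by auto
  obtain C0 r0 where u0: "dominated C0 r0 (ext_zero Q w)" using dominated_ext_zero_smooth[OF w] by blast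
  have dd: "\<exists>C r. dominated C r (ext_zero Q (partial_deriv b w))" if "b \<in> Basis" for b
    using dominated_ext_zero_smooth[OF smooth_partial_deriv[OF w that]] by metis
  have wd: "has_weak_deriv \<Omega> b (ext_zero Q w) (ext_zero Q (partial_deriv b w))" if "b \<in> Basis" for b
    unfolding w_def by (rule has_weak_deriv_ext_zero[OF \<psi> that L\<Omega>])
  have "ext_zero Q w \<in> H1 \<Omega>"
    unfolding H1_def using dominated_L2[OF u0 L\<Omega>] wd dd dominated_L2[OF _ L\<Omega>] by blast
  moreover have "\<exists>\<phi>\<in>test_functions \<Omega>. H1_norm \<Omega> (\<lambda>x. ext_zero Q w x - \<phi> x) < \<epsilon>" if \<epsilon>: "\<epsilon> > 0" for \<epsilon>
  proof -
    obtain C r where C: "\<And>m. dominated C r (cut m w)" using dominated_cut[OF w] by blast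
    have l0: "(\<lambda>m. L2_norm \<Omega> (\<lambda>x. ext_zero Q w x - cut m w x)) \<longlonglongrightarrow> 0"
    proof -
      have "(\<lambda>m. L2_norm \<Omega> (\<lambda>x. ext_zero Q w x - cut m w x)) \<longlonglongrightarrow> L2_norm \<Omega> (\<lambda>x. ext_zero Q w x - ext_zero Q w x)"
        by (rule dominated_L2_norm_tendsto[OF dominated_diff[OF dominated_lim[OF C cut_tendsto] C] _ L\<Omega>])
          (intro tendsto_intros cut_tendsto)
      then show ?thesis by (simp add: L2_norm_def)
    qed
    have lb: "(\<lambda>m. L2_norm \<Omega> (weak_deriv \<Omega> b (\<lambda>x. ext_zero Q w x - cut m w x))) \<longlonglongrightarrow> 0" if b: "b \<in> Basis" for b
    proof -
      let ?d = "\<lambda>m. partial_deriv b (cut m w)" and ?g = "ext_zero Q (partial_deriv b w)"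
      obtain D s where D: "\<And>m. dominated D s (?d m)" "\<And>x. (\<lambda>m. ?d m x) \<longlonglongrightarrow> ?g x"
        using partial_deriv_cut_convergence[OF \<psi> b] unfolding w_def by blast
      have dom: "dominated (\<bar>\<bar>D\<bar>\<bar> + \<bar>D\<bar>) s (\<lambda>x. ?g x - ?d m x)" for m
        by (rule dominated_diff[OF dominated_lim[OF D] D(1)])
      have "(\<lambda>m. L2_norm \<Omega> (\<lambda>x. ?g x - ?d m x)) \<longlonglongrightarrow> L2_norm \<Omega> (\<lambda>x. ?g x - ?g x)"
        by (rule dominated_L2_norm_tendsto[OF dom _ L\<Omega>]) (intro tendsto_intros D)
      moreover have "L2_norm \<Omega> (weak_deriv \<Omega> b (\<lambda>x. ext_zero Q w x - cut m w x)) = L2_norm \<Omega> (\<lambda>x. ?g x - ?d m x)" for m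
      proof (rule L2_norm_weak_deriv[OF \<Omega>(1) dominated_L2[OF dom L\<Omega>]])
        have "has_weak_deriv \<Omega> b (cut m w) (?d m)"
          unfolding has_weak_deriv_def
          using integration_by_parts[OF _ test_function_smooth[OF cut_test_function[OF w]] b L\<Omega>] by blast
        then show "has_weak_deriv \<Omega> b (\<lambda>x. ext_zero Q w x - cut m w x) (\<lambda>x. ?g x - ?d m x)"
          by (rule has_weak_deriv_diff[OF wd[OF b] _ L\<Omega> b u0 C dominated_lim[OF D] D(1)])
      qed
      ultimately show ?thesis by (simp add: L2_norm_def)
    qed
    have "(\<lambda>m. H1_norm \<Omega> (\<lambda>x. ext_zero Q w x - cut m w x)) \<longlonglongrightarrow> sqrt (0\<^sup>2 + (\<Sum>b\<in>(Basis::'a set). 0\<^sup>2))"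
      unfolding H1_norm_def by (intro tendsto_intros l0 lb)
    then have "\<forall>\<^sub>F m in sequentially. H1_norm \<Omega> (\<lambda>x. ext_zero Q w x - cut m w x) < \<epsilon>"
      using \<epsilon> by (intro order_tendstoD(2)) auto
    then obtain m where "H1_norm \<Omega> (\<lambda>x. ext_zero Q w x - cut m w x) < \<epsilon>"
      using eventually_happens'[OF sequentially_bot] by blast
    then show ?thesis using test_functions_mono[OF cut_test_function[OF w] \<Omega>(2)] by blast
  qed
  ultimately show ?thesis by (simp add: H10_def w_def)
qed

text \<open>A multiplier \<eta> is absorbed into the smooth factor: the product of \<eta> and \<psi>
  still vanishes on \<open>N\<close>, so the results for a general smooth factor apply to it. This
  is why \<psi> is left arbitrary throughout.\<close>

lemma H10_loc_Laplace_ext_zero: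
  assumes \<psi>: "smooth \<psi>" and \<Omega>: "open \<Omega>" "Q \<subseteq> \<Omega>"
    and N: "open N" "\<And>x. x \<in> N \<Longrightarrow> \<psi> x = 0" "frontier Q \<inter> \<Omega> \<subseteq> N"
  shows "ext_zero Q (\<lambda>x. \<psi> x * of_real (v x)) \<in> H10_loc_Laplace \<Omega>"
proof -
  let ?w = "\<lambda>x. \<psi> x * of_real (v x)"
  have w: "smooth ?w" by (intro smooth_mult \<psi> smooth_v)
  have L\<Omega>: "\<Omega> \<in> sets lebesgue" using \<Omega> by auto
  have loc: "ext_zero Q f \<in> L2_loc \<Omega>" if f: "smooth f" for f
  proof -
    obtain C r where "dominated C r (ext_zero Q f)" using dominated_ext_zero_smooth[OF f] by blast
    from dominated_L2[OF this] show ?thesis by (auto simp: L2_loc_def)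
  qed
  have "ext_zero Q ?w \<in> H1_loc \<Omega>"
    unfolding H1_loc_def
    using loc[OF w] loc[OF smooth_partial_deriv[OF w]] has_weak_deriv_ext_zero[OF \<psi> _ L\<Omega>] by blast
  moreover have "(\<lambda>x. \<eta> x * ext_zero Q ?w x) \<in> H10_Laplace \<Omega>" if \<eta>: "\<eta> \<in> test_functions UNIV" for \<eta>
  proof -
    have s: "smooth (\<lambda>x. \<eta> x * \<psi> x)" by (intro smooth_mult \<psi> test_function_smooth[OF \<eta>])
    let ?w' = "\<lambda>x. \<eta> x * \<psi> x * of_real (v x)"
    have w': "smooth ?w'" by (intro smooth_mult s smooth_v)
    have eq: "(\<lambda>x. \<eta> x * ext_zero Q ?w x) = ext_zero Q ?w'" by (auto simp: ext_zero_def)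
    obtain C r where "dominated C r (ext_zero Q (laplacian ?w'))"
      using dominated_ext_zero_smooth[OF smooth_laplacian[OF w']] by blast
    from dominated_L2[OF this L\<Omega>] show ?thesis
      unfolding eq H10_Laplace_def
      using H10_ext_zero[OF s \<Omega>] has_weak_laplacian_ext_zero[OF w' N(1) _ N(3) L\<Omega> \<Omega>(2)] N(2)
      by (smt (verit, best) mem_Collect_eq mult_zero_left mult_zero_right)
  qed
  ultimately show ?thesis unfolding H10_loc_Laplace_def H10_loc_def H10_Laplace_def by auto
qed

text \<open>The data are whatever residual the Helmholtz operator leaves, so the equation holds for
  every \<kappa>; smallness of the data is a separate matter. Outside a large ball the zero function
  is the smooth representative demanded by the radiation condition.\<close>

lemma scattering_solution_ext_zero:
  assumes \<psi>: "smooth \<psi>" and \<Omega>: "open \<Omega>" "Q \<subseteq> \<Omega>"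
    and N: "open N" "\<And>x. x \<in> N \<Longrightarrow> \<psi> x = 0" "frontier Q \<inter> \<Omega> \<subseteq> N"
  defines "w \<equiv> \<lambda>x. \<psi> x * of_real (v x)"
  shows "scattering_solution \<Omega> \<kappa> (ext_zero Q (\<lambda>x. - (laplacian w x + of_real (\<kappa>\<^sup>2) * w x))) (ext_zero Q w)"
  unfolding scattering_solution_def
proof (intro conjI)
  have L\<Omega>: "\<Omega> \<in> sets lebesgue" using \<Omega> by auto
  have w: "smooth w" unfolding w_def by (intro smooth_mult \<psi> smooth_v)
  show "ext_zero Q w \<in> H10_loc_Laplace \<Omega>"
    unfolding w_def by (rule H10_loc_Laplace_ext_zero[OF \<psi> \<Omega> N])
  have "has_weak_laplacian \<Omega> (ext_zero Q w) (ext_zero Q (laplacian w))"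
    by (rule has_weak_laplacian_ext_zero[OF w N(1) _ N(3) L\<Omega> \<Omega>(2)]) (simp add: w_def N(2))
  moreover have "ext_zero Q (laplacian w) = (\<lambda>x. - ext_zero Q (\<lambda>x. - (laplacian w x + of_real (\<kappa>\<^sup>2) * w x)) x
      - of_real (\<kappa>\<^sup>2) * ext_zero Q w x)"
    by (auto simp: ext_zero_def)
  ultimately show "has_weak_laplacian \<Omega> (ext_zero Q w) (\<lambda>x. - ext_zero Q (\<lambda>x. - (laplacian w x + of_real (\<kappa>\<^sup>2) * w x)) x
      - of_real (\<kappa>\<^sup>2) * ext_zero Q w x)" by simp
  obtain r where r: "\<And>x. x \<in> Q \<Longrightarrow> norm x \<le> r" using Q_radius by blast
  have "frechet_derivative (\<lambda>_::'a. 0::complex) (at x) = (\<lambda>_. 0)" for x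
    by (rule frechet_derivative_at[symmetric]) (rule has_derivative_const)
  then show "radiation_condition \<Omega> \<kappa> (ext_zero Q w)"
    unfolding radiation_condition_def
    by (intro exI[of _ "\<lambda>_. 0"] exI[of _ r]) (use r in \<open>force simp: ext_zero_def\<close>)
qed

end

text \<open>Removes the domain from the norms of data and solution, so that an aperture can be fixed
  before the domain is known.\<close>

lemma L2_norm_UNIV:
  assumes "f \<in> borel_measurable borel" "\<Omega> \<in> sets lebesgue" "\<And>x. x \<notin> \<Omega> \<Longrightarrow> f x = 0"
  shows "L2_norm \<Omega> f = L2_norm UNIV f"
proof -
  have m: "(\<lambda>x. (cmod (f x))\<^sup>2) \<in> borel_measurable borel" using assms(1) by simp
  show ?thesis
    unfolding L2_norm_def using assms(2,3)
    by (subst (1 2) LINT_lebesgue_on_eq_lborel[OF m]) auto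
qed

text \<open>The cut-off leaves \<open>f\<close> and \<open>u\<close> unchanged, so they form a pair
  of the graph. Any admissible constant forces \<open>f\<close> to have nonzero norm, because
  \<open>u\<close> has; if no constant is admissible, the infimum over the empty set is
  infinite.\<close>

lemma L2_opnorm_cutoff_resolvent_ge:
  assumes sol: "scattering_solution \<Omega> \<kappa> f u" and f: "f \<in> L2_comp \<Omega>"
    and supp: "\<And>x. x \<notin> Q \<Longrightarrow> f x = 0" "\<And>x. x \<notin> Q \<Longrightarrow> u x = 0"
    and Q: "Q \<subseteq> \<Omega>" "\<And>x. x \<in> Q \<Longrightarrow> norm x < R"
    and a: "L2_norm \<Omega> u > 0" "a * L2_norm \<Omega> f \<le> L2_norm \<Omega> u"
  shows "ereal a \<le> L2_opnorm \<Omega> (cutoff_resolvent \<Omega> \<kappa> R)"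
proof -
  have cf: "cutoff \<Omega> R g = g" if "\<And>x. x \<notin> Q \<Longrightarrow> g x = 0" for g
    using that Q by (auto simp: cutoff_def indicator_def fun_eq_iff)
  have mem: "(f, u) \<in> cutoff_resolvent \<Omega> \<kappa> R"
    unfolding cutoff_resolvent_def resolvent_def
    using sol f cf[OF supp(1)] cf[OF supp(2)]
    by (auto simp: L2_comp_def intro!: exI[of _ f] exI[of _ u])
  show ?thesis
    unfolding L2_opnorm_def
  proof (rule Inf_greatest, clarify)
    fix C assume C: "\<forall>(f, g)\<in>cutoff_resolvent \<Omega> \<kappa> R. L2_norm \<Omega> g \<le> C * L2_norm \<Omega> f" "0 \<le> C"
    have 1: "L2_norm \<Omega> u \<le> C * L2_norm \<Omega> f" using C(1) mem by auto
    have "L2_norm \<Omega> f \<ge> 0" by (simp add: L2_norm_def)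
    moreover have "L2_norm \<Omega> f \<noteq> 0" using 1 a(1) by auto
    ultimately have "L2_norm \<Omega> f > 0" by simp
    moreover have "a * L2_norm \<Omega> f \<le> C * L2_norm \<Omega> f" using 1 a(2) by linarith
    ultimately show "ereal a \<le> ereal C" by simp
  qed
qed

section \<open>The corner quasimode\<close>

lemma Basis_neq_singleton:
  assumes "DIM('a::euclidean_space) \<ge> 2" shows "(Basis :: 'a set) \<noteq> {b}"
proof
  assume "(Basis :: 'a set) = {b}"
  then have "DIM('a) = card {b}" by (rule arg_cong)
  with assms show False by simp
qed

lemma partial_deriv_compose_inner:
  assumes F: "\<And>t. (F has_real_derivative F' t) (at t)"
  shows "partial_deriv b (\<lambda>x. complex_of_real (F (c * ((x - p) \<bullet> b')))) x
    = of_real (F' (c * ((x - p) \<bullet> b')) * (c * (b \<bullet> b')))"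
proof -
  have "((\<lambda>x. c * ((x - p) \<bullet> b')) has_derivative (\<lambda>h. c * (h \<bullet> b'))) (at x)"
    by (auto intro!: derivative_eq_intros)
  from has_derivative_compose[OF this F[unfolded has_field_derivative_def]]
  have "((\<lambda>x. F (c * ((x - p) \<bullet> b'))) has_derivative (\<lambda>h. F' (c * ((x - p) \<bullet> b')) * (c * (h \<bullet> b')))) (at x)" .
  from partial_deriv_eq[OF has_derivative_of_real[OF this]] show ?thesis .
qed

lemma partial_deriv_prod_eq_0:
  assumes "\<And>i. i \<in> A \<Longrightarrow> smooth (f i)" "\<And>i. i \<in> A \<Longrightarrow> partial_deriv b (f i) x = 0"
  shows "partial_deriv b (\<lambda>x. \<Prod>i\<in>A. f i x) x = 0"
proof -
  have one: "partial_deriv b (\<lambda>_. 1) x = 0" by (rule partial_deriv_eq[OF has_derivative_const])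
  show ?thesis
    using assms
  proof (induction A rule: infinite_finite_induct)
    case (insert a A)
    then have "smooth (f a)" "smooth (\<lambda>x. \<Prod>i\<in>A. f i x)" by (auto intro: smooth_prod)
    from partial_deriv_mult[OF this[THEN smooth_differentiable]] insert show ?case by simp
  qed (simp_all add: one)
qed

lemma partial_deriv_mult_smooth:
  assumes "smooth f" "smooth g"
  shows "partial_deriv b (\<lambda>x. f x * g x) = (\<lambda>x. f x * partial_deriv b g x + partial_deriv b f x * g x)"
  using partial_deriv_mult[OF assms[THEN smooth_differentiable]] by blast

lemma partial_deriv_cmult_smooth:
  assumes "smooth g"
  shows "partial_deriv b (\<lambda>x. c * g x) = (\<lambda>x. c * partial_deriv b g x)"
proof -
  have "partial_deriv b (\<lambda>_. c) x = 0" for x by (rule partial_deriv_eq[OF has_derivative_const])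
  then show ?thesis using partial_deriv_mult_smooth[OF smooth_const assms] by simp
qed

lemma partial_deriv2_mult_smooth:
  assumes "smooth f" "smooth g" "b \<in> Basis"
  shows "partial_deriv b (partial_deriv b (\<lambda>x. f x * g x)) x
    = f x * partial_deriv b (partial_deriv b g) x + 2 * (partial_deriv b f x * partial_deriv b g x)
      + partial_deriv b (partial_deriv b f) x * g x"
proof -
  note s = smooth_partial_deriv[OF assms(1,3)] smooth_partial_deriv[OF assms(2,3)]
  have "partial_deriv b (partial_deriv b (\<lambda>x. f x * g x)) x
    = partial_deriv b (\<lambda>x. f x * partial_deriv b g x + partial_deriv b f x * g x) x"
    by (simp only: partial_deriv_mult_smooth[OF assms(1,2)])
  also have "\<dots> = partial_deriv b (\<lambda>x. f x * partial_deriv b g x) x + partial_deriv b (\<lambda>x. partial_deriv b f x * g x) x"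
    by (intro partial_deriv_add smooth_differentiable smooth_mult assms s)
  finally show ?thesis
    by (simp add: partial_deriv_mult_smooth assms s)
qed

context
  fixes p :: "'a::euclidean_space" and L :: real
  assumes L: "L > 0"
begin

text \<open>Separation of variables: along direction \<open>b\<close> this factor is constant and
  only one sine varies.\<close>

definition side_factor :: "'a \<Rightarrow> 'a \<Rightarrow> real" where
  "side_factor b x = (\<Prod>c\<in>Basis - {b}. sin (pi / L * ((x - p) \<bullet> c)))"

lemma smooth_side_factor: "smooth (\<lambda>x. complex_of_real (side_factor b x))"
  unfolding side_factor_def of_real_prod by (intro smooth_prod smooth_sin_inner)

lemma partial_deriv_side_factor:
  assumes "b \<in> Basis" shows "partial_deriv b (\<lambda>x. complex_of_real (side_factor b x)) = (\<lambda>_. 0)"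
proof
  fix x
  show "partial_deriv b (\<lambda>x. complex_of_real (side_factor b x)) x = 0"
    unfolding side_factor_def of_real_prod
  proof (intro partial_deriv_prod_eq_0 smooth_sin_inner)
    fix c assume "c \<in> Basis - {b}"
    then have "b \<bullet> c = 0" using assms by (auto simp: inner_Basis)
    then show "partial_deriv b (\<lambda>x. complex_of_real (sin (pi / L * ((x - p) \<bullet> c)))) x = 0"
      by (subst partial_deriv_compose_inner[OF DERIV_sin]) simp
  qed
qed

lemma cube_mode_eq: "b \<in> Basis \<Longrightarrow> cube_mode p L x = sin (pi / L * ((x - p) \<bullet> b)) * side_factor b x"
  by (simp add: cube_mode_def side_factor_def prod.remove[OF finite_Basis])

lemma smooth_cos_inner: "smooth (\<lambda>x. complex_of_real (cos (c * ((x - p) \<bullet> b))))"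
proof -
  have "(pi / 2 - c * (p \<bullet> b)) + c * (x \<bullet> b) = pi / 2 + c * ((x - p) \<bullet> b)" for x
    by (simp add: inner_diff_left right_diff_distrib)
  then have "cos (c * ((x - p) \<bullet> b)) = sin ((pi / 2 - c * (p \<bullet> b)) + c * (x \<bullet> b))" for x
    by (simp only: sin_add cos_pi_half sin_pi_half mult_zero_left mult_1_left add_0_right)
  then show ?thesis
    using smooth_compose_real[OF smooth_real_sin smooth_compose_real[OF smooth_real_affine smooth_inner]] by simp
qed

lemma partial_deriv_cube_mode:
  assumes b: "b \<in> Basis"
  shows "partial_deriv b (\<lambda>x. complex_of_real (cube_mode p L x))
    = (\<lambda>x. of_real (pi / L) * (of_real (cos (pi / L * ((x - p) \<bullet> b))) * of_real (side_factor b x)))"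
proof -
  have "partial_deriv b (\<lambda>x. complex_of_real (sin (pi / L * ((x - p) \<bullet> b))))
      = (\<lambda>x. of_real (cos (pi / L * ((x - p) \<bullet> b)) * (pi / L)))"
    using partial_deriv_compose_inner[OF DERIV_sin, of b "pi / L" p b] b by (simp add: inner_Basis fun_eq_iff)
  then show ?thesis
    unfolding cube_mode_eq[OF b] of_real_mult partial_deriv_mult_smooth[OF smooth_sin_inner smooth_side_factor]
      partial_deriv_side_factor[OF b]
    by (simp add: fun_eq_iff)
qed

lemma partial_deriv2_cube_mode:
  assumes b: "b \<in> Basis"
  shows "partial_deriv b (partial_deriv b (\<lambda>x. complex_of_real (cube_mode p L x))) x
    = - of_real ((pi / L)\<^sup>2) * of_real (cube_mode p L x)"
proof -
  have "partial_deriv b (\<lambda>x. complex_of_real (cos (pi / L * ((x - p) \<bullet> b))))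
      = (\<lambda>x. of_real (- sin (pi / L * ((x - p) \<bullet> b)) * (pi / L)))"
    using partial_deriv_compose_inner[OF DERIV_cos, of b "pi / L" p b] b by (simp add: inner_Basis fun_eq_iff)
  then show ?thesis
    unfolding partial_deriv_cube_mode[OF b] cube_mode_eq[OF b, of x] of_real_mult
      partial_deriv_cmult_smooth[OF smooth_mult[OF smooth_cos_inner smooth_side_factor]]
      partial_deriv_mult_smooth[OF smooth_cos_inner smooth_side_factor] partial_deriv_side_factor[OF b]
    by (simp add: power2_eq_square)
qed

lemma laplacian_cube_mode:
  "laplacian (\<lambda>x. complex_of_real (cube_mode p L x)) x
    = - of_real ((pi * sqrt (real DIM('a)) / L)\<^sup>2) * of_real (cube_mode p L x)"
  unfolding laplacian_def
  by (simp add: partial_deriv2_cube_mode power_mult_distrib power_divide)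

lemma abs_sin_inner_le:
  assumes "c \<in> Basis" shows "\<bar>sin (pi / L * ((x - p) \<bullet> c))\<bar> \<le> pi / L * norm (x - p)"
proof -
  have "\<bar>sin (pi / L * ((x - p) \<bullet> c))\<bar> \<le> \<bar>pi / L * ((x - p) \<bullet> c)\<bar>" by (rule abs_sin_x_le_abs_x)
  also have "\<dots> \<le> pi / L * norm (x - p)"
    using L Basis_le_norm[OF assms, of "x - p"] by (simp add: abs_mult divide_right_mono)
  finally show ?thesis .
qed

text \<open>In dimension at least two one sine remains after removing direction \<open>b\<close>; it
  is of order |x - p|, and the others are at most 1. Hence the gradient of the mode vanishes to
  first order at the corner and the mode itself to second order.\<close>

lemma abs_side_factor_le:
  assumes b: "b \<in> Basis" and dim: "DIM('a) \<ge> 2"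
  shows "\<bar>side_factor b x\<bar> \<le> pi / L * norm (x - p)"
proof -
  have "(Basis :: 'a set) \<noteq> {b}" by (rule Basis_neq_singleton[OF dim])
  then obtain c where c: "c \<in> Basis" "c \<noteq> b" using b by auto
  have "side_factor b x = sin (pi / L * ((x - p) \<bullet> c)) * (\<Prod>c\<in>Basis - {b} - {c}. sin (pi / L * ((x - p) \<bullet> c)))"
    unfolding side_factor_def using c by (intro prod.remove) auto
  then have "\<bar>side_factor b x\<bar> = \<bar>sin (pi / L * ((x - p) \<bullet> c))\<bar> * (\<Prod>c\<in>Basis - {b} - {c}. \<bar>sin (pi / L * ((x - p) \<bullet> c))\<bar>)"
    by (simp only: abs_mult abs_prod)
  also have "\<dots> \<le> (pi / L * norm (x - p)) * 1"
    using L by (intro mult_mono abs_sin_inner_le c prod_le_1 prod_nonneg) auto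
  finally show ?thesis by simp
qed

lemma abs_cube_mode_le:
  assumes dim: "DIM('a) \<ge> 2"
  shows "\<bar>cube_mode p L x\<bar> \<le> (pi / L)\<^sup>2 * (norm (x - p))\<^sup>2"
proof -
  obtain b :: 'a where b: "b \<in> Basis" using nonempty_Basis by blast
  have "\<bar>cube_mode p L x\<bar> \<le> (pi / L * norm (x - p)) * (pi / L * norm (x - p))"
    unfolding cube_mode_eq[OF b] abs_mult using L
    by (intro mult_mono abs_sin_inner_le abs_side_factor_le b dim) auto
  then show ?thesis by (simp add: power2_eq_square algebra_simps)
qed

lemma norm_partial_deriv_cube_mode_le:
  assumes b: "b \<in> Basis" and dim: "DIM('a) \<ge> 2"
  shows "cmod (partial_deriv b (\<lambda>x. complex_of_real (cube_mode p L x)) x) \<le> (pi / L)\<^sup>2 * norm (x - p)"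
proof -
  have "cmod (partial_deriv b (\<lambda>x. complex_of_real (cube_mode p L x)) x)
     = pi / L * (\<bar>cos (pi / L * ((x - p) \<bullet> b))\<bar> * \<bar>side_factor b x\<bar>)"
    unfolding partial_deriv_cube_mode[OF b] using L by (simp add: norm_mult norm_divide)
  also have "\<dots> \<le> pi / L * (1 * (pi / L * norm (x - p)))"
    using L by (intro mult_left_mono mult_mono abs_side_factor_le b dim) auto
  finally show ?thesis by (simp add: power2_eq_square)
qed

end

section \<open>The radial cut-off at the corner\<close>

lemma partial_deriv_compose_real:
  assumes "\<And>t. (F has_real_derivative F' t) (at t)" "smooth (\<lambda>x. complex_of_real (w x))"
  shows "partial_deriv b (\<lambda>x. complex_of_real (F (w x)))
    = (\<lambda>x. of_real (F' (w x)) * partial_deriv b (\<lambda>x. of_real (w x)) x)"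
  using has_derivative_compose_real(2)[OF assms(1) smooth_differentiable[OF assms(2)]] by (rule ext)

lemma smooth_dist_sq: "smooth (\<lambda>x. complex_of_real ((norm (x - p))\<^sup>2))"
proof -
  have "(norm (x - p))\<^sup>2 = (\<Sum>b\<in>Basis. (x \<bullet> b + - (p \<bullet> b)) * (x \<bullet> b + - (p \<bullet> b)))" for x
    unfolding power2_norm_eq_inner euclidean_inner[of "x - p" "x - p"] by (simp add: inner_diff_left)
  then show ?thesis
    by (simp only: of_real_sum of_real_mult of_real_add)
      (intro smooth_sum smooth_mult smooth_add smooth_inner smooth_const)
qed

lemma partial_deriv_dist_sq:
  "partial_deriv b (\<lambda>x. complex_of_real ((norm (x - p))\<^sup>2)) = (\<lambda>x. of_real (2 * ((x - p) \<bullet> b)))"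
proof
  fix x
  have "((\<lambda>x. (norm (x - p))\<^sup>2) has_derivative (\<lambda>h. 2 * ((x - p) \<bullet> h))) (at x)"
    unfolding power2_norm_eq_inner by (auto intro!: derivative_eq_intros simp: inner_commute)
  from partial_deriv_eq[OF has_derivative_of_real[OF this]]
  show "partial_deriv b (\<lambda>x. complex_of_real ((norm (x - p))\<^sup>2)) x = of_real (2 * ((x - p) \<bullet> b))" .
qed

lemma smooth_double_inner: "smooth (\<lambda>x. complex_of_real (2 * ((x - p) \<bullet> b)))"
proof -
  have "(\<lambda>x. complex_of_real (2 * ((x - p) \<bullet> b))) = (\<lambda>x. of_real (- 2 * (p \<bullet> b) + 2 * (x \<bullet> b)))"
    by (simp add: inner_diff_left algebra_simps)
  then show ?thesis
    using smooth_compose_real[OF smooth_real_affine[of "- 2 * (p \<bullet> b)" 2] smooth_inner] by simp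
qed

lemma partial_deriv_double_inner:
  assumes "b \<in> Basis"
  shows "partial_deriv b (\<lambda>x. complex_of_real (2 * ((x - p) \<bullet> b))) = (\<lambda>x. 2)"
  using partial_deriv_compose_inner[OF DERIV_ident, of b 2 p b] assms by (simp add: fun_eq_iff)

text \<open>The squared distance keeps the cut-off smooth at \<open>p\<close>. It is zero for |x -
  p| \<le> (m+1)^(-1/2) and one for |x - p| \<ge> (2/(m+1))^(1/2).\<close>

definition corner_cut :: "nat \<Rightarrow> 'a::euclidean_space \<Rightarrow> 'a \<Rightarrow> complex" where
  "corner_cut m p x = of_real (smooth_step (real (Suc m) * (norm (x - p))\<^sup>2))"

lemma smooth_corner_cut: "smooth (corner_cut m p)"
  unfolding corner_cut_def[abs_def]
  using smooth_compose_real[OF smooth_real_affine[of 0 "real (Suc m)"] smooth_dist_sq]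
  by (intro smooth_compose_real[OF smooth_real_step]) simp

lemma corner_cut_eq_0:
  assumes "norm (x - p) \<le> 1 / sqrt (real (Suc m))" shows "corner_cut m p x = 0"
proof -
  have "(norm (x - p))\<^sup>2 \<le> (1 / sqrt (real (Suc m)))\<^sup>2" using assms by (intro power_mono) auto
  then have "real (Suc m) * (norm (x - p))\<^sup>2 \<le> 1" by (simp add: power_divide divide_simps mult.commute)
  then show ?thesis by (simp add: corner_cut_def smooth_step_eq_0)
qed

text \<open>The inequality is strict because the derivatives of the step are known to vanish for
  arguments above 2.\<close>

lemma corner_eventually:
  assumes "x \<noteq> p" shows "\<forall>\<^sub>F m in sequentially. real (Suc m) * (norm (x - p))\<^sup>2 > 2"
proof -
  have pos: "(norm (x - p))\<^sup>2 > 0" using assms by simp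
  obtain N where N: "2 / (norm (x - p))\<^sup>2 < real N" using reals_Archimedean2 by blast
  have "real (Suc m) * (norm (x - p))\<^sup>2 > 2" if "m \<ge> N" for m
  proof -
    have "2 / (norm (x - p))\<^sup>2 < real (Suc m)" using that N by linarith
    then show ?thesis using pos by (simp only: pos_divide_less_eq)
  qed
  then show ?thesis by (auto simp: eventually_sequentially)
qed

text \<open>
  At the corner \<open>p\<close> the mode vanishes to second order, which balances the two derivatives that
  fall on the cut-off.
\<close>

lemma corner_residual:
  fixes p :: "'a::euclidean_space"
  assumes L: "L > 0" and dim: "DIM('a) \<ge> 2"
  defines "w \<equiv> \<lambda>m x. corner_cut m p x * of_real (cube_mode p L x)"
  defines "r \<equiv> \<lambda>m x. laplacian (w m) x + of_real ((pi * sqrt (real DIM('a)) / L)\<^sup>2) * w m x"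
  obtains B where "B \<ge> 0" "\<And>m x. cmod (r m x) \<le> B"
    "\<And>x. x \<noteq> p \<Longrightarrow> \<forall>\<^sub>F m in sequentially. r m x = 0"
proof -
  let ?v = "\<lambda>x. complex_of_real (cube_mode p L x)"
  let ?\<alpha> = "pi / L"
  obtain h1 h2 C where h1: "\<And>t. (smooth_step has_real_derivative h1 t) (at t)"
    and h2: "\<And>t. (h1 has_real_derivative h2 t) (at t)"
    and sh1: "smooth_real h1" and z: "\<And>t. t > 2 \<Longrightarrow> h1 t = 0" "\<And>t. t > 2 \<Longrightarrow> h2 t = 0"
    and C: "C \<ge> 0" "\<And>t. \<bar>t * h1 t\<bar> \<le> C" "\<And>t. \<bar>t\<^sup>2 * h2 t\<bar> \<le> C"
    by (rule smooth_step_derivs) blast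
  have D1: "((\<lambda>t. smooth_step (M * t)) has_real_derivative h1 (M * t) * M) (at t)" for M t
    by (rule DERIV_chain2[OF h1 DERIV_cmult_Id])
  have D2: "((\<lambda>t. h1 (M * t) * M) has_real_derivative h2 (M * t) * M * M) (at t)" for M t
    by (rule DERIV_cmult_right[OF DERIV_chain2[OF h2 DERIV_cmult_Id]])
  define \<rho> where "\<rho> x = (norm (x - p))\<^sup>2" for x
  have sM: "smooth (\<lambda>x. complex_of_real (M * \<rho> x))" for M
    using smooth_compose_real[OF smooth_real_affine[of 0 M] smooth_dist_sq] by (simp add: \<rho>_def)
  have sG: "smooth (\<lambda>x. complex_of_real (h1 (M * \<rho> x) * M))" for M
    unfolding of_real_mult by (intro smooth_mult smooth_const smooth_compose_real[OF sh1] sM)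
  have d1: "partial_deriv b (corner_cut m p)
      = (\<lambda>x. of_real (h1 (real (Suc m) * \<rho> x) * real (Suc m)) * of_real (2 * ((x - p) \<bullet> b)))" for b m
    using partial_deriv_compose_real[OF D1 smooth_dist_sq, of b "real (Suc m)"]
    unfolding corner_cut_def[abs_def] \<rho>_def partial_deriv_dist_sq .
  have g: "partial_deriv b (\<lambda>x. complex_of_real (h1 (M * \<rho> x) * M))
      = (\<lambda>x. of_real (h2 (M * \<rho> x) * M * M) * of_real (2 * ((x - p) \<bullet> b)))" for b M
    using partial_deriv_compose_real[OF D2 smooth_dist_sq, of b M p]
    unfolding \<rho>_def partial_deriv_dist_sq .
  have d2: "partial_deriv b (partial_deriv b (corner_cut m p)) x
      = of_real (h1 (real (Suc m) * \<rho> x) * real (Suc m)) * 2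
        + of_real (h2 (real (Suc m) * \<rho> x) * real (Suc m) * real (Suc m)) * of_real (2 * ((x - p) \<bullet> b)) * of_real (2 * ((x - p) \<bullet> b))"
    if "b \<in> Basis" for b m x
    unfolding d1 partial_deriv_mult_smooth[OF sG smooth_double_inner] partial_deriv_double_inner[OF that] g ..
  \<comment> \<open>The eigenvalue equation cancels the term in which both derivatives fall on the
    mode; only terms with a derivative of the cut-off are left.\<close>
  have r: "r m x = (\<Sum>b\<in>Basis. 2 * (partial_deriv b (corner_cut m p) x * partial_deriv b ?v x)
      + partial_deriv b (partial_deriv b (corner_cut m p)) x * ?v x)" for m x
  proof -
    have "laplacian (w m) x = (\<Sum>b\<in>Basis. corner_cut m p x * partial_deriv b (partial_deriv b ?v) x
       + (2 * (partial_deriv b (corner_cut m p) x * partial_deriv b ?v x)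
      + partial_deriv b (partial_deriv b (corner_cut m p)) x * ?v x))"
      unfolding laplacian_def w_def
      by (intro sum.cong refl) (simp add: partial_deriv2_mult_smooth smooth_corner_cut smooth_cube_mode)
    also have "\<dots> = corner_cut m p x * laplacian ?v x + (\<Sum>b\<in>Basis. 2 * (partial_deriv b (corner_cut m p) x * partial_deriv b ?v x)
      + partial_deriv b (partial_deriv b (corner_cut m p)) x * ?v x)"
      by (simp add: sum.distrib laplacian_def sum_distrib_left)
    finally show ?thesis unfolding r_def laplacian_cube_mode[OF L] by (simp add: w_def)
  qed
  \<comment> \<open>The constant is 10 = 2 * 2 + (2 + 4): the cross term occurs twice with bound 2,
    and the second derivative of the cut-off gives 2 from \<open>h1\<close> and 4 from
    \<open>h2\<close>. Each power of M is matched by a power of the squared distance to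
    \<open>p\<close>.\<close>
  have bound: "cmod (2 * (partial_deriv b (corner_cut m p) x * partial_deriv b ?v x)
      + partial_deriv b (partial_deriv b (corner_cut m p)) x * ?v x) \<le> 10 * ?\<alpha>\<^sup>2 * C"
    if b: "b \<in> Basis" for b m x
  proof -
    define M where "M = real (Suc m)"
    define s where "s = norm (x - p)"
    define y where "y = (x - p) \<bullet> b"
    define t where "t = M * s\<^sup>2"
    have M: "M \<ge> 0" and s: "s \<ge> 0" by (auto simp: M_def s_def)
    have y: "\<bar>y\<bar> \<le> s" unfolding y_def s_def by (rule Basis_le_norm[OF b])
    have y2: "y\<^sup>2 \<le> s\<^sup>2" using power_mono[OF y abs_ge_zero, of 2] by simp
    have rt: "M * \<rho> x = t" by (simp add: t_def \<rho>_def s_def)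
    have 1: "cmod (partial_deriv b (corner_cut m p) x * partial_deriv b ?v x) \<le> 2 * ?\<alpha>\<^sup>2 * C"
    proof -
      have "cmod (partial_deriv b (corner_cut m p) x * partial_deriv b ?v x)
          = (\<bar>h1 t\<bar> * M * (2 * \<bar>y\<bar>)) * cmod (partial_deriv b ?v x)"
        unfolding d1 norm_mult norm_of_real rt M_def[symmetric] y_def[symmetric] using M by (simp add: abs_mult)
      also have "\<dots> \<le> (\<bar>h1 t\<bar> * M * (2 * s)) * (?\<alpha>\<^sup>2 * s)"
        unfolding s_def using M norm_partial_deriv_cube_mode_le[OF L b dim, of p x] y
        by (intro mult_mono) (auto simp: s_def)
      also have "\<dots> = 2 * ?\<alpha>\<^sup>2 * \<bar>t * h1 t\<bar>"
        using M by (simp add: t_def abs_mult power2_eq_square)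
      also have "\<dots> \<le> 2 * ?\<alpha>\<^sup>2 * C" by (intro mult_left_mono C) auto
      finally show ?thesis .
    qed
    have 2: "cmod (partial_deriv b (partial_deriv b (corner_cut m p)) x * ?v x) \<le> 6 * ?\<alpha>\<^sup>2 * C"
    proof -
      have eq: "partial_deriv b (partial_deriv b (corner_cut m p)) x * ?v x
        = of_real ((2 * h1 t * M + h2 t * M * M * (2 * y) * (2 * y)) * cube_mode p L x)"
        unfolding d2[OF b] M_def[symmetric] rt y_def[symmetric] by simp
      have "cmod (partial_deriv b (partial_deriv b (corner_cut m p)) x * ?v x)
        = \<bar>2 * h1 t * M + h2 t * M * M * (2 * y) * (2 * y)\<bar> * \<bar>cube_mode p L x\<bar>"
        unfolding eq norm_of_real abs_mult ..
      also have "\<dots> \<le> (2 * \<bar>h1 t\<bar> * M + 4 * \<bar>h2 t\<bar> * M\<^sup>2 * s\<^sup>2) * (?\<alpha>\<^sup>2 * s\<^sup>2)"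
      proof (intro mult_mono)
        have "\<bar>2 * h1 t * M + h2 t * M * M * (2 * y) * (2 * y)\<bar> \<le> \<bar>2 * h1 t * M\<bar> + \<bar>h2 t * M * M * (2 * y) * (2 * y)\<bar>"
          by (rule abs_triangle_ineq)
        also have "\<dots> = 2 * \<bar>h1 t\<bar> * M + 4 * \<bar>h2 t\<bar> * M\<^sup>2 * y\<^sup>2"
          using M by (simp add: abs_mult power2_eq_square)
        also have "\<dots> \<le> 2 * \<bar>h1 t\<bar> * M + 4 * \<bar>h2 t\<bar> * M\<^sup>2 * s\<^sup>2"
          using y2 by (intro add_left_mono mult_left_mono) auto
        finally show "\<bar>2 * h1 t * M + h2 t * M * M * (2 * y) * (2 * y)\<bar> \<le> \<dots>" .
        show "\<bar>cube_mode p L x\<bar> \<le> ?\<alpha>\<^sup>2 * s\<^sup>2" unfolding s_def by (rule abs_cube_mode_le[OF L dim])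
      qed (use M in auto)
      also have "\<dots> = ?\<alpha>\<^sup>2 * (2 * \<bar>t * h1 t\<bar> + 4 * \<bar>t\<^sup>2 * h2 t\<bar>)"
      proof -
        have e: "\<bar>t * h1 t\<bar> = M * s\<^sup>2 * \<bar>h1 t\<bar>" "\<bar>t\<^sup>2 * h2 t\<bar> = M\<^sup>2 * (s\<^sup>2)\<^sup>2 * \<bar>h2 t\<bar>"
          using M by (simp_all add: t_def abs_mult power_mult_distrib)
        have "(2 * u * M + 4 * u' * M\<^sup>2 * S) * (A * S) = A * (2 * (M * S * u) + 4 * (M\<^sup>2 * S\<^sup>2 * u'))"
          for u u' A S :: real by (simp add: algebra_simps power2_eq_square)
        then show ?thesis unfolding e .
      qed
      also have "\<dots> \<le> ?\<alpha>\<^sup>2 * (2 * C + 4 * C)"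
        by (intro mult_left_mono add_mono C) auto
      finally show ?thesis by simp
    qed
    have "cmod (2 * (partial_deriv b (corner_cut m p) x * partial_deriv b ?v x)
      + partial_deriv b (partial_deriv b (corner_cut m p)) x * ?v x)
      \<le> 2 * cmod (partial_deriv b (corner_cut m p) x * partial_deriv b ?v x)
        + cmod (partial_deriv b (partial_deriv b (corner_cut m p)) x * ?v x)"
      by (rule order_trans[OF norm_triangle_ineq]) (simp add: norm_mult)
    with 1 2 show ?thesis by simp
  qed
  show thesis
  proof (rule that[of "real DIM('a) * (10 * ?\<alpha>\<^sup>2 * C)"])
    show "cmod (r m x) \<le> real DIM('a) * (10 * ?\<alpha>\<^sup>2 * C)" for m x
      unfolding r using sum_norm_le[OF bound] by simp
    show "\<forall>\<^sub>F m in sequentially. r m x = 0" if "x \<noteq> p" for x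
      using corner_eventually[OF that]
    proof eventually_elim
      case (elim m)
      then have h0: "h1 (real (Suc m) * \<rho> x) = 0" "h2 (real (Suc m) * \<rho> x) = 0"
        by (auto intro!: z simp: \<rho>_def)
      have "partial_deriv b (corner_cut m p) x = 0" for b unfolding d1 h0 by simp
      moreover have "partial_deriv b (partial_deriv b (corner_cut m p)) x = 0" if "b \<in> Basis" for b
        unfolding d2[OF that] h0 by simp
      ultimately show ?case unfolding r by (intro sum.neutral ballI) simp
    qed
  qed (use C in auto)
qed

lemma cube_not_null:
  assumes "L > 0" shows "\<not> (AE x in lebesgue. x \<notin> cube p L)"
proof
  assume "AE x in lebesgue. x \<notin> cube p L"
  then have "negligible (cube p L)"
    using AE_iff_null_sets[of "cube p L" lebesgue] by (simp add: negligible_iff_null_sets cube_def)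
  moreover have "p + (L / 2) *\<^sub>R One \<in> cube p L" using assms by (simp add: mem_cube)
  ultimately show False
    using open_not_negligible[of "cube p L"] by (auto simp: cube_def)
qed

text \<open>The order of quantifiers is the point: \<epsilon> depends on \<open>p\<close>,
  \<open>L\<close> and \<open>a\<close> only. Data and solution live in the cube, so their norms are
  the same in every admissible \<Omega>.\<close>

lemma quasimode:
  fixes p :: "'a::euclidean_space"
  assumes L: "L > 0" and dim: "DIM('a) \<ge> 2" and a: "a > 0"
  obtains \<epsilon> where "\<epsilon> > 0"
    "\<And>\<Omega> R. open \<Omega> \<Longrightarrow> cube p L \<subseteq> \<Omega> \<Longrightarrow> frontier (cube p L) \<inter> \<Omega> \<subseteq> ball p \<epsilon> \<Longrightarrow>
       (\<And>x. x \<in> cube p L \<Longrightarrow> norm x < R) \<Longrightarrow>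
       ereal a \<le> L2_opnorm \<Omega> (cutoff_resolvent \<Omega> (pi * sqrt (real DIM('a)) / L) R)"
proof -
  interpret cavity "cube p L" "cube_mode p L" by (rule cavity_cube[OF L])
  let ?Q = "cube p L" and ?\<kappa> = "pi * sqrt (real DIM('a)) / L"
  define w where "w m x = corner_cut m p x * of_real (cube_mode p L x)" for m x
  define f where "f m = ext_zero ?Q (\<lambda>x. - (laplacian (w m) x + of_real (?\<kappa>\<^sup>2) * w m x))" for m
  have sw: "smooth (w m)" for m
    unfolding w_def[abs_def] by (intro smooth_mult smooth_corner_cut smooth_cube_mode)
  obtain B where B: "B \<ge> 0" "\<And>m x. cmod (laplacian (w m) x + of_real (?\<kappa>\<^sup>2) * w m x) \<le> B"
    "\<And>x. x \<noteq> p \<Longrightarrow> \<forall>\<^sub>F m in sequentially. laplacian (w m) x + of_real (?\<kappa>\<^sup>2) * w m x = 0"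
    using corner_residual[OF L dim, of p] unfolding w_def[abs_def] by blast
  obtain \<rho> where \<rho>: "\<And>x. x \<in> ?Q \<Longrightarrow> norm x \<le> \<rho>" using Q_radius by blast
  have pQ: "p \<notin> ?Q" using nonempty_Basis by (auto simp: mem_cube)
  have fd: "dominated B \<rho> (f m)" for m
    unfolding f_def
  proof (rule dominated_ext_zero[OF _ _ B(1) \<rho>])
    have "smooth (\<lambda>x. (- 1) * (laplacian (w m) x + of_real (?\<kappa>\<^sup>2) * w m x))"
      by (intro smooth_mult smooth_add smooth_const smooth_laplacian sw)
    then show "(\<lambda>x. - (laplacian (w m) x + of_real (?\<kappa>\<^sup>2) * w m x)) \<in> borel_measurable borel"
      by (intro smooth_borel_measurable) simp
    show "cmod (- (laplacian (w m) x + complex_of_real (?\<kappa>\<^sup>2) * w m x)) \<le> B" for x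
      using B(2)[of m x] by (simp only: norm_minus_cancel)
  qed
  \<comment> \<open>The only exceptional point \<open>p\<close> lies outside the open cube, so the
    residual tends to zero everywhere; being uniformly bounded, it tends to zero in L2 as
    well.\<close>
  have f0: "(\<lambda>m. f m x) \<longlonglongrightarrow> 0" for x
  proof (cases "x \<in> ?Q")
    case True
    then have "x \<noteq> p" using pQ by auto
    show ?thesis
    proof (rule tendsto_eventually, rule eventually_mono[OF B(3)[OF \<open>x \<noteq> p\<close>]])
      fix m assume "laplacian (w m) x + of_real (?\<kappa>\<^sup>2) * w m x = 0"
      then show "f m x = 0" unfolding f_def ext_zero_def by (simp only: minus_zero if_cancel)
    qed
  qed (simp add: f_def ext_zero_def)
  obtain B' where B': "B' \<ge> 0" "\<And>x. x \<in> ?Q \<Longrightarrow> cmod (of_real (cube_mode p L x)) \<le> B'"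
    using bounded_on_Q[OF smooth_cube_mode] by blast
  have ud: "dominated B' \<rho> (ext_zero ?Q (w m))" for m
  proof (rule dominated_ext_zero[OF smooth_borel_measurable[OF sw] _ B'(1) \<rho>])
    show "cmod (w m x) \<le> B'" if "x \<in> ?Q" for x
    proof -
      have "cmod (w m x) \<le> 1 * B'"
        unfolding w_def norm_mult
        by (intro mult_mono B' that) (auto simp: corner_cut_def smooth_step_abs_le)
      then show ?thesis by simp
    qed
  qed
  have u0: "(\<lambda>m. ext_zero ?Q (w m) x) \<longlonglongrightarrow> ext_zero ?Q (\<lambda>x. of_real (cube_mode p L x)) x" for x
  proof (cases "x \<in> ?Q")
    case True
    then have "x \<noteq> p" using pQ by auto
    from corner_eventually[OF this] show ?thesis
      by (intro tendsto_eventually, elim eventually_mono)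
        (simp add: ext_zero_def w_def corner_cut_def smooth_step_eq_1)
  qed (simp add: ext_zero_def)
  have lf: "(\<lambda>m. L2_norm UNIV (f m)) \<longlonglongrightarrow> 0"
    using dominated_L2_norm_tendsto[OF fd f0, of UNIV] by (simp add: L2_norm_def)
  let ?c = "L2_norm UNIV (ext_zero ?Q (\<lambda>x. of_real (cube_mode p L x)))"
  have lu: "(\<lambda>m. L2_norm UNIV (ext_zero ?Q (w m))) \<longlonglongrightarrow> ?c"
    using dominated_L2_norm_tendsto[OF ud u0, of UNIV] by simp
  have c: "?c > 0"
  proof -
    let ?g = "\<lambda>x. (cmod (ext_zero ?Q (\<lambda>x. of_real (cube_mode p L x)) x))\<^sup>2"
    have "ext_zero ?Q (\<lambda>x. of_real (cube_mode p L x)) \<in> L2 UNIV"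
      by (rule dominated_L2[OF dominated_lim[OF ud u0]]) auto
    then have int: "integrable lebesgue ?g" by (simp add: L2_def lebesgue_on_UNIV_eq)
    have "(LINT x|lebesgue. ?g x) \<noteq> 0"
    proof
      assume "(LINT x|lebesgue. ?g x) = 0"
      then have "AE x in lebesgue. ?g x = 0"
        using integral_nonneg_eq_0_iff_AE[OF int] by simp
      then have "AE x in lebesgue. x \<notin> ?Q"
        by (rule eventually_mono) (use v_pos in \<open>force simp: ext_zero_def\<close>)
      with cube_not_null[OF L] show False by blast
    qed
    moreover have "(LINT x|lebesgue. ?g x) \<ge> 0" by (intro Bochner_Integration.integral_nonneg) simp
    ultimately have "(LINT x|lebesgue. ?g x) > 0" by linarith
    then show ?thesis by (simp only: L2_norm_def lebesgue_on_UNIV_eq real_sqrt_gt_0_iff)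
  qed
  \<comment> \<open>The solutions retain the positive norm of the full mode in the limit while the
    data disappear, so some \<open>m\<close> beats the prescribed factor \<open>a\<close>.\<close>
  have "(\<lambda>m. L2_norm UNIV (ext_zero ?Q (w m)) - a * L2_norm UNIV (f m)) \<longlonglongrightarrow> ?c - a * 0"
    by (intro tendsto_intros lu lf)
  then have "\<forall>\<^sub>F m in sequentially. 0 < L2_norm UNIV (ext_zero ?Q (w m)) - a * L2_norm UNIV (f m)"
    using c by (intro order_tendstoD(1)) auto
  then obtain m where m: "0 < L2_norm UNIV (ext_zero ?Q (w m)) - a * L2_norm UNIV (f m)"
    using eventually_happens'[OF sequentially_bot] by blast
  \<comment> \<open>The cut-off is zero within this radius of \<open>p\<close>, so the wall may be
    missing there.\<close>
  define \<epsilon> where "\<epsilon> = 1 / sqrt (real (Suc m))"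
  show thesis
  proof (rule that[of \<epsilon>])
    show "\<epsilon> > 0" by (simp add: \<epsilon>_def)
    fix \<Omega> R
    assume \<Omega>: "open \<Omega>" "?Q \<subseteq> \<Omega>" "frontier ?Q \<inter> \<Omega> \<subseteq> ball p \<epsilon>" and R: "\<And>x. x \<in> ?Q \<Longrightarrow> norm x < R"
    have L\<Omega>: "\<Omega> \<in> sets lebesgue" using \<Omega>(1) by auto
    have "corner_cut m p x = 0" if "x \<in> ball p \<epsilon>" for x
      using that by (intro corner_cut_eq_0) (simp add: \<epsilon>_def dist_norm norm_minus_commute)
    from scattering_solution_ext_zero[OF smooth_corner_cut \<Omega>(1,2) open_ball this \<Omega>(3), of ?\<kappa>]
    have sol: "scattering_solution \<Omega> ?\<kappa> (f m) (ext_zero ?Q (w m))"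
      unfolding f_def w_def[abs_def] by simp
    have nf: "L2_norm \<Omega> (f m) = L2_norm UNIV (f m)"
      using \<Omega>(2) by (intro L2_norm_UNIV dominated_measurable[OF fd] L\<Omega>) (auto simp: f_def ext_zero_def)
    have nu: "L2_norm \<Omega> (ext_zero ?Q (w m)) = L2_norm UNIV (ext_zero ?Q (w m))"
      using \<Omega>(2) by (intro L2_norm_UNIV dominated_measurable[OF ud] L\<Omega>) (auto simp: ext_zero_def)
    show "ereal a \<le> L2_opnorm \<Omega> (cutoff_resolvent \<Omega> ?\<kappa> R)"
    proof (rule L2_opnorm_cutoff_resolvent_ge[OF sol, where Q = ?Q])
      show "f m \<in> L2_comp \<Omega>"
        unfolding L2_comp_def using dominated_L2[OF fd L\<Omega>] dominated_zero[OF fd]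
        by (auto intro!: exI[of _ \<rho>])
      have "a * L2_norm UNIV (f m) \<ge> 0" using a by (simp add: L2_norm_def)
      then show "L2_norm \<Omega> (ext_zero ?Q (w m)) > 0" unfolding nu using m by linarith
      show "a * L2_norm \<Omega> (f m) \<le> L2_norm \<Omega> (ext_zero ?Q (w m))" unfolding nu nf using m by linarith
    qed (use \<Omega>(2) R in \<open>auto simp: f_def ext_zero_def\<close>)
  qed
qed

section \<open>Packing the cubes\<close>

text \<open>
  Consecutive cubes are grouped into rows: a row starting with side \<open>l\<close> has a cross-section of
  fixed width, divided into about \<open>(L 0 / l) ^ (n - 1)\<close> cells. The next side is either at most
  \<open>l / 2\<close> or controlled by the volume of the cubes in the row, so the heights are summable.
\<close>

lemma row_grouping:
  fixes L :: "nat \<Rightarrow> real"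
  assumes pos: "\<And>j. L j > 0" and dec: "decseq L" and sum: "summable (\<lambda>j. L j ^ Suc d)"
  obtains J M H where "J 0 = (0::nat)" "\<And>r. J (Suc r) = J r + M r ^ d" "\<And>r. M r \<ge> (1::nat)"
    "\<And>r. real (M r) * L (J r) \<le> L 0" "\<And>R. (\<Sum>r<R. L (J r)) \<le> H"
proof -
  \<comment> \<open>The number of cells of width \<open>L j\<close> along an edge of length
    \<open>L 0\<close>; a row with this many per edge holds the \<open>d\<close>-th power of
    it.\<close>
  define m where "m j = nat \<lfloor>L 0 / L j\<rfloor>" for j
  define J where "J = rec_nat 0 (\<lambda>_ j. j + m j ^ d)"
  have J: "J 0 = 0" "J (Suc r) = J r + m (J r) ^ d" for r by (simp_all add: J_def)
  have ge1: "1 \<le> L 0 / L j" for j using pos[of j] decseqD[OF dec, of 0 j] by simp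
  have m1: "1 \<le> m j" for j using ge1[of j] by (simp add: m_def le_nat_iff)
  have m2: "real (m j) \<le> L 0 / L j" for j using ge1[of j] by (simp add: m_def)
  \<comment> \<open>Rounding down a number that is at least 1 loses at most a factor 2.\<close>
  have m3: "L 0 / (2 * L j) \<le> real (m j)" for j
  proof -
    have "L 0 / L j < real (m j) + 1" using ge1[of j] by (simp add: m_def)
    moreover have "1 \<le> real (m j)" using m1[of j] by simp
    ultimately have "L 0 / L j \<le> 2 * real (m j)" by linarith
    then show ?thesis using pos[of j] by (simp add: field_simps)
  qed
  define S where "S r = (\<Sum>j\<in>{J r..<J (Suc r)}. L j ^ Suc d)" for r
  have Jle: "J r \<le> J (Suc r)" for r by (simp add: J)
  have Ssum: "(\<Sum>r<R. S r) = (\<Sum>j<J R. L j ^ Suc d)" for R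
  proof (induction R)
    case (Suc R)
    have "{..<J (Suc R)} = {..<J R} \<union> {J R..<J (Suc R)}" using Jle[of R] by auto
    then show ?case using Suc by (simp add: S_def sum.union_disjoint[of "{..<J R}"] ivl_disj_int)
  qed (simp add: J)
  define V where "V = (\<Sum>j. L j ^ Suc d)"
  have SV: "(\<Sum>r<R. S r) \<le> V" for R
    unfolding Ssum V_def using pos by (intro sum_le_suminf sum) (auto intro: less_imp_le)
  define K where "K = inverse ((L 0 / 4) ^ d)"
  have K: "K > 0" using pos[of 0] by (simp add: K_def)
  have S0: "S r \<ge> 0" for r unfolding S_def using pos by (intro sum_nonneg) (auto intro: less_imp_le)
  \<comment> \<open>Let l be the next side and suppose it exceeds half of \<open>L (J r)\<close>.
    Every cube of the row has side at least l, and by \<open>m3\<close> there are at least (L 0 / (4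
    l))^d of them. Their volume is thus at least (L 0 / 4)^d l, whence the constant
    \<open>K\<close>.\<close>
  have step: "L (J (Suc r)) \<le> L (J r) / 2 + K * S r" for r
  proof (cases "L (J (Suc r)) \<le> L (J r) / 2")
    case True
    then show ?thesis using K S0[of r] by (simp add: add_increasing2)
  next
    case False
    let ?l = "L (J (Suc r))"
    have l: "?l > 0" by (rule pos)
    have "L 0 / 4 / ?l \<le> L 0 / (2 * L (J r))"
      using False l pos[of 0] pos[of "J r"] by (simp add: divide_simps)
    also have "\<dots> \<le> real (m (J r))" by (rule m3)
    finally have "(L 0 / 4 / ?l) ^ d \<le> real (m (J r)) ^ d"
      using l pos[of 0] by (intro power_mono) auto
    then have "(L 0 / 4 / ?l) ^ d * ?l ^ Suc d \<le> real (m (J r)) ^ d * ?l ^ Suc d"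
      using l by (intro mult_right_mono) auto
    also have "\<dots> = (\<Sum>j\<in>{J r..<J (Suc r)}. ?l ^ Suc d)" by (simp add: J)
    also have "\<dots> \<le> S r"
      unfolding S_def using l decseqD[OF dec] by (intro sum_mono power_mono) auto
    also have "(L 0 / 4 / ?l) ^ d * ?l ^ Suc d = (L 0 / 4) ^ d * ?l"
      using l by (simp add: power_divide)
    finally have "(L 0 / 4) ^ d * ?l \<le> S r" .
    then have "?l \<le> K * S r" unfolding K_def using pos[of 0] by (simp add: field_simps)
    then show ?thesis using pos[of "J r"] by simp
  qed
  have "(\<Sum>r<R. L (J r)) \<le> 2 * (L 0 + K * V)" for R
  proof (cases R)
    case 0
    have "V \<ge> 0" using SV[of 0] by simp
    then show ?thesis using 0 K pos[of 0] by (simp add: add_nonneg_nonneg less_imp_le)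
  next
    case (Suc R')
    have "(\<Sum>r<Suc R'. L (J r)) = L 0 + (\<Sum>r<R'. L (J (Suc r)))"
      by (subst sum.lessThan_Suc_shift) (simp add: J(1))
    also have "\<dots> \<le> L 0 + (\<Sum>r<R'. L (J r) / 2 + K * S r)"
      by (intro add_left_mono sum_mono step)
    also have "\<dots> = L 0 + (\<Sum>r<R'. L (J r)) / 2 + K * (\<Sum>r<R'. S r)"
      by (simp add: sum.distrib sum_divide_distrib sum_distrib_left)
    also have "\<dots> \<le> L 0 + (\<Sum>r<Suc R'. L (J r)) / 2 + K * V"
      using K pos[of "J R'"] SV[of R'] by (intro add_mono mult_left_mono) auto
    \<comment> \<open>The sum also stands on the right with factor 1/2 and is absorbed, which
      accounts for the factor 2 in the bound.\<close>
    finally show ?thesis unfolding Suc by argo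
  qed
  moreover have "real (m (J r)) * L (J r) \<le> L 0" for r
    using m2[of "J r"] pos[of "J r"] by (simp add: field_simps)
  ultimately show thesis using that[of J "\<lambda>r. m (J r)"] J m1 by blast
qed

text \<open>Cube j has its lower corner at the centre \<open>p j\<close> of a cell of width
  \<open>2 * g j\<close> and fits into the upper half in every direction. In direction
  \<open>e\<close> the lower halves of the rows stay empty and become the corridors to the exterior.
  Half-open cells are disjoint even when they are adjacent, and still contain the closed
  cubes.\<close>

lemma cube_packing:
  fixes e :: "'a::euclidean_space" and L :: "nat \<Rightarrow> real"
  assumes e: "e \<in> Basis" and pos: "\<And>j. L j > 0" and dec: "decseq L"
    and sum: "summable (\<lambda>j. L j ^ DIM('a))"
  obtains p :: "nat \<Rightarrow> 'a" and g :: "nat \<Rightarrow> real" and H :: real where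
    "\<And>j. 0 < g j" "\<And>j. L j \<le> g j"
    "\<And>i j y. i \<noteq> j \<Longrightarrow> \<forall>c\<in>Basis. p i \<bullet> c - g i < y \<bullet> c \<and> y \<bullet> c \<le> p i \<bullet> c + g i \<Longrightarrow>
      \<forall>c\<in>Basis. p j \<bullet> c - g j < y \<bullet> c \<and> y \<bullet> c \<le> p j \<bullet> c + g j \<Longrightarrow> False"
    "\<And>i j t. p j \<bullet> e - g j < t \<Longrightarrow> t < p j \<bullet> e \<Longrightarrow> p i \<bullet> e \<le> t \<Longrightarrow> t \<le> p i \<bullet> e + g i \<Longrightarrow> False"
    "\<And>j. 0 \<le> p j \<bullet> e - g j" "\<And>j c. c \<in> Basis \<Longrightarrow> \<bar>p j \<bullet> c\<bar> \<le> H" "\<And>j. g j \<le> H"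
proof -
  define d where "d = DIM('a) - 1"
  have d: "DIM('a) = Suc d" using DIM_positive[where 'a='a] by (simp add: d_def)
  obtain J M H where J: "J 0 = (0::nat)" "\<And>r. J (Suc r) = J r + M r ^ d" and M: "\<And>r. M r \<ge> (1::nat)"
    "\<And>r. real (M r) * L (J r) \<le> L 0" and H: "\<And>R. (\<Sum>r<R. L (J r)) \<le> H"
    using row_grouping[OF pos dec sum[unfolded d]] by blast
  define l where "l r = L (J r)" for r
  have l: "l r > 0" for r by (simp add: l_def pos)
  have Jm: "strict_mono J"
    by (rule strict_monoI_Suc) (use M(1) J(2) in \<open>simp add: less_le_trans[OF zero_less_one]\<close>)
  have "\<exists>r. J r \<le> j \<and> j < J (Suc r)" for j
  proof (induction j)
    case 0
    then show ?case using J(1) strict_monoD[OF Jm, of 0 1] by (intro exI[of _ 0]) auto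
  next
    case (Suc j)
    then obtain r where r: "J r \<le> j" "j < J (Suc r)" by blast
    show ?case
    proof (cases "Suc j < J (Suc r)")
      case True
      then show ?thesis using r by (intro exI[of _ r]) auto
    next
      case False
      then show ?thesis using r strict_monoD[OF Jm, of "Suc r" "Suc (Suc r)"] by (intro exI[of _ "Suc r"]) auto
    qed
  qed
  then obtain row where row: "\<And>j. J (row j) \<le> j" "\<And>j. j < J (Suc (row j))" by metis
  \<comment> \<open>The cells of a row are labelled by a position along each axis other than
    \<open>e\<close>; their number equals the number of cubes in the row.\<close>
  have "\<exists>G. inj_on G {..<M r ^ d} \<and> G ` {..<M r ^ d} \<subseteq> PiE (Basis - {e}) (\<lambda>_. {..<M r})" for r
  proof -
    have "card (PiE (Basis - {e}) (\<lambda>_. {..<M r})) = M r ^ d"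
      using e by (simp add: card_PiE d_def)
    moreover have "finite (PiE (Basis - {e}) (\<lambda>_. {..<M r}))" by (intro finite_PiE) auto
    ultimately obtain G where "bij_betw G {..<M r ^ d} (PiE (Basis - {e}) (\<lambda>_. {..<M r}))"
      using ex_bij_betw_nat_finite by (metis atLeast0LessThan)
    then show ?thesis by (auto simp: bij_betw_def intro!: exI[of _ G])
  qed
  then obtain G where G: "\<And>r. inj_on (G r) {..<M r ^ d}"
    "\<And>r. G r ` {..<M r ^ d} \<subseteq> PiE (Basis - {e}) (\<lambda>_. {..<M r})" by metis
  define q where "q j = G (row j) (j - J (row j))" for j
  have idx: "j - J (row j) \<in> {..<M (row j) ^ d}" for j
    using row[of j] J(2)[of "row j"] by auto
  have qE: "q j \<in> PiE (Basis - {e}) (\<lambda>_. {..<M (row j)})" for j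
    unfolding q_def using G(2)[of "row j"] idx[of j] by blast
  have q_inj: "\<exists>c\<in>Basis - {e}. q i c \<noteq> q j c" if "row i = row j" "i \<noteq> j" for i j
  proof (rule ccontr)
    assume "\<not> ?thesis"
    then have "q i = q j" using PiE_ext[OF qE[of i, unfolded that(1)] qE[of j]] by blast
    then have "i - J (row j) = j - J (row j)"
      unfolding q_def that(1) using inj_onD[OF G(1)] idx[of i] idx[of j] that(1) by metis
    then show False using row(1)[of i] row(1)[of j] that by simp
  qed
  \<comment> \<open>The height at which row \<open>r\<close> begins: each earlier row takes a
    corridor and a layer of cubes, both of thickness \<open>l i\<close>.\<close>
  define h where "h r = (\<Sum>i<r. 2 * l i)" for r
  have hSuc: "h (Suc r) = h r + 2 * l r" for r by (simp add: h_def)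
  have "incseq h" by (rule incseq_SucI) (use l in \<open>simp add: hSuc less_imp_le\<close>)
  then have hmono: "h (Suc r) \<le> h s" if "r < s" for r s
    using incseqD[of h "Suc r" s] that by simp
  have hH: "h r \<le> 2 * H" for r
    using H[of r] by (simp add: h_def l_def flip: sum_distrib_left)
  define p where "p j = (\<Sum>c\<in>Basis. (if c = e then h (row j) + l (row j) else 2 * l (row j) * real (q j c)) *\<^sub>R c)" for j
  have pe: "p j \<bullet> e = h (row j) + l (row j)" for j
    using e by (simp add: p_def)
  have pc: "p j \<bullet> c = 2 * l (row j) * real (q j c)" if "c \<in> Basis - {e}" for j c
    using that by (simp add: p_def)
  show thesis
  \<comment> \<open>Heights are bounded by the summed thicknesses 2 H plus one side, cross-sections
    by 2 L 0, since \<open>M r\<close> cells of width \<open>2 * l r\<close> span at most that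
    length.\<close>
  proof (rule that[of "\<lambda>j. l (row j)" p "2 * H + 2 * L 0"])
    show "0 < l (row j)" for j by (rule l)
    show "L j \<le> l (row j)" for j unfolding l_def by (rule decseqD[OF dec row(1)])
    show "0 \<le> p j \<bullet> e - l (row j)" for j using l by (simp add: pe h_def sum_nonneg less_imp_le)
    show "False" if "p j \<bullet> e - l (row j) < t" "t < p j \<bullet> e" "p i \<bullet> e \<le> t" "t \<le> p i \<bullet> e + l (row i)" for i j t
      using that hmono[of "row i" "row j"] hmono[of "row j" "row i"] l[of "row i"] l[of "row j"]
      unfolding pe hSuc by (cases "row i" "row j" rule: linorder_cases) auto
    show False if ij: "i \<noteq> j"
      and i: "\<forall>c\<in>Basis. p i \<bullet> c - l (row i) < y \<bullet> c \<and> y \<bullet> c \<le> p i \<bullet> c + l (row i)"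
      and j: "\<forall>c\<in>Basis. p j \<bullet> c - l (row j) < y \<bullet> c \<and> y \<bullet> c \<le> p j \<bullet> c + l (row j)" for i j y
    proof (cases "row i = row j")
      case False
      then show False
        using bspec[OF i e] bspec[OF j e] hmono[of "row i" "row j"] hmono[of "row j" "row i"]
        unfolding pe hSuc by (cases "row i" "row j" rule: linorder_cases) auto
    next
      case True
      obtain c where c: "c \<in> Basis - {e}" "q i c \<noteq> q j c" using q_inj[OF True ij] by blast
      have apart: "2 * l (row j) * real a + 2 * l (row j) \<le> 2 * l (row j) * real b" if "a < b" for a b :: nat
      proof -
        have "2 * l (row j) * (real a + 1) \<le> 2 * l (row j) * real b"
          using that l[of "row j"] by (intro mult_left_mono) auto
        then show ?thesis by (simp add: algebra_simps)
      qed
      have cB: "c \<in> Basis" using c by auto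
      show False
        using c(2) bspec[OF i cB] bspec[OF j cB] apart[of "q i c" "q j c"] apart[of "q j c" "q i c"]
        unfolding pc[OF c(1)] True by (cases "q i c" "q j c" rule: linorder_cases) auto
    qed
    have H0: "H \<ge> 0" using H[of 0] by simp
    have lL: "l r \<le> L 0" for r unfolding l_def by (rule decseqD[OF dec le0])
    show "l (row j) \<le> 2 * H + 2 * L 0" for j using lL[of "row j"] H0 pos[of 0] by simp
    show "\<bar>p j \<bullet> c\<bar> \<le> 2 * H + 2 * L 0" if "c \<in> Basis" for j c
    proof (cases "c = e")
      case True
      have "h (row j) \<ge> 0" using l by (simp add: h_def sum_nonneg less_imp_le)
      then show ?thesis using True hH[of "row j"] lL[of "row j"] l[of "row j"] pos[of 0] by (simp add: pe)
    next
      case False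
      then have c: "c \<in> Basis - {e}" using that by auto
      then have "q j c < M (row j)" using qE[of j] by (auto simp: PiE_iff)
      then have "l (row j) * real (q j c) \<le> l (row j) * real (M (row j))"
        using l[of "row j"] by (intro mult_left_mono) auto
      also have "\<dots> \<le> L 0" using M(2)[of "row j"] by (simp add: l_def mult.commute)
      finally show ?thesis using H0 l[of "row j"] unfolding pc[OF c] by (simp add: abs_mult)
    qed
  qed
qed

section \<open>The obstacle\<close>

lemma ball_inner_bounds:
  assumes "x \<in> ball p \<epsilon>" "\<epsilon> \<le> g" "c \<in> Basis"
  shows "p \<bullet> c - g < x \<bullet> c \<and> x \<bullet> c \<le> p \<bullet> c + g"
proof -
  have "\<bar>(x - p) \<bullet> c\<bar> \<le> norm (x - p)" by (rule Basis_le_norm[OF assms(3)])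
  moreover have "norm (x - p) < g" using assms(1,2) by (simp add: dist_norm norm_minus_commute)
  ultimately show ?thesis by (simp add: inner_diff_left abs_le_iff)
qed

text \<open>
  Cavities are joined to the exterior in a solid ball: the corner of each cavity opens, through
  a small ball, into a slab that is free of cavities and leaves the solid ball.
\<close>

lemma trapping_obstacle:
  fixes k a :: "nat \<Rightarrow> real"
  assumes dim: "DIM('a::euclidean_space) \<ge> 2"
    and k: "\<And>j. 0 < k j" "incseq k" and a: "\<And>j. 0 < a j"
    and sum: "summable (\<lambda>j. inverse (k j ^ DIM('a)))"
  obtains \<Gamma> :: "'a::euclidean_space set" where "compact \<Gamma>" "\<Gamma> \<noteq> {}" "connected (- \<Gamma>)"
    "\<And>R j. (SUP x\<in>\<Gamma>. norm x) < R \<Longrightarrow>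
       ereal (a j) \<le> L2_opnorm (- \<Gamma>) (cutoff_resolvent (- \<Gamma>) (k j) R)"
proof -
  obtain e :: 'a where e: "e \<in> Basis" using nonempty_Basis by blast
  have "(Basis :: 'a set) \<noteq> {e}" by (rule Basis_neq_singleton[OF dim])
  then obtain e' where e': "e' \<in> Basis" "e' \<noteq> e" using e by auto
  define A where "A = pi * sqrt (real DIM('a))"
  have A: "A > 0" by (simp add: A_def)
  \<comment> \<open>The side for which the lowest Dirichlet eigenvalue of the cube is the square of
    \<open>k j\<close>; summability of the volumes is then the hypothesis on
    \<open>k\<close>.\<close>
  define L where "L j = A / k j" for j
  have L: "L j > 0" for j using A k(1) by (simp add: L_def)
  have kL: "pi * sqrt (real DIM('a)) / L j = k j" for j
    using A k(1)[of j] by (simp add: L_def flip: A_def)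
  have dL: "decseq L"
    unfolding L_def using A k(1) incseqD[OF k(2)] by (intro decseq_SucI divide_left_mono) auto
  have sL: "summable (\<lambda>j. L j ^ DIM('a))"
  proof -
    have "L j ^ DIM('a) = A ^ DIM('a) * inverse (k j ^ DIM('a))" for j
      by (simp add: L_def power_divide flip: divide_inverse)
    then show ?thesis using summable_mult[OF sum, of "A ^ DIM('a)"] by (simp only:)
  qed
  obtain p :: "nat \<Rightarrow> 'a" and g H where g: "\<And>j. 0 < g j" "\<And>j. L j \<le> g j"
    and cells: "\<And>i j y. i \<noteq> j \<Longrightarrow> \<forall>c\<in>Basis. p i \<bullet> c - g i < y \<bullet> c \<and> y \<bullet> c \<le> p i \<bullet> c + g i \<Longrightarrow>
      \<forall>c\<in>Basis. p j \<bullet> c - g j < y \<bullet> c \<and> y \<bullet> c \<le> p j \<bullet> c + g j \<Longrightarrow> False"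
    and slabs: "\<And>i j t. p j \<bullet> e - g j < t \<Longrightarrow> t < p j \<bullet> e \<Longrightarrow> p i \<bullet> e \<le> t \<Longrightarrow> t \<le> p i \<bullet> e + g i \<Longrightarrow> False"
    and pg: "\<And>j. 0 \<le> p j \<bullet> e - g j" and pH: "\<And>j c. c \<in> Basis \<Longrightarrow> \<bar>p j \<bullet> c\<bar> \<le> H" and gH: "\<And>j. g j \<le> H"
    by (rule cube_packing[OF e L dL sL]) (rule that)
  have "\<exists>\<epsilon>. \<epsilon> > 0 \<and> (\<forall>\<Omega> R. open \<Omega> \<longrightarrow> cube (p j) (L j) \<subseteq> \<Omega> \<longrightarrow> frontier (cube (p j) (L j)) \<inter> \<Omega> \<subseteq> ball (p j) \<epsilon> \<longrightarrow>
       (\<forall>x\<in>cube (p j) (L j). norm x < R) \<longrightarrow> ereal (a j) \<le> L2_opnorm \<Omega> (cutoff_resolvent \<Omega> (k j) R))" for j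
    using quasimode[OF L dim a, of "p j" j j] unfolding kL by metis
  then obtain \<epsilon>0 where \<epsilon>0: "\<And>j. \<epsilon>0 j > 0"
    "\<And>j \<Omega> R. open \<Omega> \<Longrightarrow> cube (p j) (L j) \<subseteq> \<Omega> \<Longrightarrow> frontier (cube (p j) (L j)) \<inter> \<Omega> \<subseteq> ball (p j) (\<epsilon>0 j) \<Longrightarrow>
       (\<And>x. x \<in> cube (p j) (L j) \<Longrightarrow> norm x < R) \<Longrightarrow> ereal (a j) \<le> L2_opnorm \<Omega> (cutoff_resolvent \<Omega> (k j) R)"
    by metis
  \<comment> \<open>The bound by \<open>g j\<close> keeps each opening inside its own cell, so that
    it breaks no wall of another cube.\<close>
  define \<epsilon> where "\<epsilon> j = min (\<epsilon>0 j) (g j)" for j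
  have \<epsilon>: "0 < \<epsilon> j" "\<epsilon> j \<le> \<epsilon>0 j" "\<epsilon> j \<le> g j" for j using \<epsilon>0(1) g(1) by (auto simp: \<epsilon>_def)
  \<comment> \<open>Coordinates in the cells are at most 2 H in modulus, and the l1 norm dominates
    the Euclidean one; the summand 1 makes the inclusion in the ball strict.\<close>
  define \<rho> where "\<rho> = real DIM('a) * (2 * H) + 1"
  have H0: "H > 0" using less_le_trans[OF g(1) gH] .
  have \<rho>: "\<rho> > 0" using H0 by (simp add: \<rho>_def add_pos_pos)
  define cell where "cell j = {y. \<forall>c\<in>Basis. p j \<bullet> c - g j < y \<bullet> c \<and> y \<bullet> c \<le> p j \<bullet> c + g j}" for j
  have cell_norm: "norm x < \<rho>" if "x \<in> cell j" for x j
  proof -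
    have "norm x \<le> (\<Sum>c\<in>Basis. \<bar>x \<bullet> c\<bar>)" by (rule norm_le_l1)
    also have "\<dots> \<le> (\<Sum>c\<in>(Basis::'a set). 2 * H)"
    proof (rule sum_mono)
      fix c :: 'a assume c: "c \<in> Basis"
      then have "p j \<bullet> c - g j < x \<bullet> c" "x \<bullet> c \<le> p j \<bullet> c + g j" using that by (auto simp: cell_def)
      then show "\<bar>x \<bullet> c\<bar> \<le> 2 * H" using pH[OF c, of j] gH[of j] by linarith
    qed
    finally show ?thesis by (simp add: \<rho>_def)
  qed
  have cell_e: "x \<bullet> e > 0" if "x \<in> cell j" for x j
    using that pg[of j] e by (fastforce simp: cell_def)
  have disj: "i = j" if "x \<in> cell i" "x \<in> cell j" for i j x
    using that cells[of i j x] by (auto simp: cell_def)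
  have ball_cell: "ball (p j) (\<epsilon> j) \<subseteq> cell j" for j
    using ball_inner_bounds[OF _ \<epsilon>(3)] by (auto simp: cell_def simp del: mem_ball)
  have cbox_cell: "cbox (p j) (p j + L j *\<^sub>R One) \<subseteq> cell j" for j
  proof
    fix x assume "x \<in> cbox (p j) (p j + L j *\<^sub>R One)"
    then have "p j \<bullet> c \<le> x \<bullet> c \<and> x \<bullet> c \<le> p j \<bullet> c + L j" if "c \<in> Basis" for c
      using that by (auto simp: mem_box inner_left_distrib)
    then show "x \<in> cell j" using g[of j] by (fastforce simp: cell_def)
  qed
  have cube_cell: "cube (p j) (L j) \<subseteq> cell j" for j
    unfolding cube_def using box_subset_cbox cbox_cell[of j] by (rule subset_trans)
  define S where "S j = {x. p j \<bullet> e - g j < x \<bullet> e \<and> x \<bullet> e < p j \<bullet> e}" for j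
  define E where "E = - cball (0::'a) \<rho>"
  \<comment> \<open>The route from cavity j to infinity: exterior of the solid ball, corridor,
    opening, cube. Consecutive pieces overlap, and all routes share the exterior, so their union is
    connected.\<close>
  define U where "U j = E \<union> S j \<union> ball (p j) (\<epsilon> j) \<union> cube (p j) (L j)" for j
  define \<Omega> where "\<Omega> = (\<Union>j. U j)"
  have oS: "open (S j)" for j
    unfolding S_def by (auto intro!: open_Collect_conj open_Collect_less continuous_intros)
  have cS: "convex (S j)" for j
  proof -
    have "S j = {x. e \<bullet> x > p j \<bullet> e - g j} \<inter> {x. e \<bullet> x < p j \<bullet> e}"
      by (auto simp: S_def inner_commute)
    then show ?thesis by (simp only: convex_Int convex_halfspace_lt convex_halfspace_gt)
  qed
  have oU: "open (U j)" for j
    unfolding U_def E_def cube_def by (intro open_Un oS) (auto simp: open_Compl)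
  have o\<Omega>: "open \<Omega>" unfolding \<Omega>_def using oU by blast
  \<comment> \<open>A slab is unbounded in direction \<open>e'\<close>, so it leaves the solid
    ball.\<close>
  have ES: "E \<inter> S j \<noteq> {}" for j
  proof -
    define x where "x = (p j \<bullet> e - g j / 2) *\<^sub>R e + (\<rho> + 1) *\<^sub>R e'"
    have "x \<bullet> e = p j \<bullet> e - g j / 2" "x \<bullet> e' = \<rho> + 1"
      using e e' by (auto simp: x_def inner_left_distrib inner_Basis)
    moreover have "\<bar>x \<bullet> e'\<bar> \<le> norm x" by (rule Basis_le_norm[OF e'(1)])
    ultimately have "x \<in> E \<inter> S j" using g(1)[of j] \<rho> by (auto simp: E_def S_def)
    then show ?thesis by blast
  qed
  have SB: "S j \<inter> ball (p j) (\<epsilon> j) \<noteq> {}" for j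
  proof -
    have "p j - (\<epsilon> j / 2) *\<^sub>R e \<in> S j \<inter> ball (p j) (\<epsilon> j)"
      using e \<epsilon>[of j] by (auto simp: S_def inner_diff_left dist_norm)
    then show ?thesis by blast
  qed
  have BQ: "ball (p j) (\<epsilon> j) \<inter> cube (p j) (L j) \<noteq> {}" for j
  proof -
    have ne: "cube (p j) (L j) \<noteq> {}"
      using L[of j] by (auto simp: cube_def box_ne_empty inner_left_distrib)
    have "p j \<in> cbox (p j) (p j + L j *\<^sub>R One)"
      using L[of j] by (auto simp: mem_box inner_left_distrib less_imp_le)
    then have "p j \<in> ball (p j) (\<epsilon> j) \<inter> closure (cube (p j) (L j))"
      using \<epsilon>(1)[of j] ne by (auto simp: cube_def closure_box)
    then show ?thesis using open_Int_closure_eq_empty[OF open_ball] by blast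
  qed
  have cU: "connected (U j)" for j
    unfolding U_def
  proof (intro connected_Un)
    show "connected E" unfolding E_def by (rule connected_complement_bounded_convex) (use dim in auto)
    show "connected (S j)" by (rule convex_connected[OF cS])
    show "connected (ball (p j) (\<epsilon> j))" "connected (cube (p j) (L j))"
      by (auto intro: convex_connected simp: cube_def)
    show "E \<inter> S j \<noteq> {}" by (rule ES)
    show "(E \<union> S j) \<inter> ball (p j) (\<epsilon> j) \<noteq> {}" using SB[of j] by blast
    show "(E \<union> S j \<union> ball (p j) (\<epsilon> j)) \<inter> cube (p j) (L j) \<noteq> {}" using BQ[of j] by blast
  qed
  have "\<Inter>(range U) \<noteq> {}" using ES[of 0] by (auto simp: U_def)
  then have c\<Omega>: "connected \<Omega>" unfolding \<Omega>_def using cU by (intro connected_Union) auto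
  \<comment> \<open>A wall point lies in cell j. That excludes the exterior and, by disjointness of
    cells, the other cubes; its height excludes every corridor. Only an opening remains, and its
    cell has to be cell j.\<close>
  have fr: "frontier (cube (p j) (L j)) \<inter> \<Omega> \<subseteq> ball (p j) (\<epsilon>0 j)" for j
  proof
    fix x assume x: "x \<in> frontier (cube (p j) (L j)) \<inter> \<Omega>"
    then have xb: "x \<in> cbox (p j) (p j + L j *\<^sub>R One)" and xn: "x \<notin> cube (p j) (L j)"
      by (auto simp: cube_def frontier_box split: if_splits)
    have xc: "x \<in> cell j" using xb cbox_cell by blast
    obtain i where i: "x \<in> U i" using x by (auto simp: \<Omega>_def)
    have "x \<notin> E" using cell_norm[OF xc] by (simp add: E_def)
    moreover have "x \<notin> S i"
    proof
      assume "x \<in> S i"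
      moreover have "p j \<bullet> e \<le> x \<bullet> e" "x \<bullet> e \<le> p j \<bullet> e + g j"
        using xb e xc by (auto simp: mem_box cell_def)
      ultimately show False using slabs[of i "x \<bullet> e" j] by (simp add: S_def)
    qed
    moreover have "x \<notin> cube (p i) (L i)"
      using disj[OF xc, of i] cube_cell[of i] xn by blast
    ultimately have xi: "x \<in> ball (p i) (\<epsilon> i)" using i unfolding U_def by blast
    then have "i = j" using disj[OF xc, of i] ball_cell[of i] by blast
    then show "x \<in> ball (p j) (\<epsilon>0 j)" using xi \<epsilon>(2)[of j] by auto
  qed
  \<comment> \<open>A point of the obstacle on the bounding sphere: its \<open>e\<close>-coordinate
    is negative, below all cells and corridors. It makes the obstacle nonempty and forces \<rho> <
    R, so that every cube lies in the ball of radius \<open>R\<close>.\<close>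
  define z where "z = (- \<rho>) *\<^sub>R e"
  have z: "z \<in> - \<Omega>"
  proof -
    have ze: "z \<bullet> e = - \<rho>" using e by (simp add: z_def)
    have "z \<notin> E" using e \<rho> by (simp add: E_def z_def)
    moreover have "z \<notin> S j" for j using pg[of j] ze \<rho> by (auto simp: S_def)
    moreover have "z \<notin> cell j" for j using cell_e[of z j] ze \<rho> by auto
    ultimately show ?thesis using ball_cell cube_cell unfolding \<Omega>_def U_def by blast
  qed
  have bd: "- \<Omega> \<subseteq> cball 0 \<rho>" by (auto simp: \<Omega>_def U_def E_def)
  show thesis
  proof (rule that[of "- \<Omega>"])
    show "compact (- \<Omega>)"
      using o\<Omega> bounded_subset[OF bounded_cball bd] by (simp add: compact_eq_bounded_closed closed_Compl)
    show "- \<Omega> \<noteq> {}" using z by blast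
    show "connected (- (- \<Omega>))" using c\<Omega> by simp
    fix R j assume R: "(SUP x\<in>- \<Omega>. norm x) < R"
    have "norm z \<le> (SUP x\<in>- \<Omega>. norm x)"
      using bd by (intro cSUP_upper z bdd_aboveI2[of _ _ \<rho>]) auto
    then have "\<rho> < R" using R \<rho> e by (simp add: z_def)
    then have "norm x < R" if "x \<in> cube (p j) (L j)" for x
      using cell_norm[of x j] cube_cell[of j] that by fastforce
    moreover have "cube (p j) (L j) \<subseteq> \<Omega>" by (auto simp: \<Omega>_def U_def)
    ultimately show "ereal (a j) \<le> L2_opnorm (- (- \<Omega>)) (cutoff_resolvent (- (- \<Omega>)) (k j) R)"
      unfolding double_complement using \<epsilon>0(2)[OF o\<Omega> _ fr] by blast
  qed
qed

theorem theorem1p4: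
  fixes k a :: "nat \<Rightarrow> real"
  assumes "CARD('n::finite) \<ge> 2"
    and "\<forall>j. 0 < k j" and "incseq k" and "\<not> bdd_above (range k)"
    and "\<forall>j. 0 < a j" and "incseq a" and "\<not> bdd_above (range a)"
    and "summable (\<lambda>j. k j powi (- int CARD('n)))"
  shows "\<exists>\<Gamma> :: (real ^ 'n) set. compact \<Gamma> \<and> \<Gamma> \<noteq> {} \<and> connected (- \<Gamma>) \<and>
    (\<forall>R > (SUP x\<in>\<Gamma>. norm x). \<forall>j.
       L2_opnorm (- \<Gamma>) (cutoff_resolvent (- \<Gamma>) (k j) R) \<ge> ereal (a j))"
proof -
  have "DIM(real ^ 'n) \<ge> 2" "summable (\<lambda>j. inverse (k j ^ DIM(real ^ 'n)))"
    using assms(1,8) by (simp_all add: power_int_minus)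
  then obtain \<Gamma> :: "(real ^ 'n) set" where "compact \<Gamma>" "\<Gamma> \<noteq> {}" "connected (- \<Gamma>)"
    "\<And>R j. (SUP x\<in>\<Gamma>. norm x) < R \<Longrightarrow>
       ereal (a j) \<le> L2_opnorm (- \<Gamma>) (cutoff_resolvent (- \<Gamma>) (k j) R)"
    using trapping_obstacle[of k a] assms(2,3,5) by metis
  then show ?thesis by blast
qed

end
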